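(* Let $\Omega\subset\mathbb{R}^n$ be a bounded domain, $p\in[1,\infty)$, $X$ be a complete metric space, $Y$ be a separable Banach space and $\iota\colon X\to Y^*$ be an isometric embedding. Then $$R^{1,p}(\Omega;X)=\left\{f\colon\Omega\to X \mid \iota\circ f\in W^{1,p}_*(\Omega;Y^* )\right\}.$$
   Context: Banach spaces are real and $\langle\cdot,\cdot\rangle$ denotes the duality pairing. A domain is a connected open set. Let $V$ be a Banach space with dual $V^*$. $f\colon\Omega\to V$ is measurable if it is measurable with respect to the Borel $\sigma$-algebra on $V$ and the Lebesgue measurable subsets of $\Omega$; it is essentially separably valued if there is a null set $N\subset\Omega$ with $f(\Omega\setminus N)$ separable. $L^p(\Omega;V)$ consists of those $f\colon\Omega\to V$ that are measurable and essentially separably valued and for which $x\mapsto\|f(x)\|$ lies in $L^p(\Omega)$. $f\colon\Omega\to V^*$ is weak* measurable if $x\mapsto\langle v,f(x)\rangle$ is measurable for every $v\in V$. $L^p_*(\Omega;V^* )$ consists of those $f\colon\Omega\to V^*$ that are weak* measurable and for which $x\mapsto\|f(x)\|$ lies in $L^p(\Omega)$. Gelfand integral: if $f\colon\Omega\to V^*$ is weak* measurable and $\langle v,f\rangle\in L^1(\Omega)$ for every $v\in V$, then the Gelfand integral $\int_\Omega f(x)\,dx$ is the unique element of $V^*$ with $\langle v,\int_\Omega f(x)\,dx\rangle=\int_\Omega\langle v,f(x)\rangle\,dx$ for every $v\in V$. $W^{1,p}_*(\Omega;V^* )$ consists of those $f\in L^p(\Omega;V^* )$ such that for every $j=1,\dots,n$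 there is $f_j\in L^p_*(\Omega;V^* )$ with $$\int_\Omega\frac{\partial\varphi}{\partial x_j}(x)\, f(x)\,dx=-\int_\Omega\varphi(x)\, f_j(x)\,dx\quad\text{for every }\varphi\in C^\infty_0(\Omega)$$ in the sense of Gelfand integrals. The Reshetnyak–Sobolev space $R^{1,p}(\Omega;V)$ consists of those $f\in L^p(\Omega;V)$ such that: (A) for every $v^*\in V^*$ the function $x\mapsto\langle v^*,f(x)\rangle$ lies in the classical Sobolev space $W^{1,p}(\Omega)$; (B) there is $g\in L^p(\Omega)$ such that for every $v^*\in V^*$ one has $|\nabla\langle v^*,f(x)\rangle|\le\|v^*\|\cdot g(x)$ for a.e. $x\in\Omega$ (weak gradient, Euclidean norm). For a complete metric space $X$ and a bounded domain $\Omega$, $$R^{1,p}(\Omega;X):=\{f\colon\Omega\to X\mid \iota_0\circ f\in R^{1,p}(\Omega;V)\},$$ where $\iota_0\colon X\to V$ is any fixed isometric embedding of $X$ into a Banach space $V$. Such an embedding always exists (e.g. $z\mapsto d(z,\cdot)-d(\cdot,z_0)$ into the space $\ell^\infty(X)$ of bounded functions on $X$), and it is a known fact that, since $\Omega$ is bounded, the resulting set does not depend on the choice of $\iota_0$ and $V$. *)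

theory Defs
  imports "HOL-Analysis.Analysis"
begin

text \<open>
  A map defined on a set \<open>\<Omega>\<close> is represented by a total function. All notions below depend only on
  its values on \<open>\<Omega>\<close>, so membership of a total function expresses membership of its restriction
  to \<open>\<Omega>\<close>. The dual of a Banach space of type \<open>'v\<close> is the type of bounded linear maps from \<open>'v\<close> to
  \<open>real\<close> with the operator norm. As usual, elements of the spaces are functions and not
  equivalence classes.
\<close>

subsection \<open>Test functions\<close>

definition partial :: "'n::finite \<Rightarrow> (real^'n \<Rightarrow> real) \<Rightarrow> real^'n \<Rightarrow> real" where
  "partial j \<phi> x = frechet_derivative \<phi> (at x) (axis j 1)"

primrec continuously_differentiable :: "nat \<Rightarrow> (real^'n::finite \<Rightarrow> real) \<Rightarrow> bool" where
  "continuously_differentiable 0 \<phi> \<longleftrightarrow> continuous_on UNIV \<phi>"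
| "continuously_differentiable (Suc k) \<phi> \<longleftrightarrow>
     \<phi> differentiable_on UNIV \<and> (\<forall>j. continuously_differentiable k (partial j \<phi>))"

text \<open>Test functions on \<open>\<Omega>\<close> are identified with their extensions by zero to the whole space.\<close>

definition test_functions :: "(real^'n::finite) set \<Rightarrow> (real^'n \<Rightarrow> real) set" where
  "test_functions \<Omega> =
     {\<phi>. (\<forall>k. continuously_differentiable k \<phi>) \<and>
          compact (closure {x. \<phi> x \<noteq> 0}) \<and> closure {x. \<phi> x \<noteq> 0} \<subseteq> \<Omega>}"

subsection \<open>Lebesgue spaces\<close>

definition Lp :: "real \<Rightarrow> (real^'n::finite) set \<Rightarrow> (real^'n \<Rightarrow> real) set" where
  "Lp p \<Omega> = {u. u \<in> borel_measurable (lebesgue_on \<Omega>) \<and>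
                integrable (lebesgue_on \<Omega>) (\<lambda>x. \<bar>u x\<bar> powr p)}"

definition essentially_separably_valued ::
    "(real^'n::finite) set \<Rightarrow> (real^'n \<Rightarrow> 'v::topological_space) \<Rightarrow> bool" where
  "essentially_separably_valued \<Omega> f \<longleftrightarrow>
     (\<exists>N. N \<in> null_sets lebesgue \<and> N \<subseteq> \<Omega> \<and> separable_space (top_of_set (f ` (\<Omega> - N))))"

definition Lp_vec :: "real \<Rightarrow> (real^'n::finite) set \<Rightarrow> (real^'n \<Rightarrow> 'v::banach) set" where
  "Lp_vec p \<Omega> = {f. f \<in> borel_measurable (lebesgue_on \<Omega>) \<and>
                    essentially_separably_valued \<Omega> f \<and> (\<lambda>x. norm (f x)) \<in> Lp p \<Omega>}"

definition weak_star_measurable ::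
    "(real^'n::finite) set \<Rightarrow> (real^'n \<Rightarrow> ('v::banach \<Rightarrow>\<^sub>L real)) \<Rightarrow> bool" where
  "weak_star_measurable \<Omega> f \<longleftrightarrow>
     (\<forall>v. (\<lambda>x. blinfun_apply (f x) v) \<in> borel_measurable (lebesgue_on \<Omega>))"

definition Lp_star :: "real \<Rightarrow> (real^'n::finite) set \<Rightarrow> (real^'n \<Rightarrow> ('v::banach \<Rightarrow>\<^sub>L real)) set" where
  "Lp_star p \<Omega> = {f. weak_star_measurable \<Omega> f \<and> (\<lambda>x. norm (f x)) \<in> Lp p \<Omega>}"

subsection \<open>The space of functions with weak-star derivatives\<close>

definition has_gelfand_integral ::
    "(real^'n::finite \<Rightarrow> ('v::banach \<Rightarrow>\<^sub>L real)) \<Rightarrow> ('v \<Rightarrow>\<^sub>L real) \<Rightarrow> (real^'n) set \<Rightarrow> bool" where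
  "has_gelfand_integral f T \<Omega> \<longleftrightarrow>
     weak_star_measurable \<Omega> f \<and>
     (\<forall>v. integrable (lebesgue_on \<Omega>) (\<lambda>x. blinfun_apply (f x) v)) \<and>
     (\<forall>v. blinfun_apply T v = integral\<^sup>L (lebesgue_on \<Omega>) (\<lambda>x. blinfun_apply (f x) v))"

lemma has_gelfand_integral_unique:
  "has_gelfand_integral f S \<Omega> \<Longrightarrow> has_gelfand_integral f T \<Omega> \<Longrightarrow> S = T"
  by (auto simp: has_gelfand_integral_def intro: blinfun_eqI)

definition W1p_star :: "real \<Rightarrow> (real^'n::finite) set \<Rightarrow> (real^'n \<Rightarrow> ('v::banach \<Rightarrow>\<^sub>L real)) set" where
  "W1p_star p \<Omega> =
     {f. f \<in> Lp_vec p \<Omega> \<and>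
         (\<forall>j. \<exists>f'. f' \<in> Lp_star p \<Omega> \<and>
            (\<forall>\<phi>\<in>test_functions \<Omega>. \<exists>S T.
               has_gelfand_integral (\<lambda>x. partial j \<phi> x *\<^sub>R f x) S \<Omega> \<and>
               has_gelfand_integral (\<lambda>x. \<phi> x *\<^sub>R f' x) T \<Omega> \<and>
               S = - T))}"

subsection \<open>Classical Sobolev spaces\<close>

definition locally_integrable :: "(real^'n::finite) set \<Rightarrow> (real^'n \<Rightarrow> real) \<Rightarrow> bool" where
  "locally_integrable \<Omega> u \<longleftrightarrow> (\<forall>K. compact K \<and> K \<subseteq> \<Omega> \<longrightarrow> integrable (lebesgue_on K) u)"

definition has_weak_gradient ::
    "(real^'n::finite) set \<Rightarrow> (real^'n \<Rightarrow> real) \<Rightarrow> (real^'n \<Rightarrow> real^'n) \<Rightarrow> bool" where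
  "has_weak_gradient \<Omega> u G \<longleftrightarrow>
     locally_integrable \<Omega> u \<and>
     (\<forall>j. locally_integrable \<Omega> (\<lambda>x. G x $ j)) \<and>
     (\<forall>j. \<forall>\<phi>\<in>test_functions \<Omega>.
        (\<integral>x. partial j \<phi> x * u x \<partial>lebesgue_on \<Omega>) = - (\<integral>x. \<phi> x * G x $ j \<partial>lebesgue_on \<Omega>))"

definition W1p :: "real \<Rightarrow> (real^'n::finite) set \<Rightarrow> (real^'n \<Rightarrow> real) set" where
  "W1p p \<Omega> = {u. u \<in> Lp p \<Omega> \<and> (\<exists>G. has_weak_gradient \<Omega> u G \<and> (\<forall>j. (\<lambda>x. G x $ j) \<in> Lp p \<Omega>))}"

subsection \<open>Reshetnyak--Sobolev spaces\<close>

text \<open>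
  The weak gradient is unique up to null sets, so in the second condition it does not matter
  which representative \<open>G\<close> is chosen.
\<close>

definition R1p :: "real \<Rightarrow> (real^'n::finite) set \<Rightarrow> (real^'n \<Rightarrow> 'v::banach) set" where
  "R1p p \<Omega> =
     {f. f \<in> Lp_vec p \<Omega> \<and>
         (\<forall>v' :: 'v \<Rightarrow>\<^sub>L real. (\<lambda>x. blinfun_apply v' (f x)) \<in> W1p p \<Omega>) \<and>
         (\<exists>g\<in>Lp p \<Omega>. \<forall>v' :: 'v \<Rightarrow>\<^sub>L real. \<exists>G.
            has_weak_gradient \<Omega> (\<lambda>x. blinfun_apply v' (f x)) G \<and>
            (AE x in lebesgue_on \<Omega>. norm (G x) \<le> norm v' * g x))}"

definition isometric_embedding :: "('x::metric_space \<Rightarrow> 'y::metric_space) \<Rightarrow> bool" where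
  "isometric_embedding i \<longleftrightarrow> (\<forall>x y. dist (i x) (i y) = dist x y)"

text \<open>
  The metric-valued space is defined through an isometric embedding \<open>i\<close> into a Banach space, here
  an explicit parameter. On bounded domains it does not depend on \<open>i\<close>. An embedding always
  exists, see below.
\<close>

definition R1p_metric ::
    "('x::complete_space \<Rightarrow> 'v::banach) \<Rightarrow> real \<Rightarrow> (real^'n::finite) set \<Rightarrow> (real^'n \<Rightarrow> 'x) set" where
  "R1p_metric i p \<Omega> = {f. i \<circ> f \<in> R1p p \<Omega>}"

lemma isometric_embedding_exists:
  "\<exists>i :: 'x::metric_space \<Rightarrow> ('x \<Rightarrow>\<^sub>C real). isometric_embedding i"
proof -
  fix z0 :: 'x
  define k where "k z = (\<lambda>w. dist z w - dist w z0)" for z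
  have bd: "\<bar>k z w\<bar> \<le> dist z z0" for z w
    unfolding k_def by (metis abs_dist_diff_le dist_commute)
  have k: "k z \<in> bcontfun" for z
    unfolding bcontfun_def
    by (auto simp: k_def intro!: continuous_intros)
       (rule boundedI[of _ "dist z z0"], use bd in \<open>auto simp: k_def\<close>)
  define i where "i z = Bcontfun (k z)" for z
  have i: "apply_bcontfun (i z) w = k z w" for z w
    by (simp add: i_def Bcontfun_inverse k)
  have "dist (i x) (i y) = dist x y" for x y
  proof (rule antisym)
    show "dist (i x) (i y) \<le> dist x y"
      by (rule dist_bound)
         (simp add: i k_def dist_real_def, metis abs_dist_diff_le dist_commute)
    show "dist x y \<le> dist (i x) (i y)"
      using dist_bounded[of "i x" y "i y"] by (simp add: i k_def dist_real_def)
  qed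
  then show ?thesis
    unfolding isometric_embedding_def by blast
qed

end

theory Submission
  imports Defs "HOL-Computational_Algebra.Polynomial"
begin

text \<open>
  Let \<open>e\<^sub>j\<close> be the coordinate vectors. A nonnegative integrable function \<open>g\<close> bounds the
  displacement of \<open>f\<close> on \<open>\<Omega>\<close> if for all \<open>j\<close> and \<open>t > 0\<close>, for almost every \<open>x\<close> whose segment
  \<open>[x, x + t e\<^sub>j]\<close> lies in \<open>\<Omega>\<close>, the distance from \<open>f x\<close> to \<open>f (x + t e\<^sub>j)\<close> is at most the
  integral of \<open>g (x + s e\<^sub>j)\<close> over \<open>s \<in> [0, t]\<close> (\<open>displacement_bound\<close>). This condition speaks of
  distances only, so it holds for \<open>\<iota>\<^sub>0 \<circ> f\<close> if and only if it holds for \<open>\<iota> \<circ> f\<close>, and it is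
  inherited by compositions with Lipschitz functions. The theorem follows because each of the two
  spaces consists of those members of the vector-valued \<open>L\<^sup>p\<close> space whose displacement is bounded by
  a function that agrees almost everywhere on \<open>\<Omega>\<close> with one in \<open>L\<^sup>p\<close>, and because membership in the
  vector-valued \<open>L\<^sup>p\<close> space does not depend on the embedding: the norms of two embeddings differ by a
  bounded function, and bounded measurable functions on the bounded set \<open>\<Omega>\<close> belong to \<open>L\<^sup>p\<close>.

  The scalar case is the core. If \<open>u\<close> is integrable, then \<open>u\<close> has a weak \<open>j\<close>-th derivative of
  modulus at most \<open>g\<close> if and only if \<open>g\<close> bounds the increments of \<open>u\<close> in direction \<open>e\<^sub>j\<close>.
  For one direction (\<open>segment_bound_of_weak_derivative_bound\<close>), average a test function \<open>\<phi>\<close> backwards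
  along a segment of length \<open>t\<close>. The average is a test function with \<open>j\<close>-th derivative
  \<open>\<phi> x - \<phi> (x - t e\<^sub>j)\<close>, so testing \<open>u\<close> against it tests the increments of \<open>u\<close> against \<open>\<phi>\<close>, and
  a one-sided du Bois-Reymond lemma removes \<open>\<phi>\<close>. For the other direction, difference quotients of
  \<open>\<phi>\<close> give \<open>\<bar>\<integral> \<partial>\<^sub>j\<phi> u\<bar> \<le> \<integral> \<bar>\<phi>\<bar> g\<close> (\<open>weak_derivative_bound_of_segment_bound\<close>), and a functional
  with such a bound is represented by a function of modulus at most \<open>g\<close>
  (\<open>weak_derivative_of_weak_derivative_bound\<close>). The representing function is found by minimising a
  quadratic functional in \<open>L\<^sup>2(g dx)\<close>, a form of the Riesz representation theorem.

  A member of either space has bounded displacement because the distance of two values is a supremum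
  of countably many functionals, for each of which the scalar case applies. For \<open>W\<^sup>1\<^sup>,\<^sup>p\<close> these are
  the evaluations at a countable dense subset of \<open>Y\<close>. For \<open>R\<^sup>1\<^sup>,\<^sup>p\<close> they are the functionals, given by
  the Hahn-Banach theorem, that norm the differences of points of a countable dense subset of the
  essential range.

  Conversely, let \<open>g\<close> bound the displacement of \<open>f\<close>. Composing \<open>f\<close> with a bounded functional, which is
  Lipschitz, and applying the scalar case yields the weak gradients that \<open>R\<^sup>1\<^sup>,\<^sup>p\<close> asks for. For
  \<open>W\<^sup>1\<^sup>,\<^sup>p\<close> it yields a weak derivative \<open>G\<^sub>v\<close> of \<open>\<langle>v, f\<rangle>\<close> with \<open>\<bar>G\<^sub>v\<bar> \<le> \<parallel>v\<parallel> g\<close> for every \<open>v\<close>. Since weak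
  derivatives are unique, \<open>v \<mapsto> G\<^sub>v x\<close> is for almost every \<open>x\<close> linear over the rationals on a
  countable dense rational subspace of \<open>Y\<close>, so it extends to an element of \<open>Y\<^sup>*\<close> of norm at most
  \<open>g x\<close> (\<open>weak_star_function_from_dense_subspace\<close>). These elements form the weak-star derivative.
\<close>

section \<open>Smooth functions\<close>

definition smooth :: "(real^'n::finite \<Rightarrow> real) \<Rightarrow> bool" where
  "smooth \<phi> \<longleftrightarrow> (\<forall>k. continuously_differentiable k \<phi>)"

lemma partial_eq: "(\<phi> has_derivative D) (at x) \<Longrightarrow> partial j \<phi> x = D (axis j 1)"
  unfolding partial_def using frechet_derivative_at by metis

lemma continuously_differentiable_SucD:
  "continuously_differentiable (Suc k) \<phi> \<Longrightarrow> continuously_differentiable k \<phi>"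
  by (induction k arbitrary: \<phi>) (auto simp: differentiable_imp_continuous_on)

lemma smooth_unfold:
  "smooth \<phi> \<longleftrightarrow> \<phi> differentiable_on UNIV \<and> (\<forall>j. smooth (partial j \<phi>))"
proof
  assume s: "smooth \<phi>"
  then have "continuously_differentiable (Suc k) \<phi>" for k unfolding smooth_def by blast
  then show "\<phi> differentiable_on UNIV \<and> (\<forall>j. smooth (partial j \<phi>))"
    by (simp add: smooth_def)
next
  assume a: "\<phi> differentiable_on UNIV \<and> (\<forall>j. smooth (partial j \<phi>))"
  have "continuously_differentiable k \<phi>" for k
    using a by (cases k) (auto simp: smooth_def differentiable_imp_continuous_on)
  then show "smooth \<phi>" by (simp add: smooth_def)
qed

text \<open>
  Smoothness is a greatest fixed point: a class of differentiable functions that is closed under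
  partial derivatives consists of smooth functions. The cut-off functions and the averages along
  segments belong to such classes.
\<close>

lemma smooth_coinduct:
  assumes "P \<phi>"
    and step: "\<And>\<phi>. P \<phi> \<Longrightarrow> \<phi> differentiable_on UNIV \<and> (\<forall>j. P (partial j \<phi>))"
  shows "smooth \<phi>"
proof -
  have "P \<phi> \<Longrightarrow> continuously_differentiable k \<phi>" for k \<phi>
    by (induction k arbitrary: \<phi>)
       (use step in \<open>auto dest: differentiable_imp_continuous_on\<close>)
  then show ?thesis using assms(1) by (simp add: smooth_def)
qed

lemma smooth_partial: "smooth \<phi> \<Longrightarrow> smooth (partial j \<phi>)"
  using smooth_unfold by blast

lemma smooth_has_derivative:
  "smooth \<phi> \<Longrightarrow> (\<phi> has_derivative frechet_derivative \<phi> (at x)) (at x)"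
  by (meson UNIV_I differentiable_on_def frechet_derivative_works smooth_unfold
      differentiable_on_eq_differentiable_at open_UNIV)

lemma smooth_continuous: "smooth \<phi> \<Longrightarrow> continuous_on S \<phi>"
  by (meson continuous_on_subset differentiable_imp_continuous_on smooth_unfold subset_UNIV)

lemma partial_add_differentiable:
  "\<phi> differentiable_on UNIV \<Longrightarrow> \<psi> differentiable_on UNIV \<Longrightarrow>
    partial j (\<lambda>x. \<phi> x + \<psi> x) = (\<lambda>x. partial j \<phi> x + partial j \<psi> x)"
  by (rule ext, subst partial_eq[OF has_derivative_add])
     (auto simp: partial_def differentiable_on_def frechet_derivative_works)

lemma partial_add:
  "smooth \<phi> \<Longrightarrow> smooth \<psi> \<Longrightarrow> partial j (\<lambda>x. \<phi> x + \<psi> x) = (\<lambda>x. partial j \<phi> x + partial j \<psi> x)"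
  using smooth_unfold partial_add_differentiable by blast

lemma partial_mult_differentiable:
  "\<phi> differentiable_on UNIV \<Longrightarrow> \<psi> differentiable_on UNIV \<Longrightarrow>
    partial j (\<lambda>x. \<phi> x * \<psi> x) = (\<lambda>x. \<phi> x * partial j \<psi> x + partial j \<phi> x * \<psi> x)"
  by (rule ext, subst partial_eq[OF has_derivative_mult])
     (auto simp: partial_def differentiable_on_def frechet_derivative_works)

lemma continuously_differentiable_add:
  "continuously_differentiable k \<phi> \<Longrightarrow> continuously_differentiable k \<psi> \<Longrightarrow>
    continuously_differentiable k (\<lambda>x. \<phi> x + \<psi> x)"
  by (induction k arbitrary: \<phi> \<psi>)
     (auto simp: partial_add_differentiable intro!: continuous_intros)

lemma continuously_differentiable_mult:
  "continuously_differentiable k \<phi> \<Longrightarrow> continuously_differentiable k \<psi> \<Longrightarrow>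
    continuously_differentiable k (\<lambda>x. \<phi> x * \<psi> x)"
proof (induction k arbitrary: \<phi> \<psi>)
  case 0
  then show ?case by (auto intro!: continuous_intros)
next
  case (Suc k)
  have "continuously_differentiable k \<phi>" "continuously_differentiable k \<psi>"
    using Suc.prems continuously_differentiable_SucD by blast+
  with Suc show ?case
    by (auto simp: partial_mult_differentiable intro!: continuously_differentiable_add)
qed

lemma smooth_add: "smooth \<phi> \<Longrightarrow> smooth \<psi> \<Longrightarrow> smooth (\<lambda>x. \<phi> x + \<psi> x)"
  by (simp add: smooth_def continuously_differentiable_add)

lemma smooth_mult: "smooth \<phi> \<Longrightarrow> smooth \<psi> \<Longrightarrow> smooth (\<lambda>x. \<phi> x * \<psi> x)"
  by (simp add: smooth_def continuously_differentiable_mult)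

lemma smooth_const: "smooth (\<lambda>x::real^'n::finite. c)"
proof (rule smooth_coinduct[where P = "\<lambda>\<phi>. \<exists>c. \<phi> = (\<lambda>x. c)"])
  fix \<phi> :: "real^'n \<Rightarrow> real"
  assume "\<exists>c. \<phi> = (\<lambda>x. c)"
  then obtain c where c: "\<phi> = (\<lambda>x. c)" by blast
  have "partial j \<phi> = (\<lambda>x. 0)" for j
    by (rule ext, subst partial_eq[where D = "\<lambda>x. 0"]) (auto simp: c)
  with c show "\<phi> differentiable_on UNIV \<and> (\<forall>j. \<exists>c. partial j \<phi> = (\<lambda>x. c))"
    by auto
qed auto

lemma partial_cmult:
  "smooth \<phi> \<Longrightarrow> partial j (\<lambda>x. c * \<phi> x) = (\<lambda>x. c * partial j \<phi> x)"
  by (rule ext, subst partial_eq[OF has_derivative_mult_right[OF smooth_has_derivative]])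
     (auto simp: partial_def)

lemma smooth_diff: "smooth \<phi> \<Longrightarrow> smooth \<psi> \<Longrightarrow> smooth (\<lambda>x. \<phi> x - \<psi> x)"
  using smooth_add[of \<phi> "\<lambda>x. (- 1) * \<psi> x"] smooth_mult[OF smooth_const, of \<psi> "- 1"] by simp

lemma smooth_prod: "(\<And>i. i \<in> I \<Longrightarrow> smooth (F i)) \<Longrightarrow> smooth (\<lambda>x. \<Prod>i\<in>I. F i x)"
  by (induction I rule: infinite_finite_induct) (auto simp: smooth_const smooth_mult)

section \<open>Smooth cut-off functions and test functions\<close>

text \<open>
  For \<open>q = 1\<close> this is the standard smooth function that vanishes to infinite order at \<open>0\<close>. The
  polynomial factor makes the family closed under differentiation.
\<close>

definition flat_exp :: "real poly \<Rightarrow> real \<Rightarrow> real" where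
  "flat_exp q t = (if t > 0 then poly q (1 / t) * exp (- 1 / t) else 0)"

lemma poly_times_exp_at_top: "((\<lambda>s. poly q s * exp (- s)) \<longlongrightarrow> 0) at_top" for q :: "real poly"
proof (induction q)
  case 0
  then show ?case by simp
next
  case (pCons a q)
  have e: "((\<lambda>s::real. exp (- s)) \<longlongrightarrow> 0) at_top"
    using tendsto_power_div_exp_0[of 0] by (simp add: exp_minus field_simps)
  have main: "((\<lambda>s. poly q s * s * exp (- s)) \<longlongrightarrow> 0) at_top" for q :: "real poly"
  proof -
    have "((\<lambda>s. \<Sum>i\<le>degree q. coeff q i * (s ^ (Suc i) / exp s)) \<longlongrightarrow> (\<Sum>i\<le>degree q. coeff q i * 0)) at_top"
      by (intro tendsto_sum tendsto_mult tendsto_const tendsto_power_div_exp_0)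
    also have "(\<lambda>s. \<Sum>i\<le>degree q. coeff q i * (s ^ (Suc i) / exp s)) = (\<lambda>s. poly q s * s * exp (- s))"
      by (auto simp: poly_altdef sum_distrib_left sum_distrib_right exp_minus field_simps sum_divide_distrib)
    finally show ?thesis by simp
  qed
  have "((\<lambda>s. a * exp (- s) + poly q s * s * exp (- s)) \<longlongrightarrow> a * 0 + 0) at_top"
    by (intro tendsto_intros e main)
  then show ?case by (simp add: algebra_simps)
qed

lemma flat_exp_tendsto_0: "(flat_exp q \<longlongrightarrow> 0) (at 0)"
proof -
  have "((\<lambda>t. poly q (inverse t) * exp (- inverse t)) \<longlongrightarrow> 0) (at_right 0)"
    using filterlim_compose[OF poly_times_exp_at_top filterlim_inverse_at_top_right] .
  then have "(flat_exp q \<longlongrightarrow> 0) (at_right 0)"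
    by (rule Lim_transform_eventually)
       (auto simp: flat_exp_def eventually_at_filter field_simps inverse_eq_divide)
  moreover have "(flat_exp q \<longlongrightarrow> 0) (at_left 0)"
    by (rule Lim_transform_eventually[OF tendsto_const[of 0]])
       (auto simp: flat_exp_def eventually_at_filter)
  ultimately show ?thesis
    using filterlim_split_at by blast
qed

lemma flat_exp_DERIV:
  "DERIV (flat_exp q) t :> flat_exp (pCons 0 (pCons 0 (q - pderiv q))) t"
proof -
  consider "t > 0" | "t < 0" | "t = 0" by linarith
  then show ?thesis
  proof cases
    case 1
    have "DERIV (\<lambda>t. poly q (1 / t) * exp (- 1 / t)) t :> flat_exp (pCons 0 (pCons 0 (q - pderiv q))) t"
      using 1 by (auto intro!: derivative_eq_intros DERIV_chain2[OF poly_DERIV]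
          simp: flat_exp_def field_simps power2_eq_square)
    then show ?thesis
      by (rule has_field_derivative_transform_within_open[where S = "{0<..}"]) (use 1 in \<open>auto simp: flat_exp_def\<close>)
  next
    case 2
    have "DERIV (\<lambda>t. 0) t :> flat_exp (pCons 0 (pCons 0 (q - pderiv q))) t"
      using 2 by (auto simp: flat_exp_def)
    then show ?thesis
      by (rule has_field_derivative_transform_within_open[where S = "{..<0}"]) (use 2 in \<open>auto simp: flat_exp_def\<close>)
  next
    case 3
    have "(\<lambda>h. (flat_exp q (0 + h) - flat_exp q 0) / h) = flat_exp (pCons 0 q)"
      by (auto simp: flat_exp_def)
    then show ?thesis
      using flat_exp_tendsto_0[of "pCons 0 q"] 3 by (simp add: DERIV_def) (simp add: flat_exp_def)
  qed
qed

text \<open>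
  The functions \<open>c * flat_exp q (a * x $ i + b)\<close>, with \<open>c\<close> and \<open>q\<close> varying, are closed under partial
  derivatives.
\<close>

lemma smooth_flat_exp: "smooth (\<lambda>x::real^'n::finite. flat_exp q (a * x $ i + b))"
proof -
  have "smooth (\<lambda>x::real^'n. 1 * flat_exp q (a * x $ i + b))"
  proof (rule smooth_coinduct[where P = "\<lambda>\<phi>. \<exists>c q. \<phi> = (\<lambda>x. c * flat_exp q (a * x $ i + b))"])
    fix \<phi> :: "real^'n \<Rightarrow> real"
    assume "\<exists>c q. \<phi> = (\<lambda>x. c * flat_exp q (a * x $ i + b))"
    then obtain c q where \<phi>: "\<phi> = (\<lambda>x. c * flat_exp q (a * x $ i + b))" by blast
    define q' where "q' = pCons 0 (pCons 0 (q - pderiv q))"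
    have d: "(flat_exp q has_derivative (\<lambda>h. h * flat_exp q' t)) (at t)" for t
      using flat_exp_DERIV[of q t] by (simp add: has_field_derivative_def q'_def mult.commute[of _ "flat_exp _ _"])
    have D: "(\<phi> has_derivative (\<lambda>h. c * ((a * h $ i) * flat_exp q' (a * x $ i + b)))) (at x)" for x
      unfolding \<phi>
      by (rule has_derivative_mult_right, rule has_derivative_compose[OF _ d, where f = "\<lambda>x. a * x $ i + b"])
         (auto intro!: derivative_eq_intros bounded_linear_imp_has_derivative bounded_linear_vec_nth)
    have "partial j \<phi> = (\<lambda>x. (c * a * axis j 1 $ i) * flat_exp q' (a * x $ i + b))" for j
      by (rule ext) (simp add: partial_eq[OF D])
    moreover have "\<phi> differentiable_on UNIV"
      using D by (auto simp: differentiable_on_def differentiable_def)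
    ultimately show "\<phi> differentiable_on UNIV \<and> (\<forall>j. \<exists>c q. partial j \<phi> = (\<lambda>x. c * flat_exp q (a * x $ i + b)))"
      by blast
  qed blast
  then show ?thesis by simp
qed

text \<open>
  A cut-off for the box with corners \<open>a\<close> and \<open>b\<close>: it is supported in the closed box and increases to the
  indicator of the open box as \<open>m\<close> tends to infinity.
\<close>

definition bump :: "nat \<Rightarrow> real^'n::finite \<Rightarrow> real^'n \<Rightarrow> real^'n \<Rightarrow> real" where
  "bump m a b x = (\<Prod>i\<in>UNIV. flat_exp 1 (real m * (x $ i - a $ i)) * flat_exp 1 (real m * (b $ i - x $ i)))"

lemma smooth_bump: "smooth (bump m a b)"
proof -
  have "smooth (\<lambda>x. flat_exp 1 (real m * x $ i + - (real m * a $ i)) *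
      flat_exp 1 (- real m * x $ i + real m * b $ i))" for i
    by (intro smooth_mult smooth_flat_exp)
  then have "smooth (\<lambda>x. \<Prod>i\<in>UNIV. flat_exp 1 (real m * x $ i + - (real m * a $ i)) *
      flat_exp 1 (- real m * x $ i + real m * b $ i))"
    by (rule smooth_prod)
  then show ?thesis
    unfolding bump_def[abs_def] by (simp add: algebra_simps)
qed

lemma flat_exp_1_bounds: "0 \<le> flat_exp 1 t" "flat_exp 1 t \<le> 1"
  by (auto simp: flat_exp_def)

lemma bump_bounds: "0 \<le> bump m a b x" "bump m a b x \<le> 1"
  unfolding bump_def
  by (auto intro!: prod_nonneg prod_le_1 mult_nonneg_nonneg mult_le_one simp: flat_exp_1_bounds)

lemma bump_outside: "x \<notin> box a b \<Longrightarrow> bump m a b x = 0"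
proof -
  assume "x \<notin> box a b"
  then obtain i where "\<not> (a $ i < x $ i \<and> x $ i < b $ i)" by (auto simp: mem_box_cart)
  then have "flat_exp 1 (real m * (x $ i - a $ i)) * flat_exp 1 (real m * (b $ i - x $ i)) = 0"
    by (auto simp: flat_exp_def zero_less_mult_iff)
  then show ?thesis unfolding bump_def by (meson UNIV_I finite prod_zero)
qed

lemma bump_tendsto_1:
  assumes "x \<in> box a b"
  shows "(\<lambda>m. bump m a b x) \<longlonglongrightarrow> 1"
proof -
  have l: "(\<lambda>m. flat_exp 1 (real m * c)) \<longlonglongrightarrow> 1" if "c > 0" for c
  proof -
    have "(\<lambda>m. exp (- (1/c) * (1 / real m))) \<longlonglongrightarrow> exp (- (1/c) * 0)"
      by (intro tendsto_intros lim_1_over_n)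
    moreover have "\<forall>\<^sub>F m in sequentially. exp (- (1/c) * (1 / real m)) = flat_exp 1 (real m * c)"
      using eventually_gt_at_top[of 0] by eventually_elim (use that in \<open>auto simp: flat_exp_def field_simps\<close>)
    ultimately show ?thesis
      using Lim_transform_eventually by fastforce
  qed
  have "(\<lambda>m. bump m a b x) \<longlonglongrightarrow> (\<Prod>i\<in>(UNIV::'a set). 1 * 1)"
    unfolding bump_def using assms
    by (intro tendsto_prod tendsto_mult l) (auto simp: mem_box_cart)
  then show ?thesis by simp
qed

lemma test_functionsI:
  assumes "smooth \<phi>" "compact K" "K \<subseteq> \<Omega>" "\<And>x. x \<notin> K \<Longrightarrow> \<phi> x = 0"
  shows "\<phi> \<in> test_functions \<Omega>"
proof -
  have "closure {x. \<phi> x \<noteq> 0} \<subseteq> K"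
    using assms by (intro closure_minimal) (auto intro: compact_imp_closed)
  moreover from this have "compact (closure {x. \<phi> x \<noteq> 0})"
    using \<open>compact K\<close> by (meson bounded_subset closed_closure compact_eq_bounded_closed)
  ultimately show ?thesis
    using assms by (auto simp: test_functions_def smooth_def)
qed

lemma test_function_smooth: "\<phi> \<in> test_functions \<Omega> \<Longrightarrow> smooth \<phi>"
  by (simp add: test_functions_def smooth_def)

lemma test_functionE:
  assumes "\<phi> \<in> test_functions \<Omega>"
  obtains K where "compact K" "K \<subseteq> \<Omega>" "\<And>x. x \<notin> K \<Longrightarrow> \<phi> x = 0" "\<And>j x. x \<notin> K \<Longrightarrow> partial j \<phi> x = 0"
proof
  let ?K = "closure {x. \<phi> x \<noteq> 0}"
  show "compact ?K" "?K \<subseteq> \<Omega>" using assms by (auto simp: test_functions_def)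
  show z: "\<phi> x = 0" if "x \<notin> ?K" for x
    using that closure_subset[of "{x. \<phi> x \<noteq> 0}"] by auto
  show "partial j \<phi> x = 0" if "x \<notin> ?K" for j x
  proof -
    have "((\<lambda>x. 0::real) has_derivative (\<lambda>h. 0)) (at x)" by (rule has_derivative_const)
    then have "(\<phi> has_derivative (\<lambda>h. 0)) (at x)"
    proof (rule has_derivative_transform_within_open[where s = "- ?K"])
      show "open (- ?K)" by (intro open_Compl closed_closure)
    
      show "x \<in> - ?K" using that by blast
      show "0 = \<phi> y" if "y \<in> - ?K" for y using z[of y] that by (metis ComplD)
    qed
    from partial_eq[OF this] show "partial j \<phi> x = 0" by (rule trans) (rule refl)
  qed
qed

lemma test_function_support:
  assumes "\<phi> \<in> test_functions \<Omega>"
  shows "\<exists>K. compact K \<and> K \<subseteq> \<Omega> \<and> (\<forall>x. x \<notin> K \<longrightarrow> \<phi> x = 0)"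
  using test_functionE[OF assms] by metis

lemma test_function_partial: "\<phi> \<in> test_functions \<Omega> \<Longrightarrow> partial j \<phi> \<in> test_functions \<Omega>"
  by (metis test_functionE test_functionsI test_function_smooth smooth_partial)

lemma test_function_bounded:
  assumes "\<phi> \<in> test_functions \<Omega>"
  obtains B where "B \<ge> 0" "\<And>x. \<bar>\<phi> x\<bar> \<le> B"
proof -
  obtain K where K: "compact K" "\<And>x. x \<notin> K \<Longrightarrow> \<phi> x = 0"
    using test_functionE[OF assms] by metis
  have "bounded (\<phi> ` K)"
    using K smooth_continuous[OF test_function_smooth[OF assms]]
    by (intro compact_imp_bounded compact_continuous_image)
  then obtain B where "\<And>x. x \<in> K \<Longrightarrow> \<bar>\<phi> x\<bar> \<le> B" by (auto simp: bounded_iff)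
  with K(2) have "\<bar>\<phi> x\<bar> \<le> max 0 B" for x
    by (cases "x \<in> K") (auto simp: le_max_iff_disj)
  then show ?thesis using that[of "max 0 B"] by auto
qed

lemma smooth_measurable:
  "smooth \<phi> \<Longrightarrow> \<phi> \<in> borel_measurable borel" "smooth \<phi> \<Longrightarrow> \<phi> \<in> borel_measurable lebesgue"
  "smooth \<phi> \<Longrightarrow> \<phi> \<in> borel_measurable (lebesgue_on S)"
proof -
  show m: "smooth \<phi> \<Longrightarrow> \<phi> \<in> borel_measurable borel"
    by (intro borel_measurable_continuous_onI smooth_continuous)
  then show "smooth \<phi> \<Longrightarrow> \<phi> \<in> borel_measurable lebesgue"
    by (simp add: measurable_completion)
  then show "smooth \<phi> \<Longrightarrow> \<phi> \<in> borel_measurable (lebesgue_on S)"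
    by (rule measurable_restrict_space1)
qed

lemma integrable_bounded_mult:
  fixes u :: "'a \<Rightarrow> real"
  assumes "integrable M u" "\<phi> \<in> borel_measurable M" "\<And>x. \<bar>\<phi> x\<bar> \<le> B"
  shows "integrable M (\<lambda>x. \<phi> x * u x)"
proof (rule Bochner_Integration.integrable_bound[where f = "\<lambda>x. B * \<bar>u x\<bar>"])
  show "AE x in M. norm (\<phi> x * u x) \<le> norm (B * \<bar>u x\<bar>)"
    using assms(3) by (intro AE_I2) (auto simp: abs_mult intro!: mult_right_mono, meson abs_ge_self order_trans)
qed (use assms in auto)

lemma test_function_integrable_mult:
  assumes "\<phi> \<in> test_functions \<Omega>" "integrable lebesgue u"
  shows "integrable lebesgue (\<lambda>x. \<phi> x * u x)"
  using assms test_function_bounded[OF assms(1)] smooth_measurable(2)[OF test_function_smooth[OF assms(1)]]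
  by (metis integrable_bounded_mult)

lemma test_function_add:
  assumes "\<phi> \<in> test_functions \<Omega>" "\<psi> \<in> test_functions \<Omega>"
  shows "(\<lambda>x. \<phi> x + \<psi> x) \<in> test_functions \<Omega>"
proof -
  obtain K where K: "compact K" "K \<subseteq> \<Omega>" "\<And>x. x \<notin> K \<Longrightarrow> \<phi> x = 0" using test_functionE[OF assms(1)] by metis
  obtain L where L: "compact L" "L \<subseteq> \<Omega>" "\<And>x. x \<notin> L \<Longrightarrow> \<psi> x = 0" using test_functionE[OF assms(2)] by metis
  show ?thesis
    by (rule test_functionsI[where K = "K \<union> L"])
       (use K L assms in \<open>auto simp: smooth_add test_function_smooth\<close>)
qed

lemma test_function_cmult:
  assumes "\<phi> \<in> test_functions \<Omega>"
  shows "(\<lambda>x. c * \<phi> x) \<in> test_functions \<Omega>"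
proof -
  obtain K where K: "compact K" "K \<subseteq> \<Omega>" "\<And>x. x \<notin> K \<Longrightarrow> \<phi> x = 0" using test_functionE[OF assms] by metis
  show ?thesis
    by (rule test_functionsI[where K = K])
       (use K assms in \<open>auto simp: smooth_mult smooth_const test_function_smooth\<close>)
qed

text \<open>
  An open set is a countable union of open boxes whose closures it contains. If \<open>b\<^sub>k\<close> are the cut-offs of
  the boxes, \<open>1 - (\<Prod>k<m. 1 - b\<^sub>k)\<close> is supported in the first \<open>m\<close> closed boxes, and it tends to \<open>1\<close>
  wherever one of the cut-offs does.
\<close>

lemma test_functions_exhaust_open:
  fixes U :: "(real^'n::finite) set"
  assumes "open U"
  obtains \<phi> where "\<And>m::nat. \<phi> m \<in> test_functions U" "\<And>m x. 0 \<le> \<phi> m x" "\<And>m x. \<phi> m x \<le> 1"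
    "\<And>x. (\<lambda>m. \<phi> m x) \<longlonglongrightarrow> indicator U x"
proof -
  define F where "F = {(a,b). cbox a b \<subseteq> U}"
  have ex: "\<exists>a b. x \<in> box a b \<and> cbox a b \<subseteq> U" if xU: "x \<in> U" for x
    by (rule open_contains_cbox[OF assms xU]) (intro exI conjI)
  then have UF: "U = \<Union>((\<lambda>(a,b). box a b) ` F)"
  proof (intro equalityI subsetI)
    fix x assume "x \<in> U"
    then obtain a b where "x \<in> box a b" "cbox a b \<subseteq> U" using ex by blast
    then show "x \<in> \<Union>((\<lambda>(a,b). box a b) ` F)" by (auto simp: F_def)
  next
    fix x assume "x \<in> \<Union>((\<lambda>(a,b). box a b) ` F)"
    then show "x \<in> U" using box_subset_cbox by (auto simp: F_def)
  qed
  obtain F' where F': "F' \<subseteq> (\<lambda>(a,b). box a b) ` F" "countable F'" "\<Union>F' = \<Union>((\<lambda>(a,b). box a b) ` F)"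
    by (rule Lindelof[of "(\<lambda>(a,b). box a b) ` F"]) auto
  define X :: "nat \<Rightarrow> _" where "X = from_nat_into (insert {} F')"
  have X: "range X = insert {} F'"
    unfolding X_def using F' by (intro range_from_nat_into) auto
  have "\<exists>a b. X k = box a b \<and> cbox a b \<subseteq> U" for k :: nat
  proof (cases "X k = {}")
    case True
    have "box 1 (0::real^'n) = {}" "cbox 1 (0::real^'n) = {}" by (auto simp: interval_eq_empty_cart)
    with True show ?thesis by (metis empty_subsetI)
  next
    case False
    then have "X k \<in> F'" using X by (metis insertE rangeI)
    then have "X k \<in> (\<lambda>(a,b). box a b) ` F" using F'(1) by blast
    then show ?thesis by (auto simp: F_def)
  qed
  then obtain A B where AB: "\<And>k. X k = box (A k) (B k)" "\<And>k. cbox (A k) (B k) \<subseteq> U"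
    by metis
  have "U = \<Union>(range X)"
    using UF F'(3) unfolding X by (metis Union_insert Un_empty_left)
  then have U: "x \<in> U \<longleftrightarrow> (\<exists>k. x \<in> box (A k) (B k))" for x
    by (auto simp: AB(1))
  define \<phi> where "\<phi> m x = 1 - (\<Prod>k<m. (1 - bump m (A k) (B k) x))" for m :: nat and x
  have pr: "0 \<le> (\<Prod>k<m. (1 - bump m (A k) (B k) x))" "(\<Prod>k<m. (1 - bump m (A k) (B k) x)) \<le> 1" for m x
    by (auto intro!: prod_nonneg prod_le_1 simp: bump_bounds)
  show ?thesis
  proof (rule that[of \<phi>])
    fix m :: nat
    show "\<phi> m \<in> test_functions U"
    proof (rule test_functionsI[where K = "\<Union>k<m. cbox (A k) (B k)"])
      show "smooth (\<phi> m)"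
        unfolding \<phi>_def by (intro smooth_diff smooth_prod smooth_const smooth_bump)
      show "\<phi> m x = 0" if "x \<notin> (\<Union>k<m. cbox (A k) (B k))" for x
      proof -
        have "bump m (A k) (B k) x = 0" if "k < m" for k
          using \<open>x \<notin> _\<close> that box_subset_cbox by (intro bump_outside) blast
        then show ?thesis by (simp add: \<phi>_def)
      qed
    qed (use AB in auto)
    fix x
    show "0 \<le> \<phi> m x" "\<phi> m x \<le> 1" using pr[where m=m and x=x] by (auto simp: \<phi>_def)
  next
    fix x
    show "(\<lambda>m. \<phi> m x) \<longlonglongrightarrow> indicator U x"
    proof (cases "x \<in> U")
      case False
      then have "bump m (A k) (B k) x = 0" for m k using U by (intro bump_outside) auto
      with False show ?thesis by (simp add: \<phi>_def)
    next
      case True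
      then obtain k where k: "x \<in> box (A k) (B k)" using U by blast
      have "(\<lambda>m. 1 - (1 - bump m (A k) (B k) x)) \<longlonglongrightarrow> 1"
        using bump_tendsto_1[OF k] by simp
      moreover have "\<forall>\<^sub>F m in sequentially. 1 - (1 - bump m (A k) (B k) x) \<le> \<phi> m x"
        using eventually_gt_at_top[of k]
      proof eventually_elim
        case (elim m)
        have "(\<Prod>k<m. (1 - bump m (A k) (B k) x)) =
           (1 - bump m (A k) (B k) x) * (\<Prod>i\<in>{..<m} - {k}. (1 - bump m (A i) (B i) x))"
          using elim by (intro prod.remove) auto
        also have "\<dots> \<le> (1 - bump m (A k) (B k) x) * 1"
          by (intro mult_left_mono prod_le_1) (auto simp: bump_bounds)
        finally show ?case by (simp add: \<phi>_def)
      qed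
      moreover have "\<phi> m x \<le> 1" for m using pr[where m=m and x=x] by (auto simp: \<phi>_def)
      ultimately have "(\<lambda>m. \<phi> m x) \<longlonglongrightarrow> 1"
        by (rule_tac tendsto_sandwich[where h = "\<lambda>m. 1"]) (assumption | simp)+
      with True show ?thesis by simp
    qed
  qed
qed

text \<open>
  Exhausting open sets by test functions shows that the integral of \<open>w\<close> over every open subset of \<open>\<Omega>\<close>
  is nonnegative. Approximating the set \<open>{w < 0}\<close> from outside by open sets extends this to that set, so
  the set is null. The one-sided form yields pointwise bounds as well as uniqueness of weak derivatives.
\<close>

lemma du_Bois_Reymond_nonneg:
  fixes w :: "real^'n::finite \<Rightarrow> real"
  assumes "open \<Omega>" and w: "integrable lebesgue w"
    and pos: "\<And>\<phi>. \<phi> \<in> test_functions \<Omega> \<Longrightarrow> (\<And>x. 0 \<le> \<phi> x) \<Longrightarrow> 0 \<le> (\<integral>x. \<phi> x * w x \<partial>lebesgue)"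
  shows "AE x in lebesgue. x \<in> \<Omega> \<longrightarrow> 0 \<le> w x"
proof -
  have [measurable]: "w \<in> borel_measurable lebesgue" using w by auto
  have opn: "0 \<le> (\<integral>x. indicator U x * w x \<partial>lebesgue)" if U: "open U" "U \<subseteq> \<Omega>" for U
  proof -
    obtain \<phi> where \<phi>: "\<And>m::nat. \<phi> m \<in> test_functions U" "\<And>m x. 0 \<le> \<phi> m x" "\<And>m x. \<phi> m x \<le> 1"
      "\<And>x. (\<lambda>m. \<phi> m x) \<longlonglongrightarrow> indicator U x"
      using test_functions_exhaust_open[OF U(1)] by metis
    have sub: "\<phi> m \<in> test_functions \<Omega>" for m
      using \<phi>(1)[of m] U(2) by (auto simp: test_functions_def)
    have [measurable]: "\<phi> m \<in> borel_measurable lebesgue" for m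
      using smooth_measurable test_function_smooth[OF sub] by blast
    have [measurable]: "U \<in> sets lebesgue" using U(1) by auto
    have "(\<lambda>m. \<integral>x. \<phi> m x * w x \<partial>lebesgue) \<longlonglongrightarrow> (\<integral>x. indicator U x * w x \<partial>lebesgue)"
    proof (rule integral_dominated_convergence[where w = "\<lambda>x. \<bar>w x\<bar>"])
      show "AE x in lebesgue. norm (\<phi> m x * w x) \<le> \<bar>w x\<bar>" for m
        using \<phi>(2,3)[of m] by (auto simp: abs_mult mult_left_le_one_le)
      show "AE x in lebesgue. (\<lambda>i. \<phi> i x * w x) \<longlonglongrightarrow> indicator U x * w x"
        by (intro AE_I2 tendsto_intros \<phi>)
    qed (use w in auto)
    then show ?thesis
      by (rule LIMSEQ_le_const) (use pos[OF sub] \<phi>(2) in auto)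
  qed
  define A where "A = {x \<in> \<Omega>. w x < 0}"
  have \<Omega>m[measurable]: "\<Omega> \<in> sets lebesgue" using assms by auto
  have A[measurable]: "A \<in> sets lebesgue"
  proof -
    have "A = \<Omega> \<inter> {x \<in> space lebesgue. w x < 0}" by (auto simp: A_def)
    also have "\<dots> \<in> sets lebesgue" by measurable
    finally show ?thesis .
  qed
  have "\<exists>T. open T \<and> A \<subseteq> T \<and> emeasure lebesgue (T - A) < ennreal (1 / Suc n)" for n
    by (rule sets_lebesgue_outer_open[OF A, of "1 / Suc n"]) auto
  then obtain T where T: "\<And>n::nat. open (T n)" "\<And>n. A \<subseteq> T n"
     "\<And>n. emeasure lebesgue (T n - A) < ennreal (1 / Suc n)"
    by metis
  define U where "U n = \<Omega> \<inter> (\<Inter>i\<le>n. T i)" for n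
  have Uo: "open (U n)" "U n \<subseteq> \<Omega>" "A \<subseteq> U n" for n
    using T assms by (auto simp: U_def A_def)
  have [measurable]: "U n \<in> sets lebesgue" for n using Uo by auto
  define Z where "Z = (\<Inter>n. U n)"
  have Zm[measurable]: "Z \<in> sets lebesgue" unfolding Z_def by measurable
  have "emeasure lebesgue (Z - A) \<le> ennreal e" if "e > 0" for e
  proof -
    obtain n where n: "1 / Suc n < e" using nat_approx_posE[OF \<open>e > 0\<close>] .
    have "Z - A \<subseteq> T n - A" by (auto simp: Z_def U_def)
    then have "emeasure lebesgue (Z - A) \<le> emeasure lebesgue (T n - A)"
      by (rule emeasure_mono) (use A T in auto)
    also have "\<dots> \<le> ennreal e" using T(3)[of n] n by (meson ennreal_leI less_imp_le order_trans)
    finally show ?thesis .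
  qed
  then have "emeasure lebesgue (Z - A) = 0"
    using ennreal_le_epsilon[of 0 "emeasure lebesgue (Z - A)"] by (metis add_0 le_zero_eq)
  then have ZA: "AE x in lebesgue. x \<notin> Z - A"
    by (intro AE_not_in) (auto simp: null_sets_def)
  have "(\<lambda>n. \<integral>x. indicator (U n) x * w x \<partial>lebesgue) \<longlonglongrightarrow> (\<integral>x. indicator A x * w x \<partial>lebesgue)"
  proof (rule integral_dominated_convergence[where w = "\<lambda>x. \<bar>w x\<bar>"])
    show "AE x in lebesgue. (\<lambda>i. indicator (U i) x * w x) \<longlonglongrightarrow> indicator A x * w x"
      using ZA
    proof eventually_elim
      case (elim x)
      have "decseq U" unfolding U_def decseq_def by fastforce
      then have "(\<lambda>i. indicator (U i) x :: real) \<longlonglongrightarrow> indicator Z x"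
        unfolding Z_def by (rule LIMSEQ_indicator_decseq)
      moreover have "indicator Z x = (indicator A x :: real)"
        using elim Uo(3) by (auto simp: indicator_def Z_def)
      ultimately show ?case by (intro tendsto_intros) simp
    qed
  qed (use w in \<open>auto simp: indicator_def\<close>)
  then have "0 \<le> (\<integral>x. indicator A x * w x \<partial>lebesgue)"
    by (rule LIMSEQ_le_const) (use opn Uo in auto)
  moreover have le: "indicator A x * w x \<le> 0" for x
    by (auto simp: indicator_def A_def)
  ultimately have "(\<integral>x. - (indicator A x * w x) \<partial>lebesgue) = 0"
    using integral_nonneg_AE[of "\<lambda>x. - (indicator A x * w x)" lebesgue] by fastforce
  moreover have "integrable lebesgue (\<lambda>x. - (indicator A x * w x))"
    using integrable_real_mult_indicator[OF A w] by (simp add: mult.commute)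
  ultimately have "AE x in lebesgue. - (indicator A x * w x) = 0"
    using le by (subst (asm) integral_nonneg_eq_0_iff_AE) auto
  then show ?thesis
    by eventually_elim (auto simp: A_def indicator_def split: if_splits)
qed

section \<open>Integrals along segments\<close>

text \<open>
  A translation is an affine map with unit scaling factors.
\<close>

lemma lebesgue_distr_plus: "distr lebesgue lebesgue ((+) a) = (lebesgue :: 'a::euclidean_space measure)"
  and plus_measurable_lebesgue: "(+) a \<in> lebesgue \<rightarrow>\<^sub>M (lebesgue :: 'a::euclidean_space measure)"
proof -
  have T: "(\<lambda>x. a + (\<Sum>j\<in>Basis. (1 * (x \<bullet> j)) *\<^sub>R j)) = (+) a"
    by (auto simp: euclidean_representation)
  show "distr lebesgue lebesgue ((+) a) = (lebesgue :: 'a measure)"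
    using lebesgue_affine_euclidean[of "\<lambda>_. 1" a] unfolding T by (simp add: density_1)
  show "(+) a \<in> lebesgue \<rightarrow>\<^sub>M (lebesgue :: 'a measure)"
    using lebesgue_affine_measurable[of "\<lambda>_. 1" a] unfolding T by simp
qed

lemma lebesgue_translation:
  fixes u :: "'a::euclidean_space \<Rightarrow> real"
  assumes "integrable lebesgue u"
  shows integrable_lebesgue_translation: "integrable lebesgue (\<lambda>x. u (a + x))"
    and integral_lebesgue_translation: "(\<integral>x. u (a + x) \<partial>lebesgue) = (\<integral>x. u x \<partial>lebesgue)"
proof -
  have [measurable]: "u \<in> borel_measurable lebesgue" using assms by auto
  have "integrable (distr lebesgue lebesgue ((+) a)) u" using assms by (simp add: lebesgue_distr_plus)
  then show "integrable lebesgue (\<lambda>x. u (a + x))"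
    by (subst (asm) integrable_distr_eq) (auto simp: plus_measurable_lebesgue)
  show "(\<integral>x. u (a + x) \<partial>lebesgue) = (\<integral>x. u x \<partial>lebesgue)"
    by (subst (2) lebesgue_distr_plus[symmetric, of a], subst integral_distr)
       (auto simp: plus_measurable_lebesgue)
qed

lemma lborel_translation:
  fixes u :: "'a::euclidean_space \<Rightarrow> real"
  assumes "integrable lborel u"
  shows integrable_lborel_translation: "integrable lborel (\<lambda>x. u (a + x))"
    and integral_lborel_translation: "(\<integral>x. u (a + x) \<partial>lborel) = (\<integral>x. u x \<partial>lborel)"
proof -
  have [measurable]: "u \<in> borel_measurable borel" using assms by auto
  have "integrable (distr lborel borel ((+) a)) u" using assms by (simp add: lborel_distr_plus)
  then show "integrable lborel (\<lambda>x. u (a + x))"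
    by (subst (asm) integrable_distr_eq) auto
  show "(\<integral>x. u (a + x) \<partial>lborel) = (\<integral>x. u x \<partial>lborel)"
    by (subst (2) lborel_distr_plus[symmetric, of a], subst integral_distr) auto
qed

text \<open>
  At points where the integrand is not integrable over the segment, the value is \<open>0\<close>. For integrable \<open>g\<close>
  these points form a null set.
\<close>

definition segment_integral :: "real^'n::finite \<Rightarrow> real \<Rightarrow> (real^'n \<Rightarrow> real) \<Rightarrow> real^'n \<Rightarrow> real" where
  "segment_integral e t g x = (\<integral>s. indicator {0..t} s * g (x + s *\<^sub>R e) \<partial>lborel)"

lemma segment_integral_cmult: "segment_integral e t (\<lambda>x. c * g x) x = c * segment_integral e t g x"
  unfolding segment_integral_def
  by (subst integral_mult_right_zero[symmetric]) (simp add: algebra_simps)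

lemma segment_integral_nonneg: "(\<And>x. 0 \<le> g x) \<Longrightarrow> 0 \<le> segment_integral e t g x"
  unfolding segment_integral_def by (intro integral_nonneg_AE) auto

text \<open>
  Averaging forwards along segments is adjoint to averaging backwards. Both sides are double integrals
  over \<open>[0, t]\<close> and the space, which agree by Fubini after translating by \<open>s e\<close> for each \<open>s\<close>.
\<close>

lemma
  fixes g \<phi> :: "real^'n::finite \<Rightarrow> real"
  assumes g: "integrable lborel g" and t: "t \<ge> 0"
  shows integrable_segment_integral: "integrable lborel (segment_integral e t g)"
    and segment_integral_Fubini:
      "\<phi> \<in> borel_measurable borel \<Longrightarrow> (\<And>x. \<bar>\<phi> x\<bar> \<le> B) \<Longrightarrow>
        (\<integral>x. \<phi> x * segment_integral e t g x \<partial>lborel) = (\<integral>y. g y * segment_integral (- e) t \<phi> y \<partial>lborel)"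
proof -
  have [measurable]: "g \<in> borel_measurable borel" using g by auto
  have tr: "integrable lborel (\<lambda>x. g (x + s *\<^sub>R e))" "(\<integral>x. norm (g (x + s *\<^sub>R e)) \<partial>lborel) = (\<integral>x. norm (g x) \<partial>lborel)" for s
    using integrable_lborel_translation[OF g, of "s *\<^sub>R e"]
      integral_lborel_translation[OF integrable_norm[OF g], of "s *\<^sub>R e"] by (simp_all add: add.commute)
  have ind: "integrable lborel (\<lambda>s. indicator {0..t} s * c :: real)" for c
    by (intro integrable_mult_left integrable_real_indicator) (auto simp: emeasure_lborel_Icc_eq)
  have I: "integrable (lborel \<Otimes>\<^sub>M lborel) (\<lambda>(s, x). indicator {0..t} s * g (x + s *\<^sub>R e))"
  proof (rule lborel_pair.Fubini_integrable)
    show "integrable lborel (\<lambda>s. \<integral>x. norm (case (s, x) of (s, x) \<Rightarrow> indicator {0..t} s * g (x + s *\<^sub>R e)) \<partial>lborel)"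
      using ind[of "\<integral>x. norm (g x) \<partial>lborel"] tr(2) by (simp add: abs_mult)
    show "AE s in lborel. integrable lborel (\<lambda>x. case (s, x) of (s, x) \<Rightarrow> indicator {0..t} s * g (x + s *\<^sub>R e))"
      using tr(1) by (auto intro!: AE_I2 integrable_mult_right)
  qed measurable
  have "integrable lborel (\<lambda>x. \<integral>s. indicator {0..t} s * g (x + s *\<^sub>R e) \<partial>lborel)"
    by (rule lborel_pair.integrable_snd[OF I])
  then show "integrable lborel (segment_integral e t g)"
    by (simp add: segment_integral_def[abs_def])
  assume \<phi>[measurable]: "\<phi> \<in> borel_measurable borel" and B: "\<And>x. \<bar>\<phi> x\<bar> \<le> B"
  have J: "integrable (lborel \<Otimes>\<^sub>M lborel) (\<lambda>(s::real, y::real^'n). indicator {0..t} s * g y)"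
  proof (rule lborel_pair.Fubini_integrable)
    show "integrable lborel (\<lambda>s. \<integral>x. norm (case (s, x) of (s, y) \<Rightarrow> indicator {0..t} s * g y) \<partial>lborel)"
      using ind[of "\<integral>x. norm (g x) \<partial>lborel"] by (simp add: abs_mult)
    show "AE s in lborel. integrable lborel (\<lambda>x. case (s, x) of (s, y) \<Rightarrow> indicator {0..t} s * g y)"
      using g by (auto intro!: AE_I2 integrable_mult_right)
  qed measurable
  have I': "integrable (lborel \<Otimes>\<^sub>M lborel) (\<lambda>(s, x). \<phi> x * (indicator {0..t} s * g (x + s *\<^sub>R e)))"
    using integrable_bounded_mult[OF I, of "\<lambda>(s, x). \<phi> x" B] B by (simp add: case_prod_beta')
  have J': "integrable (lborel \<Otimes>\<^sub>M lborel) (\<lambda>(s::real, y::real^'n). \<phi> (y + s *\<^sub>R (- e)) * (indicator {0..t} s * g y))"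
    using integrable_bounded_mult[OF J, of "\<lambda>(s, y). \<phi> (y + s *\<^sub>R (- e))" B] B by (simp add: case_prod_beta')
  have "(\<integral>x. \<phi> x * segment_integral e t g x \<partial>lborel) =
      (\<integral>x. (\<integral>s. \<phi> x * (indicator {0..t} s * g (x + s *\<^sub>R e)) \<partial>lborel) \<partial>lborel)"
    by (simp add: segment_integral_def)
  also have "\<dots> = (\<integral>s. (\<integral>x. \<phi> x * (indicator {0..t} s * g (x + s *\<^sub>R e)) \<partial>lborel) \<partial>lborel)"
    by (rule lborel_pair.Fubini_integral) (use I' in simp)
  also have "\<dots> = (\<integral>s. (\<integral>y. \<phi> (y + s *\<^sub>R (- e)) * (indicator {0..t} s * g y) \<partial>lborel) \<partial>lborel)"
  proof (rule Bochner_Integration.integral_cong[OF refl])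
    fix s
    have "integrable lborel (\<lambda>y. \<phi> (y + s *\<^sub>R (- e)) * (indicator {0..t} s * g y))"
      using integrable_bounded_mult[OF integrable_mult_right[OF g], of "\<lambda>y. \<phi> (y + s *\<^sub>R (- e))" B] B by simp
    from integral_lborel_translation[OF this, of "s *\<^sub>R e"]
    show "(\<integral>x. \<phi> x * (indicator {0..t} s * g (x + s *\<^sub>R e)) \<partial>lborel) =
      (\<integral>y. \<phi> (y + s *\<^sub>R (- e)) * (indicator {0..t} s * g y) \<partial>lborel)"
      by (simp add: algebra_simps)
  qed
  also have "\<dots> = (\<integral>y. (\<integral>s. \<phi> (y + s *\<^sub>R (- e)) * (indicator {0..t} s * g y) \<partial>lborel) \<partial>lborel)"
    by (rule lborel_pair.Fubini_integral[symmetric]) (use J' in simp)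
  also have "\<dots> = (\<integral>y. g y * segment_integral (- e) t \<phi> y \<partial>lborel)"
    unfolding segment_integral_def
    by (subst integral_mult_right_zero[symmetric]) (simp add: algebra_simps)
  finally show "(\<integral>x. \<phi> x * segment_integral e t g x \<partial>lborel) = (\<integral>y. g y * segment_integral (- e) t \<phi> y \<partial>lborel)" .
qed

lemma smooth_has_derivative_partials:
  assumes "smooth \<phi>"
  shows "(\<phi> has_derivative (\<lambda>h. \<Sum>i\<in>UNIV. partial i \<phi> x * h $ i)) (at x)"
proof -
  note D = smooth_has_derivative[OF assms, of x]
  have lin: "linear (frechet_derivative \<phi> (at x))" using D by (rule has_derivative_linear)
  have "frechet_derivative \<phi> (at x) h = (\<Sum>i\<in>UNIV. partial i \<phi> x * h $ i)" for h
  proof -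
    have "frechet_derivative \<phi> (at x) h = frechet_derivative \<phi> (at x) (\<Sum>i\<in>UNIV. h $ i *\<^sub>R axis i 1)"
      using basis_expansion[of h] by (simp add: scalar_mult_eq_scaleR)
    also have "\<dots> = (\<Sum>i\<in>UNIV. h $ i *\<^sub>R frechet_derivative \<phi> (at x) (axis i 1))"
      by (simp add: linear_sum[OF lin] linear_scale[OF lin])
    finally show ?thesis by (simp add: partial_def mult.commute)
  qed
  then have "frechet_derivative \<phi> (at x) = (\<lambda>h. \<Sum>i\<in>UNIV. partial i \<phi> x * h $ i)" by auto
  with D show ?thesis by simp
qed

lemma segment_integral_continuous:
  assumes "continuous_on UNIV \<phi>"
  shows "segment_integral e t \<phi> x = integral (cbox 0 t) (\<lambda>s. \<phi> (x + s *\<^sub>R e))"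
proof -
  have "continuous_on UNIV (\<lambda>s. \<phi> (x + s *\<^sub>R e))"
    by (rule continuous_on_compose2[OF assms]) (auto intro!: continuous_intros)
  then have "set_integrable lborel {0..t} (\<lambda>s. \<phi> (x + s *\<^sub>R e))"
    by (intro borel_integrable_atLeastAtMost' ) (rule continuous_on_subset, auto)
  from set_borel_integral_eq_integral(2)[OF this] show ?thesis
    by (simp add: segment_integral_def set_lebesgue_integral_def)
qed

text \<open>
  Differentiation under the integral sign. The Leibniz rule needs the derivative as a continuous
  family of bounded linear maps, for which it is expanded in the coordinate functionals.
\<close>

lemma
  assumes \<phi>: "smooth \<phi>"
  shows differentiable_segment_integral: "segment_integral e t \<phi> differentiable_on UNIV"
    and partial_segment_integral: "partial j (segment_integral e t \<phi>) = segment_integral e t (partial j \<phi>)"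
proof -
  define X where "X i = Blinfun (\<lambda>h::real^'a. h $ i)" for i
  have X: "blinfun_apply (X i) h = h $ i" for i h
    by (simp add: X_def bounded_linear_Blinfun_apply bounded_linear_vec_nth)
  define D where "D x s = (\<Sum>i\<in>UNIV. partial i \<phi> (x + s *\<^sub>R e) *\<^sub>R X i)" for x s
  have D: "blinfun_apply (D x s) h = (\<Sum>i\<in>UNIV. partial i \<phi> (x + s *\<^sub>R e) * h $ i)" for x s h
    by (simp add: D_def blinfun.sum_left blinfun.scaleR_left X)
  note cont = smooth_continuous[OF \<phi>, of UNIV] smooth_continuous[OF smooth_partial[OF \<phi>], of UNIV]
  have contD: "continuous_on (UNIV \<times> cbox 0 t) (\<lambda>(x, s). D x s)"
    unfolding D_def case_prod_beta'
    by (intro continuous_intros continuous_on_compose2[OF cont(2)]) auto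
  have d: "(segment_integral e t \<phi> has_derivative blinfun_apply (integral (cbox 0 t) (D x))) (at x)" for x
    unfolding segment_integral_continuous[OF cont(1), abs_def]
  proof (rule leibniz_rule[of UNIV, simplified], goal_cases)
    case (1 x s)
    have "((\<lambda>x. \<phi> (x + s *\<^sub>R e)) has_derivative (\<lambda>h. \<Sum>i\<in>UNIV. partial i \<phi> (x + s *\<^sub>R e) * h $ i)) (at x)"
      by (rule has_derivative_compose[OF _ smooth_has_derivative_partials[OF \<phi>], where f = "\<lambda>x. x + s *\<^sub>R e"])
         (auto intro!: derivative_eq_intros)
    moreover have "blinfun_apply (D x s) = (\<lambda>h. \<Sum>i\<in>UNIV. partial i \<phi> (x + s *\<^sub>R e) * h $ i)"
      using D by auto
    ultimately show ?case by simp
  next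
    case (2 x)
    show ?case
      by (rule integrable_continuous) (auto intro!: continuous_on_compose2[OF cont(1)] continuous_intros)
  next
    case 3
    then show ?case using contD by simp
  qed
  then show "segment_integral e t \<phi> differentiable_on UNIV"
    by (auto simp: differentiable_on_def differentiable_def)
  show "partial j (segment_integral e t \<phi>) = segment_integral e t (partial j \<phi>)"
  proof
    fix x
    have "continuous_on (cbox 0 t) (D x)"
      unfolding D_def by (intro continuous_intros continuous_on_compose2[OF cont(2)]) auto
    then have "D x integrable_on cbox 0 t" by (rule integrable_continuous)
    then have "blinfun_apply (integral (cbox 0 t) (D x)) (axis j 1) = integral (cbox 0 t) (\<lambda>s. blinfun_apply (D x s) (axis j 1))"
      by (rule blinfun_apply_integral)
    also have "\<dots> = integral (cbox 0 t) (\<lambda>s. partial j \<phi> (x + s *\<^sub>R e))"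
      by (simp add: D axis_def if_distrib cong: if_cong)
    finally show "partial j (segment_integral e t \<phi>) x = segment_integral e t (partial j \<phi>) x"
      unfolding partial_eq[OF d] segment_integral_continuous[OF cont(2)] .
  qed
qed

lemma smooth_segment_integral:
  assumes "smooth \<phi>"
  shows "smooth (segment_integral e t \<phi>)"
proof (rule smooth_coinduct[where P = "\<lambda>\<psi>. \<exists>\<phi>. smooth \<phi> \<and> \<psi> = segment_integral e t \<phi>"])
  fix \<psi> :: "real^'a \<Rightarrow> real"
  assume "\<exists>\<phi>. smooth \<phi> \<and> \<psi> = segment_integral e t \<phi>"
  then show "\<psi> differentiable_on UNIV \<and> (\<forall>j. \<exists>\<phi>. smooth \<phi> \<and> partial j \<psi> = segment_integral e t \<phi>)"
    using differentiable_segment_integral partial_segment_integral smooth_partial by metis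
qed (use assms in auto)

lemma smooth_DERIV_axis:
  assumes "smooth \<phi>"
  shows "((\<lambda>s. \<phi> (y + s *\<^sub>R axis j 1)) has_field_derivative partial j \<phi> (y + s *\<^sub>R axis j 1)) (at s)"
proof -
  have "((\<lambda>s. \<phi> (y + s *\<^sub>R axis j 1)) has_derivative (\<lambda>h. \<Sum>i\<in>UNIV. partial i \<phi> (y + s *\<^sub>R axis j 1) * (h *\<^sub>R axis j 1) $ i)) (at s)"
    by (rule has_derivative_compose[OF _ smooth_has_derivative_partials[OF assms]])
       (auto intro!: derivative_eq_intros)
  also have "(\<lambda>h. \<Sum>i\<in>UNIV. partial i \<phi> (y + s *\<^sub>R axis j 1) * (h *\<^sub>R axis j 1) $ i) = (*) (partial j \<phi> (y + s *\<^sub>R axis j 1))"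
    by (rule ext) (simp add: axis_def if_distrib cong: if_cong)
  finally show ?thesis by (simp add: has_field_derivative_def)
qed

lemma segment_integral_partial:
  assumes \<phi>: "smooth \<phi>" and "t \<ge> 0"
  shows "segment_integral (- axis j 1) t (partial j \<phi>) x = \<phi> x - \<phi> (x - t *\<^sub>R axis j 1)"
proof -
  have "((\<lambda>s. partial j \<phi> (x + s *\<^sub>R - axis j 1)) has_integral - \<phi> (x - t *\<^sub>R axis j 1) - - \<phi> (x - 0 *\<^sub>R axis j 1)) {0..t}"
  proof (rule fundamental_theorem_of_calculus[OF \<open>t \<ge> 0\<close>])
    fix s
    have "((\<lambda>s. \<phi> (x + (- s) *\<^sub>R axis j 1)) has_field_derivative partial j \<phi> (x + (- s) *\<^sub>R axis j 1) * - 1) (at s within {0..t})"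
      by (rule DERIV_chain2[OF smooth_DERIV_axis[OF \<phi>]]) (auto intro!: derivative_eq_intros)
    from DERIV_minus[OF this]
    show "((\<lambda>s. - \<phi> (x - s *\<^sub>R axis j 1)) has_vector_derivative partial j \<phi> (x + s *\<^sub>R - axis j 1)) (at s within {0..t})"
      by (simp add: has_real_derivative_iff_has_vector_derivative)
  qed
  then show ?thesis
    unfolding segment_integral_continuous[OF smooth_continuous[OF smooth_partial[OF \<phi>]]]
    by (simp add: integral_unique)
qed

section \<open>Functionals bounded in the \<open>L\<^sup>1\<close> norm\<close>

lemma AE_summable_of_summable_integrals:
  fixes f :: "nat \<Rightarrow> 'a \<Rightarrow> real"
  assumes [measurable]: "\<And>i. integrable M (f i)"
    and sums: "summable (\<lambda>i. \<integral>x. \<bar>f i x\<bar> \<partial>M)"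
  shows "AE x in M. summable (\<lambda>i. \<bar>f i x\<bar>)"
proof -
  have "(\<integral>\<^sup>+ x. (\<Sum>i. ennreal \<bar>f i x\<bar>) \<partial>M) = (\<Sum>i. \<integral>\<^sup>+ x. ennreal \<bar>f i x\<bar> \<partial>M)"
    by (intro nn_integral_suminf) simp
  also have "\<dots> = (\<Sum>i. ennreal (\<integral>x. \<bar>f i x\<bar> \<partial>M))"
    by (intro arg_cong[where f=suminf] ext nn_integral_eq_integral integrable_abs assms) auto
  also have "\<dots> \<noteq> \<infinity>"
    using sums by (simp add: ennreal_suminf_neq_top)
  finally have "AE x in M. (\<Sum>i. ennreal \<bar>f i x\<bar>) \<noteq> \<infinity>"
    by (intro nn_integral_PInf_AE) auto
  then show ?thesis
    by eventually_elim (auto intro: summable_suminf_not_top)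
qed

text \<open>
  The Riesz representation theorem for \<open>L\<^sup>2\<close> of a finite measure, on a space \<open>D\<close> of bounded functions
  that need not be dense. A sequence in \<open>D\<close> that minimises \<open>J \<phi> = \<integral> \<phi>\<^sup>2 - 2 T \<phi>\<close> is a Cauchy sequence
  in \<open>L\<^sup>2\<close> by the parallelogram identity, hence in \<open>L\<^sup>1\<close>. Its \<open>L\<^sup>1\<close> limit \<open>h\<close> represents \<open>T\<close> because the
  first variation of \<open>J\<close> tends to zero along the sequence and because the members of \<open>D\<close> are bounded.
\<close>

lemma L1_bounded_functional_representation:
  fixes D :: "('a \<Rightarrow> real) set" and T :: "('a \<Rightarrow> real) \<Rightarrow> real"
  assumes "finite_measure M"
    and D_meas: "\<And>\<phi>. \<phi> \<in> D \<Longrightarrow> \<phi> \<in> borel_measurable M"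
    and D_bdd: "\<And>\<phi>. \<phi> \<in> D \<Longrightarrow> \<exists>B. \<forall>x. \<bar>\<phi> x\<bar> \<le> B"
    and D_ne: "D \<noteq> {}"
    and D_add: "\<And>\<phi> \<psi>. \<phi> \<in> D \<Longrightarrow> \<psi> \<in> D \<Longrightarrow> (\<lambda>x. \<phi> x + \<psi> x) \<in> D"
    and D_scale: "\<And>c \<phi>. \<phi> \<in> D \<Longrightarrow> (\<lambda>x. c * \<phi> x) \<in> D"
    and T_add: "\<And>\<phi> \<psi>. \<phi> \<in> D \<Longrightarrow> \<psi> \<in> D \<Longrightarrow> T (\<lambda>x. \<phi> x + \<psi> x) = T \<phi> + T \<psi>"
    and T_scale: "\<And>c \<phi>. \<phi> \<in> D \<Longrightarrow> T (\<lambda>x. c * \<phi> x) = c * T \<phi>"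
    and T_bound: "\<And>\<phi>. \<phi> \<in> D \<Longrightarrow> \<bar>T \<phi>\<bar> \<le> (\<integral>x. \<bar>\<phi> x\<bar> \<partial>M)"
  obtains h where "integrable M h" "\<And>\<phi>. \<phi> \<in> D \<Longrightarrow> T \<phi> = (\<integral>x. \<phi> x * h x \<partial>M)"
proof -
  interpret finite_measure M by fact
  note D_meas[measurable_dest]
  define \<mu> where "\<mu> = measure M (space M)"
  have int: "integrable M \<phi>" if \<phi>: "\<phi> \<in> D" for \<phi>
  proof -
    obtain B where "\<And>x. \<bar>\<phi> x\<bar> \<le> B" using D_bdd[OF \<phi>] by blast
    then show ?thesis using D_meas[OF \<phi>] by (intro integrable_const_bound[of _ B]) auto
  qed
  have int2: "integrable M (\<lambda>x. \<phi> x * \<psi> x)" if \<phi>: "\<phi> \<in> D" and \<psi>: "\<psi> \<in> D" for \<phi> \<psi>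
  proof -
    obtain B where B: "\<And>x. \<bar>\<phi> x\<bar> \<le> B" using D_bdd[OF \<phi>] by blast
    obtain C where C: "\<And>x. \<bar>\<psi> x\<bar> \<le> C" using D_bdd[OF \<psi>] by blast
    have "\<bar>\<phi> x * \<psi> x\<bar> \<le> B * C" for x
      unfolding abs_mult by (intro mult_mono B C) (use B[of x] in auto)
    then show ?thesis
      using D_meas[OF \<phi>] D_meas[OF \<psi>] by (intro integrable_const_bound[of _ "B * C"]) auto
  qed
  define N :: "(_ \<Rightarrow> real) \<Rightarrow> real" where "N \<phi> = (\<integral>x. \<phi> x * \<phi> x \<partial>M)" for \<phi>
  define J where "J \<phi> = N \<phi> - 2 * T \<phi>" for \<phi>
  have N0: "0 \<le> N \<phi>" for \<phi> unfolding N_def by (intro integral_nonneg_AE) auto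
  \<comment> \<open>Young's inequality replaces Cauchy-Schwarz: \<open>d = 1\<close> bounds \<open>J\<close> from below, and \<open>d = 2\<^sup>-\<^sup>k\<close> turns a
    bound of order \<open>4\<^sup>-\<^sup>k\<close> on \<open>N\<close> into one of order \<open>2\<^sup>-\<^sup>k\<close> on the \<open>L\<^sup>1\<close> norm.\<close>
  have abs_le: "(\<integral>x. \<bar>\<phi> x\<bar> \<partial>M) \<le> (d * \<mu> + N \<phi> / d) / 2" if "\<phi> \<in> D" "d > 0" for \<phi> d
  proof -
    have "(\<integral>x. \<bar>\<phi> x\<bar> \<partial>M) \<le> (\<integral>x. (d + (\<phi> x * \<phi> x) / d) / 2 \<partial>M)"
    proof (rule integral_mono)
      fix x
      have "0 \<le> (d - \<bar>\<phi> x\<bar>)\<^sup>2" by simp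
      then show "\<bar>\<phi> x\<bar> \<le> (d + (\<phi> x * \<phi> x) / d) / 2"
        using that by (simp add: field_simps power2_eq_square)
    qed (use int int2 that in auto)
    also have "\<dots> = (d * \<mu> + N \<phi> / d) / 2"
      using int2[OF that(1) that(1)] by (simp add: N_def \<mu>_def)
    finally show ?thesis .
  qed
  have J_low: "- \<mu> \<le> J \<phi>" if "\<phi> \<in> D" for \<phi>
    using abs_le[OF that, of 1] T_bound[OF that] by (simp add: J_def)
  define m where "m = Inf (J ` D)"
  have m_le: "m \<le> J \<phi>" if "\<phi> \<in> D" for \<phi>
    unfolding m_def using J_low that by (intro cInf_lower) (auto intro!: bdd_belowI[of _ "- \<mu>"])
  have "\<exists>\<phi>\<in>D. J \<phi> < m + (1/4)^k" for k :: nat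
  proof -
    have "\<exists>y\<in>J ` D. y < m + (1/4)^k"
      unfolding m_def using D_ne J_low
      by (subst cInf_less_iff[symmetric]) (auto intro!: bdd_belowI[of _ "- \<mu>"])
    then show ?thesis by blast
  qed
  then obtain \<Phi> where \<Phi>: "\<And>k. \<Phi> k \<in> D" "\<And>k. J (\<Phi> k) < m + (1/4)^k"
    by metis
  have N_add: "N (\<lambda>x. \<phi> x + s * \<psi> x) = N \<phi> + 2 * s * (\<integral>x. \<phi> x * \<psi> x \<partial>M) + s * s * N \<psi>"
    if "\<phi> \<in> D" "\<psi> \<in> D" for \<phi> \<psi> s
  proof -
    have "N (\<lambda>x. \<phi> x + s * \<psi> x) = (\<integral>x. \<phi> x * \<phi> x + 2 * s * (\<phi> x * \<psi> x) + s * s * (\<psi> x * \<psi> x) \<partial>M)"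
      unfolding N_def by (simp add: algebra_simps)
    also have "\<dots> = N \<phi> + 2 * s * (\<integral>x. \<phi> x * \<psi> x \<partial>M) + s * s * N \<psi>"
      unfolding N_def using int2 that by simp
    finally show ?thesis .
  qed
  have D_lin: "(\<lambda>x. \<phi> x + s * \<psi> x) \<in> D" if "\<phi> \<in> D" "\<psi> \<in> D" for \<phi> \<psi> s
    using that by (intro D_add D_scale)
  have J_add: "J (\<lambda>x. \<phi> x + s * \<psi> x) = J \<phi> + 2 * s * ((\<integral>x. \<phi> x * \<psi> x \<partial>M) - T \<psi>) + s * s * N \<psi>"
    if "\<phi> \<in> D" "\<psi> \<in> D" for \<phi> \<psi> s
    unfolding J_def N_add[OF that] using that by (simp add: T_add T_scale D_scale algebra_simps)
  \<comment> \<open>Expanding \<open>J\<close> around \<open>\<phi>\<close> at \<open>\<psi>\<close> and at the midpoint, and eliminating the linear term, leaves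
    the parallelogram identity. The value of \<open>J\<close> at the midpoint is at least \<open>m\<close>.\<close>
  have par: "N (\<lambda>x. \<psi> x - \<phi> x) \<le> 2 * (J \<phi> + J \<psi> - 2 * m)" if "\<phi> \<in> D" "\<psi> \<in> D" for \<phi> \<psi>
  proof -
    let ?\<delta> = "\<lambda>x. \<psi> x + (-1) * \<phi> x"
    have \<delta>: "?\<delta> \<in> D" using that by (intro D_lin)
    have 1: "J \<psi> = J \<phi> + 2 * ((\<integral>x. \<phi> x * ?\<delta> x \<partial>M) - T ?\<delta>) + N ?\<delta>"
      using J_add[OF that(1) \<delta>, of 1] by simp
    have 2: "J (\<lambda>x. \<phi> x + (1/2) * ?\<delta> x) = J \<phi> + ((\<integral>x. \<phi> x * ?\<delta> x \<partial>M) - T ?\<delta>) + N ?\<delta> / 4"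
      using J_add[OF that(1) \<delta>, of "1/2"] by simp
    have 3: "m \<le> J (\<lambda>x. \<phi> x + (1/2) * ?\<delta> x)"
      by (intro m_le D_lin that)
    have "N ?\<delta> \<le> 2 * (J \<phi> + J \<psi> - 2 * m)" using 1 2 3 by argo
    then show ?thesis by simp
  qed
  have cauchy: "(\<integral>x. \<bar>\<Phi> (Suc k) x - \<Phi> k x\<bar> \<partial>M) \<le> ((\<mu> + 4) / 2) * (1/2)^k" for k
  proof -
    have "N (\<lambda>x. \<Phi> (Suc k) x - \<Phi> k x) \<le> 2 * (J (\<Phi> k) + J (\<Phi> (Suc k)) - 2 * m)"
      by (intro par \<Phi>)
    also have "\<dots> \<le> 4 * (1/4)^k"
    proof -
      have "(1/4::real) ^ Suc k \<le> (1/4)^k" by simp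
      then show ?thesis using \<Phi>(2)[of k] \<Phi>(2)[of "Suc k"] by argo
    qed
    finally have N: "N (\<lambda>x. \<Phi> (Suc k) x - \<Phi> k x) \<le> 4 * (1/4)^k" .
    have "(\<lambda>x. \<Phi> (Suc k) x - \<Phi> k x) \<in> D"
      using D_lin[OF \<Phi>(1) \<Phi>(1), of "Suc k" "-1" k] by simp
    then have "(\<integral>x. \<bar>\<Phi> (Suc k) x - \<Phi> k x\<bar> \<partial>M) \<le>
        ((1/2)^k * \<mu> + N (\<lambda>x. \<Phi> (Suc k) x - \<Phi> k x) / (1/2)^k) / 2"
      by (intro abs_le) auto
    also have "\<dots> \<le> ((1/2)^k * \<mu> + (4 * (1/4)^k) / (1/2)^k) / 2"
      using N by (intro divide_right_mono add_left_mono) auto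
    also have "(4 * (1/4::real)^k) / (1/2)^k = 4 * (1/2)^k"
    proof -
      have "(1/4::real)^k = (1/2)^k * (1/2)^k" by (simp flip: power_mult_distrib)
      then show ?thesis by simp
    qed
    finally show ?thesis by (simp add: algebra_simps)
  qed
  \<comment> \<open>The increments of the minimising sequence, starting with its first term, so that partial sums
    recover the sequence and absolute convergence of the series gives the limit.\<close>
  define f where "f k = (case k of 0 \<Rightarrow> \<Phi> 0 | Suc i \<Rightarrow> (\<lambda>x. \<Phi> (Suc i) x - \<Phi> i x))" for k
  have f_D: "f k \<in> D" for k
    using D_lin[OF \<Phi>(1) \<Phi>(1), of "k" "-1" "k - 1"] \<Phi>(1) by (cases k) (auto simp: f_def)
  have f_sum: "(\<Sum>i<Suc n. f i x) = \<Phi> n x" for n x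
    by (induction n) (auto simp: f_def)
  have f_summable: "summable (\<lambda>i. \<integral>x. \<bar>f i x\<bar> \<partial>M)"
  proof (subst summable_Suc_iff[symmetric], rule summable_comparison_test')
    show "summable (\<lambda>k. ((\<mu> + 4) / 2) * (1/2::real)^k)"
      by (intro summable_mult summable_geometric) simp
    show "norm (\<integral>x. \<bar>f (Suc n) x\<bar> \<partial>M) \<le> ((\<mu> + 4) / 2) * (1/2)^n" if "n \<ge> 0" for n
      using cauchy[of n] by (simp add: f_def integral_nonneg_AE)
  qed
  have AEs: "AE x in M. summable (\<lambda>i. \<bar>f i x\<bar>)"
    by (rule AE_summable_of_summable_integrals[OF int[OF f_D] f_summable])
  define h where "h x = (\<Sum>i. f i x)" for x
  show ?thesis
  proof (rule that[of h])
    show "integrable M h"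
      unfolding h_def using AEs f_summable by (intro integrable_suminf int f_D) simp_all
    fix \<phi> assume \<phi>: "\<phi> \<in> D"
    obtain B where B: "\<And>x. \<bar>\<phi> x\<bar> \<le> B" using D_bdd[OF \<phi>] by blast
    have "(\<lambda>n. \<Sum>i<n. \<integral>x. \<phi> x * f i x \<partial>M) \<longlonglongrightarrow> (\<integral>x. (\<Sum>i. \<phi> x * f i x) \<partial>M)"
      unfolding sums_def[symmetric]
    proof (rule sums_integral)
      show "AE x in M. summable (\<lambda>i. norm (\<phi> x * f i x))"
        using AEs by eventually_elim (auto simp: abs_mult intro: summable_mult)
      show "summable (\<lambda>i. \<integral>x. norm (\<phi> x * f i x) \<partial>M)"
      proof (rule summable_comparison_test')
        show "summable (\<lambda>i. B * (\<integral>x. \<bar>f i x\<bar> \<partial>M))"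
          by (intro summable_mult f_summable)
        show "norm (\<integral>x. norm (\<phi> x * f i x) \<partial>M) \<le> B * (\<integral>x. \<bar>f i x\<bar> \<partial>M)" if "i \<ge> 0" for i
        proof -
          have "(\<integral>x. norm (\<phi> x * f i x) \<partial>M) \<le> (\<integral>x. B * \<bar>f i x\<bar> \<partial>M)"
            using B by (intro integral_mono integrable_norm int2[OF \<phi> f_D] integrable_mult_right integrable_abs int[OF f_D])
              (auto simp: abs_mult intro!: mult_right_mono)
          then show ?thesis by (simp add: integral_nonneg_AE)
        qed
      qed
    qed (intro int2 \<phi> f_D)
    then have "(\<lambda>n. \<Sum>i<Suc n. \<integral>x. \<phi> x * f i x \<partial>M) \<longlonglongrightarrow> (\<integral>x. (\<Sum>i. \<phi> x * f i x) \<partial>M)"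
      by (rule LIMSEQ_Suc)
    also have "(\<lambda>n. \<Sum>i<Suc n. \<integral>x. \<phi> x * f i x \<partial>M) = (\<lambda>n. \<integral>x. \<Phi> n x * \<phi> x \<partial>M)"
    proof
      fix n
      have "(\<Sum>i<Suc n. \<integral>x. \<phi> x * f i x \<partial>M) = (\<integral>x. (\<Sum>i<Suc n. \<phi> x * f i x) \<partial>M)"
        by (rule Bochner_Integration.integral_sum[symmetric]) (intro int2 \<phi> f_D)
      also have "\<dots> = (\<integral>x. \<Phi> n x * \<phi> x \<partial>M)"
        by (simp only: sum_distrib_left[symmetric] f_sum mult.commute)
      finally show "(\<Sum>i<Suc n. \<integral>x. \<phi> x * f i x \<partial>M) = (\<integral>x. \<Phi> n x * \<phi> x \<partial>M)" .
    qed
    also have "(\<integral>x. (\<Sum>i. \<phi> x * f i x) \<partial>M) = (\<integral>x. \<phi> x * h x \<partial>M)"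
    proof (rule integral_cong_AE)
      have [measurable]: "f i \<in> borel_measurable M" for i using D_meas[OF f_D] .
      have [measurable]: "\<phi> \<in> borel_measurable M" using D_meas[OF \<phi>] .
      show "(\<lambda>x. \<Sum>i. \<phi> x * f i x) \<in> borel_measurable M" by measurable
      show "(\<lambda>x. \<phi> x * h x) \<in> borel_measurable M" unfolding h_def by measurable
      show "AE x in M. (\<Sum>i. \<phi> x * f i x) = \<phi> x * h x"
        using AEs by eventually_elim (auto simp: h_def intro!: suminf_mult dest: summable_rabs_cancel)
    qed
    finally have lim1: "(\<lambda>n. \<integral>x. \<Phi> n x * \<phi> x \<partial>M) \<longlonglongrightarrow> (\<integral>x. \<phi> x * h x \<partial>M)" .
    have "(\<lambda>n. (\<integral>x. \<Phi> n x * \<phi> x \<partial>M) - T \<phi>) \<longlonglongrightarrow> 0"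
    proof (rule Lim_null_comparison)
      show "\<forall>\<^sub>F n in sequentially. norm ((\<integral>x. \<Phi> n x * \<phi> x \<partial>M) - T \<phi>) \<le> (1/2)^n * ((1 + N \<phi>) / 2)"
      proof (intro always_eventually allI)
        fix n
        define c where "c = (\<integral>x. \<Phi> n x * \<phi> x \<partial>M) - T \<phi>"
        \<comment> \<open>Since \<open>J\<close> is within \<open>4\<^sup>-\<^sup>n\<close> of its infimum, the steps \<open>s = 2\<^sup>-\<^sup>n\<close> and \<open>s = - 2\<^sup>-\<^sup>n\<close> give the best
          control of the first variation \<open>2 * c\<close>.\<close>
        have var: "0 \<le> (1/4)^n + 2 * s * c + s * s * N \<phi>" for s
          using m_le[OF D_lin[OF \<Phi>(1)[of n] \<phi>, of s]] \<Phi>(2)[of n]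
          unfolding J_add[OF \<Phi>(1) \<phi>] c_def by simp
        define d :: real where "d = (1/2)^n"
        have d: "d > 0" "(1/4)^n = d * d" by (auto simp: d_def simp flip: power_mult_distrib)
        have "2 * d * c \<le> d * d + d * d * N \<phi>" using var[of "- d"] unfolding d by simp
        moreover have "2 * d * (- c) \<le> d * d + d * d * N \<phi>" using var[of d] unfolding d by simp
        ultimately have "2 * d * \<bar>c\<bar> \<le> d * d + d * d * N \<phi>" by (cases "c \<ge> 0") auto
        also have "\<dots> = 2 * d * (d * ((1 + N \<phi>) / 2))" by (simp add: algebra_simps)
        finally have "\<bar>c\<bar> \<le> d * ((1 + N \<phi>) / 2)" using d(1) by (simp only: mult_le_cancel_left_pos)
        then show "norm ((\<integral>x. \<Phi> n x * \<phi> x \<partial>M) - T \<phi>) \<le> (1/2)^n * ((1 + N \<phi>) / 2)"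
          by (simp add: c_def d_def)
      qed
      show "(\<lambda>n. (1/2)^n * ((1 + N \<phi>) / 2)) \<longlonglongrightarrow> 0"
        by (intro tendsto_mult_left_zero LIMSEQ_power_zero) simp
    qed
    then have "(\<lambda>n. \<integral>x. \<Phi> n x * \<phi> x \<partial>M) \<longlonglongrightarrow> T \<phi>"
      by (rule LIM_zero_cancel)
    then show "T \<phi> = (\<integral>x. \<phi> x * h x \<partial>M)"
      using lim1 LIMSEQ_unique by blast
  qed
qed

section \<open>Weak derivatives and increments along segments\<close>

lemma integral_translate_difference:
  assumes \<phi>: "\<phi> \<in> test_functions \<Omega>" and u: "integrable lebesgue u"
  shows "(\<integral>x. (\<phi> x - \<phi> (x - a)) * u x \<partial>lebesgue) = - (\<integral>x. \<phi> x * (u (x + a) - u x) \<partial>lebesgue)"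
proof -
  obtain B where B: "\<And>x. \<bar>\<phi> x\<bar> \<le> B" using test_function_bounded[OF \<phi>] by metis
  have [measurable]: "\<phi> \<in> borel_measurable borel"
    using smooth_measurable(1)[OF test_function_smooth[OF \<phi>]] .
  have m: "(\<lambda>x. \<phi> (x - a)) \<in> borel_measurable lebesgue"
    by (intro measurable_completion) measurable
  have ia: "integrable lebesgue (\<lambda>x. \<phi> (x - a) * u x)"
    by (rule integrable_bounded_mult[OF u m B])
  have ta: "integrable lebesgue (\<lambda>x. u (x + a))"
    using integrable_lebesgue_translation[OF u, of a] by (simp add: add.commute)
  have "(\<integral>x. (\<phi> x - \<phi> (x - a)) * u x \<partial>lebesgue) =
      (\<integral>x. \<phi> x * u x \<partial>lebesgue) - (\<integral>x. \<phi> (x - a) * u x \<partial>lebesgue)"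
    by (simp add: left_diff_distrib ia test_function_integrable_mult[OF \<phi> u])
  also have "(\<integral>x. \<phi> (x - a) * u x \<partial>lebesgue) = (\<integral>x. \<phi> x * u (x + a) \<partial>lebesgue)"
    using integral_lebesgue_translation[OF ia, of a] by (simp add: add.commute)
  finally show ?thesis
    by (simp add: right_diff_distrib test_function_integrable_mult[OF \<phi>] u ta)
qed

lemma open_segment_inside:
  fixes \<Omega> :: "'a::real_normed_vector set"
  assumes "open \<Omega>"
  shows "open {x. \<forall>s\<in>{0..t}. x + s *\<^sub>R e \<in> \<Omega>}"
proof -
  have "compact ((\<lambda>s. - (s *\<^sub>R e)) ` {0..t})"
    by (intro compact_continuous_image continuous_intros) auto
  then have "closed (\<Union>y\<in>- \<Omega>. \<Union>z\<in>(\<lambda>s. - (s *\<^sub>R e)) ` {0..t}. {y + z})"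
    using assms by (intro closed_compact_sums) (auto simp: closed_def)
  also have "(\<Union>y\<in>- \<Omega>. \<Union>z\<in>(\<lambda>s. - (s *\<^sub>R e)) ` {0..t}. {y + z}) = - {x. \<forall>s\<in>{0..t}. x + s *\<^sub>R e \<in> \<Omega>}"
  proof (intro equalityI subsetI)
    fix x assume "x \<in> - {x. \<forall>s\<in>{0..t}. x + s *\<^sub>R e \<in> \<Omega>}"
    then obtain s where "s \<in> {0..t}" "x + s *\<^sub>R e \<in> - \<Omega>" by auto
    moreover have "x = (x + s *\<^sub>R e) + - (s *\<^sub>R e)" by simp
    ultimately show "x \<in> (\<Union>y\<in>- \<Omega>. \<Union>z\<in>(\<lambda>s. - (s *\<^sub>R e)) ` {0..t}. {y + z})"
      by blast
  next
    fix x assume "x \<in> (\<Union>y\<in>- \<Omega>. \<Union>z\<in>(\<lambda>s. - (s *\<^sub>R e)) ` {0..t}. {y + z})"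
    then obtain y s where "y \<in> - \<Omega>" "s \<in> {0..t}" "x = y + - (s *\<^sub>R e)" by blast
    then have "s \<in> {0..t}" "x + s *\<^sub>R e \<notin> \<Omega>" by simp_all
    then show "x \<in> - {x. \<forall>s\<in>{0..t}. x + s *\<^sub>R e \<in> \<Omega>}" by blast
  qed
  finally show ?thesis by (simp add: closed_open)
qed

lemma test_function_segment_integral:
  assumes \<phi>: "\<phi> \<in> test_functions {x. \<forall>s\<in>{0..t}. x + s *\<^sub>R e \<in> \<Omega>}"
  shows "segment_integral (- e) t \<phi> \<in> test_functions \<Omega>"
proof -
  obtain K where K: "compact K" "K \<subseteq> {x. \<forall>s\<in>{0..t}. x + s *\<^sub>R e \<in> \<Omega>}" "\<And>x. x \<notin> K \<Longrightarrow> \<phi> x = 0"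
    using test_function_support[OF \<phi>] by blast
  show ?thesis
  proof (rule test_functionsI)
    show "smooth (segment_integral (- e) t \<phi>)"
      using \<phi> test_function_smooth by (intro smooth_segment_integral) auto
    show "compact ((\<lambda>(x, s). x + s *\<^sub>R e) ` (K \<times> {0..t}))"
      using K(1) by (intro compact_continuous_image compact_Times) (auto intro!: continuous_intros simp: case_prod_beta')
    show "(\<lambda>(x, s). x + s *\<^sub>R e) ` (K \<times> {0..t}) \<subseteq> \<Omega>"
      using K(2) by auto
    fix y assume y: "y \<notin> (\<lambda>(x, s). x + s *\<^sub>R e) ` (K \<times> {0..t})"
    have "\<phi> (y + s *\<^sub>R (- e)) = 0" if s: "s \<in> {0..t}" for s
    proof (rule K(3), rule notI)
      assume "y + s *\<^sub>R (- e) \<in> K"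
      moreover have "y = (y + s *\<^sub>R (- e)) + s *\<^sub>R e" by simp
      ultimately show False using y s by (metis (no_types, lifting) SigmaI case_prod_conv imageI)
    qed
    then have "(\<lambda>s. indicator {0..t} s * \<phi> (y + s *\<^sub>R (- e))) = (\<lambda>s. 0)"
      by (auto simp: indicator_def)
    then show "segment_integral (- e) t \<phi> y = 0" by (simp add: segment_integral_def)
  qed
qed

text \<open>
  For \<open>\<phi> \<ge> 0\<close> on the set of points whose segment lies in \<open>\<Omega>\<close>, the backward average \<open>\<psi>\<close> of \<open>\<phi>\<close> is a test
  function on \<open>\<Omega>\<close>. Its \<open>j\<close>-th derivative turns the left side of the hypothesis into the integral of \<open>\<phi>\<close>
  times the increment of \<open>u\<close>, and Fubini turns the right side into the integral of \<open>\<phi>\<close> times the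
  segment integral of \<open>g\<close>.
\<close>

lemma segment_bound_of_weak_derivative_bound:
  fixes u g :: "real^'n::finite \<Rightarrow> real"
  defines "e j \<equiv> axis j 1"
  assumes \<Omega>: "open \<Omega>" and t: "t \<ge> 0"
    and u: "integrable lebesgue u" and g: "integrable lborel g"
    and Q: "\<And>\<phi>. \<phi> \<in> test_functions \<Omega> \<Longrightarrow>
      \<bar>\<integral>x. partial j \<phi> x * u x \<partial>lebesgue\<bar> \<le> (\<integral>x. \<bar>\<phi> x\<bar> * g x \<partial>lborel)"
  shows "AE x in lebesgue. (\<forall>s\<in>{0..t}. x + s *\<^sub>R e j \<in> \<Omega>) \<longrightarrow>
    \<bar>u (x + t *\<^sub>R e j) - u x\<bar> \<le> segment_integral (e j) t g x"
proof -
  let ?\<Omega> = "{x. \<forall>s\<in>{0..t}. x + s *\<^sub>R e j \<in> \<Omega>}"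
  let ?d = "\<lambda>x. u (x + t *\<^sub>R e j) - u x"
  let ?I = "segment_integral (e j) t g"
  have ta: "integrable lebesgue (\<lambda>x. u (x + t *\<^sub>R e j))"
    using integrable_lebesgue_translation[OF u, of "t *\<^sub>R e j"] by (simp add: add.commute)
  have I: "integrable lborel ?I" by (rule integrable_segment_integral[OF g t])
  have IL: "integrable lebesgue ?I"
    using I integrable_completion[of ?I lborel] borel_measurable_integrable by blast
  have main: "AE x in lebesgue. x \<in> ?\<Omega> \<longrightarrow> 0 \<le> ?I x + \<sigma> * ?d x" if \<sigma>: "\<bar>\<sigma>\<bar> = 1" for \<sigma> :: real
  proof (rule du_Bois_Reymond_nonneg)
    show "open ?\<Omega>" by (rule open_segment_inside[OF \<Omega>])
    show "integrable lebesgue (\<lambda>x. ?I x + \<sigma> * ?d x)"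
      using IL u ta by auto
    fix \<phi> assume \<phi>: "\<phi> \<in> test_functions ?\<Omega>" and pos: "\<And>x. 0 \<le> \<phi> x"
    define \<psi> where "\<psi> = segment_integral (- e j) t \<phi>"
    have sm: "smooth \<phi>" using \<phi> by (rule test_function_smooth)
    have [measurable]: "\<phi> \<in> borel_measurable borel" by (rule smooth_measurable(1)[OF sm])
    obtain B where B: "\<And>x. \<bar>\<phi> x\<bar> \<le> B" using test_function_bounded[OF \<phi>] by metis
    have \<psi>: "\<psi> \<in> test_functions \<Omega>" unfolding \<psi>_def by (rule test_function_segment_integral[OF \<phi>])
    have \<psi>0: "0 \<le> \<psi> x" for x unfolding \<psi>_def by (rule segment_integral_nonneg[OF pos])
    have "(\<integral>x. partial j \<psi> x * u x \<partial>lebesgue) = (\<integral>x. (\<phi> x - \<phi> (x - t *\<^sub>R e j)) * u x \<partial>lebesgue)"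
      unfolding \<psi>_def partial_segment_integral[OF sm] e_def by (simp only: segment_integral_partial[OF sm t])
    also have "\<dots> = - (\<integral>x. \<phi> x * ?d x \<partial>lebesgue)"
      by (rule integral_translate_difference[OF \<phi> u])
    finally have 1: "(\<integral>x. partial j \<psi> x * u x \<partial>lebesgue) = - (\<integral>x. \<phi> x * ?d x \<partial>lebesgue)" .
    have "(\<integral>x. \<bar>\<psi> x\<bar> * g x \<partial>lborel) = (\<integral>y. g y * segment_integral (- e j) t \<phi> y \<partial>lborel)"
      using \<psi>0 by (simp add: \<psi>_def mult.commute)
    also have "\<dots> = (\<integral>x. \<phi> x * ?I x \<partial>lborel)"
      by (rule segment_integral_Fubini[OF g t _ B, symmetric]) simp
    also have "\<dots> = (\<integral>x. \<phi> x * ?I x \<partial>lebesgue)"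
      by (rule integral_completion[symmetric]) (use I in measurable)
    finally have 2: "(\<integral>x. \<bar>\<psi> x\<bar> * g x \<partial>lborel) = (\<integral>x. \<phi> x * ?I x \<partial>lebesgue)" .
    have "\<bar>\<integral>x. \<phi> x * ?d x \<partial>lebesgue\<bar> \<le> (\<integral>x. \<phi> x * ?I x \<partial>lebesgue)"
      using Q[OF \<psi>] 1 2 by simp
    then have "0 \<le> (\<integral>x. \<phi> x * ?I x \<partial>lebesgue) + \<sigma> * (\<integral>x. \<phi> x * ?d x \<partial>lebesgue)"
      using \<sigma> by (cases "\<sigma> \<ge> 0") (auto simp: abs_if split: if_splits)
    also have "\<dots> = (\<integral>x. \<phi> x * ?I x + \<sigma> * (\<phi> x * ?d x) \<partial>lebesgue)"
      using test_function_integrable_mult[OF \<phi> IL] test_function_integrable_mult[OF \<phi>, of ?d] ta u by simp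
    also have "\<dots> = (\<integral>x. \<phi> x * (?I x + \<sigma> * ?d x) \<partial>lebesgue)"
      by (simp add: algebra_simps)
    finally show "0 \<le> (\<integral>x. \<phi> x * (?I x + \<sigma> * ?d x) \<partial>lebesgue)" .
  qed
  show ?thesis
    using main[of 1, simplified] main[of "-1", simplified] by eventually_elim auto
qed

lemma smooth_lipschitz_axis:
  assumes "smooth \<phi>" "\<And>x. \<bar>partial j \<phi> x\<bar> \<le> C"
  shows "\<bar>\<phi> (y - s *\<^sub>R axis j 1) - \<phi> y\<bar> \<le> C * \<bar>s\<bar>"
  using field_differentiable_bound[of UNIV "\<lambda>s. \<phi> (y + s *\<^sub>R axis j 1)" "\<lambda>s. partial j \<phi> (y + s *\<^sub>R axis j 1)" C "- s" 0]
    smooth_DERIV_axis[OF assms(1)] assms(2) by simp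

text \<open>
  The derivative of \<open>\<phi>\<close> is a limit of difference quotients. Moving each difference from \<open>\<phi>\<close> to \<open>u\<close> and
  using the bound on increments leaves the integral of \<open>g\<close> times the average of \<open>\<bar>\<phi>\<bar>\<close> over a segment of
  length \<open>t\<close>. This average differs from \<open>\<bar>\<phi>\<bar>\<close> by at most \<open>C * t\<close>, where \<open>C\<close> bounds the derivative of \<open>\<phi>\<close>.
\<close>

lemma weak_derivative_bound_of_segment_bound:
  fixes u g :: "real^'n::finite \<Rightarrow> real"
  defines "e j \<equiv> axis j 1"
  assumes \<Omega>: "open \<Omega>" and u: "integrable lebesgue u" and g: "integrable lborel g" and g0: "\<And>x. 0 \<le> g x"
    and Q: "\<And>t. t > 0 \<Longrightarrow> AE x in lebesgue. (\<forall>s\<in>{0..t}. x + s *\<^sub>R e j \<in> \<Omega>) \<longrightarrow>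
      \<bar>u (x + t *\<^sub>R e j) - u x\<bar> \<le> segment_integral (e j) t g x"
    and \<phi>: "\<phi> \<in> test_functions \<Omega>"
  shows "\<bar>\<integral>x. partial j \<phi> x * u x \<partial>lebesgue\<bar> \<le> (\<integral>x. \<bar>\<phi> x\<bar> * g x \<partial>lborel)"
proof -
  have sm: "smooth \<phi>" using \<phi> by (rule test_function_smooth)
  have [measurable]: "\<phi> \<in> borel_measurable borel" by (rule smooth_measurable(1)[OF sm])
  have [measurable]: "partial j \<phi> \<in> borel_measurable borel" by (rule smooth_measurable(1)[OF smooth_partial[OF sm]])
  have [measurable]: "g \<in> borel_measurable borel" "u \<in> borel_measurable lebesgue" using g u by auto
  obtain K where K: "compact K" "K \<subseteq> \<Omega>" "\<And>x. x \<notin> K \<Longrightarrow> \<phi> x = 0"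
    using test_functionE[OF \<phi>] by metis
  obtain B where B: "\<And>x. \<bar>\<phi> x\<bar> \<le> B" using test_function_bounded[OF \<phi>] by metis
  obtain C where C: "C \<ge> 0" "\<And>x. \<bar>partial j \<phi> x\<bar> \<le> C"
    using test_function_bounded[OF test_function_partial[OF \<phi>]] by metis
  obtain \<delta> where \<delta>: "\<delta> > 0" "(\<Union>x\<in>K. cball x \<delta>) \<subseteq> \<Omega>"
    using compact_subset_open_imp_cball_epsilon_subset[OF K(1) \<Omega> K(2)] by metis
  \<comment> \<open>Steps of length at most \<open>\<delta>\<close> keep the segments that start in the support of \<open>\<phi>\<close> inside \<open>\<Omega>\<close>.\<close>
  define t where "t n = \<delta> / real (Suc n)" for n
  have t: "t n > 0" "t n \<le> \<delta>" for n using \<delta>(1) by (auto simp: t_def field_simps)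
  have t0: "t \<longlonglongrightarrow> 0" unfolding t_def by (rule lim_const_over_n[THEN LIMSEQ_Suc])
  define E where "E n y = (\<phi> y - \<phi> (y - t n *\<^sub>R e j)) / t n" for n y
  have [measurable]: "E n \<in> borel_measurable borel" for n unfolding E_def by measurable
  have E_bound: "\<bar>E n y\<bar> \<le> C" for n y
    using smooth_lipschitz_axis[OF sm C(2), of y "t n"] t(1)[of n]
    by (simp add: E_def e_def abs_minus_commute field_simps)
  have E_lim: "(\<lambda>n. E n y) \<longlonglongrightarrow> partial j \<phi> y" for y
  proof -
    have "((\<lambda>h. (\<phi> (y + (0 + h) *\<^sub>R e j) - \<phi> (y + 0 *\<^sub>R e j)) / h) \<longlongrightarrow> partial j \<phi> y) (at 0)"
      using smooth_DERIV_axis[OF sm, of y j 0] by (simp add: DERIV_def e_def)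
    moreover have "filterlim (\<lambda>n. - t n) (at 0) sequentially"
      using tendsto_minus[OF t0] less_imp_neq[OF t(1)] by (auto simp: filterlim_at intro!: always_eventually)
    ultimately have "(\<lambda>n. (\<phi> (y + (0 + - t n) *\<^sub>R e j) - \<phi> (y + 0 *\<^sub>R e j)) / - t n) \<longlonglongrightarrow> partial j \<phi> y"
      by (rule filterlim_compose)
    then show ?thesis by (simp add: E_def minus_divide_left[symmetric] diff_divide_distrib algebra_simps)
  qed
  have lim: "(\<lambda>n. \<integral>x. E n x * u x \<partial>lebesgue) \<longlonglongrightarrow> (\<integral>x. partial j \<phi> x * u x \<partial>lebesgue)"
  proof (rule integral_dominated_convergence[where w = "\<lambda>x. C * \<bar>u x\<bar>"])
    show "AE x in lebesgue. (\<lambda>i. E i x * u x) \<longlonglongrightarrow> partial j \<phi> x * u x"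
      by (intro AE_I2 tendsto_intros E_lim)
    show "AE x in lebesgue. norm (E i x * u x) \<le> C * \<bar>u x\<bar>" for i
      by (intro AE_I2) (auto simp: abs_mult intro!: mult_right_mono E_bound)
    have [measurable]: "partial j \<phi> \<in> borel_measurable lebesgue" "E i \<in> borel_measurable lebesgue" for i
      by (rule measurable_completion; simp)+
    show "(\<lambda>x. partial j \<phi> x * u x) \<in> borel_measurable lebesgue" by measurable
    show "(\<lambda>x. E i x * u x) \<in> borel_measurable lebesgue" for i by measurable
  qed (use u in auto)
  have gi: "integrable lborel (\<lambda>x. \<bar>\<phi> x\<bar> * g x)"
    by (rule integrable_bounded_mult[OF g, where B = B]) (use B in auto)
  have bound: "\<bar>\<integral>x. E n x * u x \<partial>lebesgue\<bar> \<le> (\<integral>x. \<bar>\<phi> x\<bar> * g x \<partial>lborel) + t n * C * (\<integral>x. g x \<partial>lborel)" for n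
  proof -
    let ?d = "\<lambda>x. u (x + t n *\<^sub>R e j) - u x"
    let ?I = "segment_integral (e j) (t n) g"
    have tn: "t n \<ge> 0" using t(1)[of n] by simp
    have I: "integrable lborel ?I" by (rule integrable_segment_integral[OF g tn])
    have [measurable]: "?I \<in> borel_measurable borel" using I by auto
    have IL: "integrable lebesgue ?I"
      using I integrable_completion[of ?I lborel] borel_measurable_integrable by blast
    have "(\<integral>x. E n x * u x \<partial>lebesgue) = (\<integral>x. (\<phi> x - \<phi> (x - t n *\<^sub>R e j)) * u x \<partial>lebesgue) / t n"
      unfolding E_def by (subst integral_divide_zero[symmetric]) simp
    also have "\<bar>\<dots>\<bar> = \<bar>\<integral>x. \<phi> x * ?d x \<partial>lebesgue\<bar> / t n"
      using tn by (simp add: integral_translate_difference[OF \<phi> u])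
    also have "\<bar>\<integral>x. \<phi> x * ?d x \<partial>lebesgue\<bar> \<le> (\<integral>x. \<bar>\<phi> x * ?d x\<bar> \<partial>lebesgue)"
      by (rule integral_abs_bound)
    also have "\<dots> \<le> (\<integral>x. \<bar>\<phi> x\<bar> * ?I x \<partial>lebesgue)"
    proof (rule integral_mono_AE)
      have "integrable lebesgue (\<lambda>x. u (x + t n *\<^sub>R e j))"
        using integrable_lebesgue_translation[OF u, of "t n *\<^sub>R e j"] by (simp add: add.commute)
      then show "integrable lebesgue (\<lambda>x. \<bar>\<phi> x * ?d x\<bar>)"
        using u by (intro integrable_abs test_function_integrable_mult[OF \<phi>]) auto
      show "integrable lebesgue (\<lambda>x. \<bar>\<phi> x\<bar> * ?I x)"
        by (rule integrable_bounded_mult[OF IL, where B = B]) (use B in \<open>auto intro: measurable_completion\<close>)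
      show "AE x in lebesgue. \<bar>\<phi> x * ?d x\<bar> \<le> \<bar>\<phi> x\<bar> * ?I x"
        using Q[OF t(1)[of n]]
      proof eventually_elim
        case (elim x)
        show ?case
        proof (cases "x \<in> K")
          case False
          then show ?thesis using K(3) by simp
        next
          case True
          have "x + s *\<^sub>R e j \<in> \<Omega>" if s: "s \<in> {0..t n}" for s
          proof -
            have "dist x (x + s *\<^sub>R e j) \<le> \<delta>"
              using s t(2)[of n] by (simp add: dist_norm e_def)
            then show ?thesis using True \<delta>(2) by (auto simp: subset_iff)
          qed
          then have "\<bar>?d x\<bar> \<le> ?I x" using elim by blast
          then show ?thesis by (simp add: abs_mult mult_left_mono)
        qed
      qed
    qed
    also have "(\<integral>x. \<bar>\<phi> x\<bar> * ?I x \<partial>lebesgue) = (\<integral>x. \<bar>\<phi> x\<bar> * ?I x \<partial>lborel)"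
      by (rule integral_completion) measurable
    also have "\<dots> = (\<integral>y. g y * segment_integral (- e j) (t n) (\<lambda>x. \<bar>\<phi> x\<bar>) y \<partial>lborel)"
      by (rule segment_integral_Fubini[OF g tn, where B = B]) (use B in auto)
    also have "\<dots> \<le> (\<integral>y. t n * (\<bar>\<phi> y\<bar> * g y) + t n * (t n * C) * g y \<partial>lborel)"
    proof (rule integral_mono)
      have seg: "segment_integral (- e j) (t n) (\<lambda>x. \<bar>\<phi> x\<bar>) y \<le> t n * (\<bar>\<phi> y\<bar> + t n * C)"
        "0 \<le> segment_integral (- e j) (t n) (\<lambda>x. \<bar>\<phi> x\<bar>) y" for y
      proof -
        have "segment_integral (- e j) (t n) (\<lambda>x. \<bar>\<phi> x\<bar>) y \<le> (\<integral>s. indicator {0..t n} s * (\<bar>\<phi> y\<bar> + t n * C) \<partial>lborel)"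
          unfolding segment_integral_def
        proof (rule integral_mono)
          have i: "integrable lborel (\<lambda>s. indicator {0..t n} s * c :: real)" for c
            by (intro integrable_mult_left integrable_real_indicator) (auto simp: emeasure_lborel_Icc_eq)
          show "integrable lborel (\<lambda>s. indicator {0..t n} s * (\<bar>\<phi> y\<bar> + t n * C))" by (rule i)
          show "integrable lborel (\<lambda>s. indicator {0..t n} s * \<bar>\<phi> (y + s *\<^sub>R - e j)\<bar>)"
            by (rule Bochner_Integration.integrable_bound[OF i[of B]])
               (use B in \<open>auto simp: indicator_def intro: order_trans[OF _ abs_ge_self]\<close>)
          fix s
          show "indicator {0..t n} s * \<bar>\<phi> (y + s *\<^sub>R - e j)\<bar> \<le> indicator {0..t n} s * (\<bar>\<phi> y\<bar> + t n * C)"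
          proof (cases "s \<in> {0..t n}")
            case True
            have "\<bar>\<phi> (y - s *\<^sub>R axis j 1) - \<phi> y\<bar> \<le> C * \<bar>s\<bar>" by (rule smooth_lipschitz_axis[OF sm C(2)])
            also have "\<dots> \<le> C * t n" using True C(1) by (intro mult_left_mono) auto
            finally show ?thesis using True by (simp add: e_def mult.commute)
          qed simp
        qed
        also have "\<dots> = t n * (\<bar>\<phi> y\<bar> + t n * C)" using tn by simp
        finally show "segment_integral (- e j) (t n) (\<lambda>x. \<bar>\<phi> x\<bar>) y \<le> t n * (\<bar>\<phi> y\<bar> + t n * C)" .
        show "0 \<le> segment_integral (- e j) (t n) (\<lambda>x. \<bar>\<phi> x\<bar>) y" by (rule segment_integral_nonneg) simp
      qed
      show maj: "integrable lborel (\<lambda>y. t n * (\<bar>\<phi> y\<bar> * g y) + t n * (t n * C) * g y)"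
        using gi g by auto
      show le: "g y * segment_integral (- e j) (t n) (\<lambda>x. \<bar>\<phi> x\<bar>) y \<le> t n * (\<bar>\<phi> y\<bar> * g y) + t n * (t n * C) * g y" for y
        using mult_left_mono[OF seg(1)[of y] g0[of y]] by (simp add: algebra_simps)
      have [measurable]: "segment_integral (- e j) (t n) (\<lambda>x. \<bar>\<phi> x\<bar>) \<in> borel_measurable borel"
        unfolding segment_integral_def[abs_def] by (rule lborel.borel_measurable_lebesgue_integral) measurable
      show "integrable lborel (\<lambda>y. g y * segment_integral (- e j) (t n) (\<lambda>x. \<bar>\<phi> x\<bar>) y)"
        by (rule Bochner_Integration.integrable_bound[OF maj])
           (use le seg(2) g0 in \<open>auto intro: order_trans[OF _ abs_ge_self]\<close>)
    qed
    also have "\<dots> = t n * (\<integral>x. \<bar>\<phi> x\<bar> * g x \<partial>lborel) + t n * (t n * C) * (\<integral>x. g x \<partial>lborel)"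
      using gi g by simp
    also have "\<dots> = t n * ((\<integral>x. \<bar>\<phi> x\<bar> * g x \<partial>lborel) + t n * C * (\<integral>x. g x \<partial>lborel))"
      by (simp add: algebra_simps)
    finally show ?thesis
      using t(1)[of n] by (simp add: divide_right_mono pos_divide_le_eq mult.commute)
  qed
  have "(\<lambda>n. (\<integral>x. \<bar>\<phi> x\<bar> * g x \<partial>lborel) + t n * C * (\<integral>x. g x \<partial>lborel)) \<longlonglongrightarrow> (\<integral>x. \<bar>\<phi> x\<bar> * g x \<partial>lborel) + 0 * C * (\<integral>x. g x \<partial>lborel)"
    by (intro tendsto_intros t0)
  from LIMSEQ_le[OF tendsto_rabs[OF lim] this] bound show ?thesis by auto
qed

text \<open>
  The functional \<open>\<phi> \<mapsto> \<integral> \<partial>\<^sub>j\<phi> u\<close> is bounded in the \<open>L\<^sup>1\<close> norm of the finite measure \<open>g dx\<close>, so it is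
  integration against some \<open>h\<close> with respect to this measure, and \<open>G = - g h\<close> is the weak derivative.
  The inequality \<open>\<bar>G\<bar> \<le> g\<close> follows by testing \<open>g + G\<close> and \<open>g - G\<close> with nonnegative functions.
\<close>

lemma weak_derivative_of_weak_derivative_bound:
  fixes u g :: "real^'n::finite \<Rightarrow> real"
  assumes \<Omega>: "open \<Omega>" and u: "integrable lebesgue u" and g: "integrable lborel g" and g0: "\<And>x. 0 \<le> g x"
    and Q: "\<And>\<phi>. \<phi> \<in> test_functions \<Omega> \<Longrightarrow>
      \<bar>\<integral>x. partial j \<phi> x * u x \<partial>lebesgue\<bar> \<le> (\<integral>x. \<bar>\<phi> x\<bar> * g x \<partial>lborel)"
  shows "\<exists>G. integrable lebesgue G \<and> (AE x in lebesgue. x \<in> \<Omega> \<longrightarrow> \<bar>G x\<bar> \<le> g x) \<and>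
    (\<forall>\<phi>\<in>test_functions \<Omega>. (\<integral>x. partial j \<phi> x * u x \<partial>lebesgue) = - (\<integral>x. \<phi> x * G x \<partial>lebesgue))"
proof -
  have [measurable]: "g \<in> borel_measurable borel" using g by auto
  define M where "M = density lborel (\<lambda>x. ennreal (g x))"
  define T where "T \<phi> = (\<integral>x. partial j \<phi> x * u x \<partial>lebesgue)" for \<phi>
  have [simp]: "sets M = sets borel" by (simp add: M_def)
  have m: "\<phi> \<in> borel_measurable borel" if "\<phi> \<in> test_functions \<Omega>" for \<phi>
    using smooth_measurable(1)[OF test_function_smooth[OF that]] .
  have pi: "integrable lebesgue (\<lambda>x. partial j \<phi> x * u x)" if "\<phi> \<in> test_functions \<Omega>" for \<phi>
    using test_function_integrable_mult[OF test_function_partial[OF that] u] .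
  have "finite_measure M"
  proof
    have "emeasure M (space M) = (\<integral>\<^sup>+x. ennreal (g x) \<partial>lborel)"
      by (simp add: M_def emeasure_density)
    also have "\<dots> = ennreal (\<integral>x. g x \<partial>lborel)"
      using g g0 by (intro nn_integral_eq_integral) auto
    finally show "emeasure M (space M) \<noteq> \<infinity>" by simp
  qed
  then have "\<exists>h. integrable M h \<and> (\<forall>\<phi>\<in>test_functions \<Omega>. T \<phi> = (\<integral>x. \<phi> x * h x \<partial>M))"
  proof (rule L1_bounded_functional_representation[where D = "test_functions \<Omega>" and T = T])
    fix \<phi> assume \<phi>: "\<phi> \<in> test_functions \<Omega>"
    show "\<phi> \<in> borel_measurable M" using m[OF \<phi>] by (simp add: M_def)
    show "\<exists>B. \<forall>x. \<bar>\<phi> x\<bar> \<le> B" using test_function_bounded[OF \<phi>] by metis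
    show "(\<lambda>x. c * \<phi> x) \<in> test_functions \<Omega>" for c by (rule test_function_cmult[OF \<phi>])
    show "T (\<lambda>x. c * \<phi> x) = c * T \<phi>" for c
      by (simp add: T_def partial_cmult[OF test_function_smooth[OF \<phi>]] mult.assoc)
    show "\<bar>T \<phi>\<bar> \<le> (\<integral>x. \<bar>\<phi> x\<bar> \<partial>M)"
      using Q[OF \<phi>] m[OF \<phi>] g0 unfolding T_def M_def by (subst integral_density) (auto simp: mult.commute)
    fix \<psi> assume \<psi>: "\<psi> \<in> test_functions \<Omega>"
    show "(\<lambda>x. \<phi> x + \<psi> x) \<in> test_functions \<Omega>" by (rule test_function_add[OF \<phi> \<psi>])
    show "T (\<lambda>x. \<phi> x + \<psi> x) = T \<phi> + T \<psi>"
      by (simp add: T_def partial_add test_function_smooth[OF \<phi>] test_function_smooth[OF \<psi>] distrib_right pi \<phi> \<psi>)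
  next
    have "(\<lambda>x. 0) \<in> test_functions \<Omega>" by (rule test_functionsI[where K = "{}"]) (auto simp: smooth_const)
    then show "test_functions \<Omega> \<noteq> {}" by blast
  qed blast
  then obtain h where h: "integrable M h" "\<And>\<phi>. \<phi> \<in> test_functions \<Omega> \<Longrightarrow> T \<phi> = (\<integral>x. \<phi> x * h x \<partial>M)"
    by blast
  have hm[measurable]: "h \<in> borel_measurable borel" using borel_measurable_integrable[OF h(1)] by (simp add: M_def)
  define H where "H x = g x * h x" for x
  have [measurable]: "H \<in> borel_measurable borel" unfolding H_def by measurable
  have Hi: "integrable lborel H"
    using h(1) g0 unfolding M_def H_def[abs_def] by (subst (asm) integrable_density) auto
  have HL: "integrable lebesgue H" using Hi integrable_completion[of H lborel] by simp
  have gL: "integrable lebesgue g" using g integrable_completion[of g lborel] by simp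
  have T: "T \<phi> = (\<integral>x. \<phi> x * H x \<partial>lebesgue)" if \<phi>: "\<phi> \<in> test_functions \<Omega>" for \<phi>
  proof -
    have "T \<phi> = (\<integral>x. g x *\<^sub>R (\<phi> x * h x) \<partial>lborel)"
      unfolding h(2)[OF \<phi>] M_def using m[OF \<phi>] g0 by (intro integral_density) auto
    also have "\<dots> = (\<integral>x. \<phi> x * H x \<partial>lborel)" by (simp add: H_def mult_ac)
    also have "\<dots> = (\<integral>x. \<phi> x * H x \<partial>lebesgue)"
      using m[OF \<phi>] by (intro integral_completion[symmetric]) auto
    finally show ?thesis .
  qed
  have main: "AE x in lebesgue. x \<in> \<Omega> \<longrightarrow> 0 \<le> g x + \<sigma> * H x" if \<sigma>: "\<bar>\<sigma>\<bar> = 1" for \<sigma> :: real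
  proof (rule du_Bois_Reymond_nonneg[OF \<Omega>])
    show "integrable lebesgue (\<lambda>x. g x + \<sigma> * H x)" using gL HL by auto
    fix \<phi> assume \<phi>: "\<phi> \<in> test_functions \<Omega>" and pos: "\<And>x. 0 \<le> \<phi> x"
    have "\<bar>T \<phi>\<bar> \<le> (\<integral>x. \<phi> x * g x \<partial>lborel)" using Q[OF \<phi>] pos by (simp add: T_def)
    also have "\<dots> = (\<integral>x. \<phi> x * g x \<partial>lebesgue)"
      using m[OF \<phi>] by (intro integral_completion[symmetric]) auto
    finally have "0 \<le> (\<integral>x. \<phi> x * g x \<partial>lebesgue) + \<sigma> * T \<phi>"
      using \<sigma> by (cases "\<sigma> \<ge> 0") (auto simp: abs_if split: if_splits)
    also have "\<dots> = (\<integral>x. \<phi> x * g x + \<sigma> * (\<phi> x * H x) \<partial>lebesgue)"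
      unfolding T[OF \<phi>] using test_function_integrable_mult[OF \<phi>] gL HL by simp
    also have "\<dots> = (\<integral>x. \<phi> x * (g x + \<sigma> * H x) \<partial>lebesgue)"
      by (simp add: algebra_simps)
    finally show "0 \<le> (\<integral>x. \<phi> x * (g x + \<sigma> * H x) \<partial>lebesgue)" .
  qed
  show ?thesis
  proof (intro exI[of _ "\<lambda>x. - H x"] conjI ballI)
    show "integrable lebesgue (\<lambda>x. - H x)" using HL by simp
    show "AE x in lebesgue. x \<in> \<Omega> \<longrightarrow> \<bar>- H x\<bar> \<le> g x"
      using main[of 1, simplified] main[of "-1", simplified] by eventually_elim auto
    fix \<phi> assume "\<phi> \<in> test_functions \<Omega>"
    from T[OF this] show "(\<integral>x. partial j \<phi> x * u x \<partial>lebesgue) = - (\<integral>x. \<phi> x * - H x \<partial>lebesgue)"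
      by (simp add: T_def)
  qed
qed

section \<open>Lebesgue spaces on a bounded open set\<close>

lemma Lp_mono:
  assumes g: "g \<in> Lp p \<Omega>" and m: "h \<in> borel_measurable (lebesgue_on \<Omega>)" and p: "0 \<le> p"
    and le: "AE x in lebesgue_on \<Omega>. \<bar>h x\<bar> \<le> \<bar>g x\<bar>"
  shows "h \<in> Lp p \<Omega>"
proof -
  have "integrable (lebesgue_on \<Omega>) (\<lambda>x. \<bar>h x\<bar> powr p)"
  proof (rule Bochner_Integration.integrable_bound)
    show "integrable (lebesgue_on \<Omega>) (\<lambda>x. \<bar>g x\<bar> powr p)" using g by (simp add: Lp_def)
    show "(\<lambda>x. \<bar>h x\<bar> powr p) \<in> borel_measurable (lebesgue_on \<Omega>)" using m by measurable
    show "AE x in lebesgue_on \<Omega>. norm (\<bar>h x\<bar> powr p) \<le> norm (\<bar>g x\<bar> powr p)"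
      using le
    proof eventually_elim
      case (elim x)
      then show ?case using p by (simp add: powr_mono2)
    qed
  qed
  with m show ?thesis by (simp add: Lp_def)
qed

lemma Lp_add:
  assumes u: "u \<in> Lp p \<Omega>" and v: "v \<in> Lp p \<Omega>" and p: "0 \<le> p"
  shows "(\<lambda>x. u x + v x) \<in> Lp p \<Omega>"
proof -
  have [measurable]: "u \<in> borel_measurable (lebesgue_on \<Omega>)" "v \<in> borel_measurable (lebesgue_on \<Omega>)"
    using u v by (auto simp: Lp_def)
  have "integrable (lebesgue_on \<Omega>) (\<lambda>x. \<bar>u x + v x\<bar> powr p)"
  proof (rule Bochner_Integration.integrable_bound)
    show "integrable (lebesgue_on \<Omega>) (\<lambda>x. 2 powr p * (\<bar>u x\<bar> powr p + \<bar>v x\<bar> powr p))"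
      using u v by (simp add: Lp_def)
    show "AE x in lebesgue_on \<Omega>. norm (\<bar>u x + v x\<bar> powr p) \<le> norm (2 powr p * (\<bar>u x\<bar> powr p + \<bar>v x\<bar> powr p))"
    proof (intro AE_I2)
      fix x
      have "\<bar>u x + v x\<bar> powr p \<le> (2 * max \<bar>u x\<bar> \<bar>v x\<bar>) powr p"
        using p by (intro powr_mono2) auto
      also have "\<dots> = 2 powr p * max \<bar>u x\<bar> \<bar>v x\<bar> powr p" by (rule powr_mult)
      also have "\<dots> \<le> 2 powr p * (\<bar>u x\<bar> powr p + \<bar>v x\<bar> powr p)"
        by (intro mult_left_mono) (auto simp: max_def)
      finally show "norm (\<bar>u x + v x\<bar> powr p) \<le> norm (2 powr p * (\<bar>u x\<bar> powr p + \<bar>v x\<bar> powr p))"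
        by simp
    qed
  qed measurable
  then show ?thesis by (simp add: Lp_def)
qed

lemma Lp_cmult:
  assumes u: "u \<in> Lp p \<Omega>"
  shows "(\<lambda>x. c * u x) \<in> Lp p \<Omega>"
  using u by (auto simp: Lp_def abs_mult powr_mult)

lemma Lp_abs: "u \<in> Lp p \<Omega> \<Longrightarrow> (\<lambda>x. \<bar>u x\<bar>) \<in> Lp p \<Omega>"
  by (auto simp: Lp_def)

lemma Lp_sum:
  assumes "finite I" "\<And>i. i \<in> I \<Longrightarrow> u i \<in> Lp p \<Omega>" "0 < p"
  shows "(\<lambda>x. \<Sum>i\<in>I. u i x) \<in> Lp p \<Omega>"
  using assms
proof (induction I)
  case empty
  then show ?case by (simp add: Lp_def)
next
  case (insert i I)
  then show ?case using Lp_add[of "u i" p \<Omega> "\<lambda>x. \<Sum>i\<in>I. u i x"] by simp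
qed

lemma finite_measure_lebesgue_on_bounded:
  assumes "open \<Omega>" "bounded (\<Omega> :: (real^'n::finite) set)"
  shows "finite_measure (lebesgue_on \<Omega>)"
proof
  have "emeasure (lebesgue_on \<Omega>) (space (lebesgue_on \<Omega>)) = emeasure lborel \<Omega>"
    using assms by (simp add: emeasure_restrict_space)
  also have "\<dots> < \<infinity>" using assms(2) by (rule emeasure_bounded_finite)
  finally show "emeasure (lebesgue_on \<Omega>) (space (lebesgue_on \<Omega>)) \<noteq> \<infinity>" by simp
qed

lemma Lp_const:
  assumes "open \<Omega>" "bounded (\<Omega> :: (real^'n::finite) set)"
  shows "(\<lambda>x. c) \<in> Lp p \<Omega>"
proof -
  interpret finite_measure "lebesgue_on \<Omega>" by (rule finite_measure_lebesgue_on_bounded[OF assms])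
  show ?thesis by (simp add: Lp_def)
qed

lemma Lp_integrable:
  assumes \<Omega>: "open \<Omega>" "bounded (\<Omega> :: (real^'n::finite) set)" and u: "u \<in> Lp p \<Omega>" and p: "1 \<le> p"
  shows "integrable (lebesgue_on \<Omega>) u"
proof (rule Bochner_Integration.integrable_bound)
  interpret finite_measure "lebesgue_on \<Omega>" by (rule finite_measure_lebesgue_on_bounded[OF \<Omega>])
  show "integrable (lebesgue_on \<Omega>) (\<lambda>x. 1 + \<bar>u x\<bar> powr p)" using u by (simp add: Lp_def)
  show "AE x in lebesgue_on \<Omega>. norm (u x) \<le> norm (1 + \<bar>u x\<bar> powr p)"
  proof (intro AE_I2)
    fix x
    have "\<bar>u x\<bar> \<le> 1 + \<bar>u x\<bar> powr p"
    proof (cases "\<bar>u x\<bar> \<le> 1")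
      case True
      then show ?thesis using powr_ge_zero[of "\<bar>u x\<bar>" p] by linarith
    next
      case False
      then have "\<bar>u x\<bar> powr 1 \<le> \<bar>u x\<bar> powr p" using p by (intro powr_mono) auto
      then show ?thesis using False by simp
    qed
    then show "norm (u x) \<le> norm (1 + \<bar>u x\<bar> powr p)" by simp
  qed
qed (use u in \<open>simp add: Lp_def\<close>)

text \<open>
  Segment integrals restrict a function to null sets, so the bound is replaced by a nonnegative Borel
  function on the whole space to which Fubini applies.
\<close>

lemma Lp_borel_majorant:
  assumes \<Omega>: "open \<Omega>" "bounded (\<Omega> :: (real^'n::finite) set)" and g: "g \<in> Lp p \<Omega>" and p: "1 \<le> p"
  obtains g' where "integrable lborel g'" "\<And>x. 0 \<le> g' x" "AE x in lebesgue_on \<Omega>. \<bar>g x\<bar> = g' x"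
proof -
  have Om: "\<Omega> \<in> sets lebesgue" "\<Omega> \<inter> space lebesgue \<in> sets lebesgue" using \<Omega> by auto
  have i: "integrable lebesgue (\<lambda>x. indicator \<Omega> x * \<bar>g x\<bar>)"
    using integrable_abs[OF Lp_integrable[OF \<Omega> g p]] by (simp add: integrable_restrict_space[OF Om(2)])
  then obtain h where h: "h \<in> borel_measurable lborel" "AE x in lborel. indicator \<Omega> x * \<bar>g x\<bar> = h x"
    using completion_ex_borel_measurable_real[OF borel_measurable_integrable[OF i]] by blast
  have AEc: "AE x in lebesgue. indicator \<Omega> x * \<bar>g x\<bar> = \<bar>h x\<bar>"
    using AE_completion[OF h(2)]
  proof eventually_elim
    case (elim x)
    have "0 \<le> indicator \<Omega> x * \<bar>g x\<bar>" by simp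
    then show ?case using elim by simp
  qed
  have "integrable lebesgue (\<lambda>x. \<bar>h x\<bar>)"
    using AEc i h(1) by (subst integrable_cong_AE[where g = "\<lambda>x. indicator \<Omega> x * \<bar>g x\<bar>"])
      (auto intro: measurable_completion borel_measurable_integrable)
  then have hi: "integrable lborel (\<lambda>x. \<bar>h x\<bar>)"
    using h(1) by (subst (asm) integrable_completion) auto
  have "AE x in lebesgue_on \<Omega>. \<bar>g x\<bar> = \<bar>h x\<bar>"
    unfolding AE_restrict_space_iff[OF Om(2)] using AEc by eventually_elim auto
  with hi show ?thesis using that[of "\<lambda>x. \<bar>h x\<bar>"] by auto
qed

section \<open>Weak derivatives on an open set\<close>

lemma integral_lebesgue_on:
  fixes F :: "'a::euclidean_space \<Rightarrow> real"
  assumes "open \<Omega>"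
  shows "(\<integral>x. F x \<partial>lebesgue_on \<Omega>) = (\<integral>x. indicator \<Omega> x * F x \<partial>lebesgue)"
    and "integrable (lebesgue_on \<Omega>) F \<longleftrightarrow> integrable lebesgue (\<lambda>x. indicator \<Omega> x * F x)"
  using assms by (simp_all add: integral_restrict_space integrable_restrict_space)

lemma AE_lebesgue_on_iff:
  assumes "open \<Omega>"
  shows "(AE x in lebesgue_on \<Omega>. P x) \<longleftrightarrow> (AE x in lebesgue. x \<in> \<Omega> \<longrightarrow> P x)"
  using assms by (subst AE_restrict_space_iff) auto

lemma test_function_outside: "\<phi> \<in> test_functions \<Omega> \<Longrightarrow> x \<notin> \<Omega> \<Longrightarrow> \<phi> x = 0"
  using test_function_support by blast

text \<open>
  Extending \<open>u\<close> by zero reduces the claim to functions on the whole space, since the end points of a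
  segment in \<open>\<Omega>\<close> belong to \<open>\<Omega>\<close>.
\<close>

lemma segment_bound_of_weak_derivative:
  fixes u g :: "real^'n::finite \<Rightarrow> real"
  assumes \<Omega>: "open \<Omega>" and t: "t \<ge> 0"
    and u: "integrable (lebesgue_on \<Omega>) u" and g: "integrable lborel g" "\<And>x. 0 \<le> g x"
    and G: "AE x in lebesgue_on \<Omega>. \<bar>G x\<bar> \<le> g x"
    and weak: "\<And>\<phi>. \<phi> \<in> test_functions \<Omega> \<Longrightarrow>
      (\<integral>x. partial j \<phi> x * u x \<partial>lebesgue_on \<Omega>) = - (\<integral>x. \<phi> x * G x \<partial>lebesgue_on \<Omega>)"
  shows "AE x in lebesgue. (\<forall>s\<in>{0..t}. x + s *\<^sub>R axis j 1 \<in> \<Omega>) \<longrightarrow>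
    \<bar>u (x + t *\<^sub>R axis j 1) - u x\<bar> \<le> segment_integral (axis j 1) t g x"
proof -
  have gL: "integrable lebesgue g" using g(1) integrable_completion[of g lborel] by auto
  let ?u = "\<lambda>x. indicator \<Omega> x * u x"
  have Q: "\<bar>\<integral>x. partial j \<phi> x * ?u x \<partial>lebesgue\<bar> \<le> (\<integral>x. \<bar>\<phi> x\<bar> * g x \<partial>lborel)" if \<phi>: "\<phi> \<in> test_functions \<Omega>" for \<phi>
  proof -
    obtain B where B: "\<And>x. \<bar>\<phi> x\<bar> \<le> B" using test_function_bounded[OF \<phi>] by metis
    note sm = test_function_smooth[OF \<phi>]
    have [measurable]: "\<phi> \<in> borel_measurable borel" by (rule smooth_measurable(1)[OF sm])
    have iL: "integrable lebesgue (\<lambda>x. \<bar>\<phi> x\<bar> * g x)"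
      by (rule integrable_bounded_mult[OF gL, where B = B]) (use B smooth_measurable(2)[OF sm] in auto)
    have ind: "(\<lambda>x. indicator \<Omega> x * (\<bar>\<phi> x\<bar> * g x)) = (\<lambda>x. \<bar>\<phi> x\<bar> * g x)"
    proof
      show "indicator \<Omega> x * (\<bar>\<phi> x\<bar> * g x) = \<bar>\<phi> x\<bar> * g x" for x
        by (cases "x \<in> \<Omega>") (auto simp: test_function_outside[OF \<phi>])
    qed
    have "(\<integral>x. partial j \<phi> x * ?u x \<partial>lebesgue) = (\<integral>x. partial j \<phi> x * u x \<partial>lebesgue_on \<Omega>)"
      unfolding integral_lebesgue_on(1)[OF \<Omega>] by (simp add: mult_ac)
    then have "\<bar>\<integral>x. partial j \<phi> x * ?u x \<partial>lebesgue\<bar> = \<bar>\<integral>x. \<phi> x * G x \<partial>lebesgue_on \<Omega>\<bar>"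
      using weak[OF \<phi>] by simp
    also have "\<dots> \<le> (\<integral>x. \<bar>\<phi> x * G x\<bar> \<partial>lebesgue_on \<Omega>)" by (rule integral_abs_bound)
    also have "\<dots> \<le> (\<integral>x. \<bar>\<phi> x\<bar> * g x \<partial>lebesgue_on \<Omega>)"
    proof (rule integral_mono_AE')
      show "integrable (lebesgue_on \<Omega>) (\<lambda>x. \<bar>\<phi> x\<bar> * g x)"
        unfolding integral_lebesgue_on(2)[OF \<Omega>] ind by (rule iL)
      show "AE x in lebesgue_on \<Omega>. \<bar>\<phi> x * G x\<bar> \<le> \<bar>\<phi> x\<bar> * g x"
        using G by eventually_elim (auto simp: abs_mult intro: mult_left_mono)
      show "AE x in lebesgue_on \<Omega>. 0 \<le> \<bar>\<phi> x\<bar> * g x" using g(2) by simp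
    qed
    also have "\<dots> = (\<integral>x. \<bar>\<phi> x\<bar> * g x \<partial>lebesgue)"
      unfolding integral_lebesgue_on(1)[OF \<Omega>] ind ..
    also have "\<dots> = (\<integral>x. \<bar>\<phi> x\<bar> * g x \<partial>lborel)"
      using g(1) by (intro integral_completion) auto
    finally show ?thesis .
  qed
  have "AE x in lebesgue. (\<forall>s\<in>{0..t}. x + s *\<^sub>R axis j 1 \<in> \<Omega>) \<longrightarrow>
    \<bar>?u (x + t *\<^sub>R axis j 1) - ?u x\<bar> \<le> segment_integral (axis j 1) t g x"
    by (rule segment_bound_of_weak_derivative_bound[OF \<Omega> t u[unfolded integral_lebesgue_on(2)[OF \<Omega>]] g(1) Q])
  then show ?thesis
  proof eventually_elim
    case (elim x)
    show ?case
    proof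
      assume seg: "\<forall>s\<in>{0..t}. x + s *\<^sub>R axis j 1 \<in> \<Omega>"
      then have "x \<in> \<Omega>" "x + t *\<^sub>R axis j 1 \<in> \<Omega>" using t by (auto dest: bspec[of _ _ 0] bspec[of _ _ t])
      then show "\<bar>u (x + t *\<^sub>R axis j 1) - u x\<bar> \<le> segment_integral (axis j 1) t g x"
        using elim seg by simp
    qed
  qed
qed

lemma weak_derivative_of_segment_bound:
  fixes u g :: "real^'n::finite \<Rightarrow> real"
  assumes \<Omega>: "open \<Omega>"
    and u: "integrable (lebesgue_on \<Omega>) u" and g: "integrable lborel g" "\<And>x. 0 \<le> g x"
    and Q: "\<And>t. t > 0 \<Longrightarrow> AE x in lebesgue. (\<forall>s\<in>{0..t}. x + s *\<^sub>R axis j 1 \<in> \<Omega>) \<longrightarrow>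
      \<bar>u (x + t *\<^sub>R axis j 1) - u x\<bar> \<le> segment_integral (axis j 1) t g x"
  shows "\<exists>G. integrable (lebesgue_on \<Omega>) G \<and> (AE x in lebesgue_on \<Omega>. \<bar>G x\<bar> \<le> g x) \<and>
    (\<forall>\<phi>\<in>test_functions \<Omega>. (\<integral>x. partial j \<phi> x * u x \<partial>lebesgue_on \<Omega>) = - (\<integral>x. \<phi> x * G x \<partial>lebesgue_on \<Omega>))"
proof -
  let ?u = "\<lambda>x. indicator \<Omega> x * u x"
  have uL: "integrable lebesgue ?u" using u by (simp add: integral_lebesgue_on(2)[OF \<Omega>])
  have Q': "AE x in lebesgue. (\<forall>s\<in>{0..t}. x + s *\<^sub>R axis j 1 \<in> \<Omega>) \<longrightarrow>
      \<bar>?u (x + t *\<^sub>R axis j 1) - ?u x\<bar> \<le> segment_integral (axis j 1) t g x" if t: "t > 0" for t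
    using Q[OF t]
  proof eventually_elim
    case (elim x)
    show ?case
    proof
      assume seg: "\<forall>s\<in>{0..t}. x + s *\<^sub>R axis j 1 \<in> \<Omega>"
      then have "x \<in> \<Omega>" "x + t *\<^sub>R axis j 1 \<in> \<Omega>" using t by (auto dest: bspec[of _ _ 0] bspec[of _ _ t])
      then show "\<bar>?u (x + t *\<^sub>R axis j 1) - ?u x\<bar> \<le> segment_integral (axis j 1) t g x"
        using elim seg by simp
    qed
  qed
  have "\<bar>\<integral>x. partial j \<phi> x * ?u x \<partial>lebesgue\<bar> \<le> (\<integral>x. \<bar>\<phi> x\<bar> * g x \<partial>lborel)" if \<phi>: "\<phi> \<in> test_functions \<Omega>" for \<phi>
    by (rule weak_derivative_bound_of_segment_bound[OF \<Omega> uL g Q' \<phi>])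
  from weak_derivative_of_weak_derivative_bound[OF \<Omega> uL g this]
  obtain G where G: "integrable lebesgue G" "AE x in lebesgue. x \<in> \<Omega> \<longrightarrow> \<bar>G x\<bar> \<le> g x"
    "\<And>\<phi>. \<phi> \<in> test_functions \<Omega> \<Longrightarrow> (\<integral>x. partial j \<phi> x * ?u x \<partial>lebesgue) = - (\<integral>x. \<phi> x * G x \<partial>lebesgue)"
    by blast
  show ?thesis
  proof (intro exI conjI ballI)
    show "integrable (lebesgue_on \<Omega>) G"
      using integrable_mult_indicator[OF _ G(1), of \<Omega>] \<Omega> by (simp add: integral_lebesgue_on(2)[OF \<Omega>])
    show "AE x in lebesgue_on \<Omega>. \<bar>G x\<bar> \<le> g x"
      using G(2) by (simp add: AE_lebesgue_on_iff[OF \<Omega>])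
    fix \<phi> assume \<phi>: "\<phi> \<in> test_functions \<Omega>"
    have "(\<lambda>x. indicator \<Omega> x * (\<phi> x * G x)) = (\<lambda>x. \<phi> x * G x)"
    proof
      show "indicator \<Omega> x * (\<phi> x * G x) = \<phi> x * G x" for x
        by (cases "x \<in> \<Omega>") (auto simp: test_function_outside[OF \<phi>])
    qed
    then show "(\<integral>x. partial j \<phi> x * u x \<partial>lebesgue_on \<Omega>) = - (\<integral>x. \<phi> x * G x \<partial>lebesgue_on \<Omega>)"
      using G(3)[OF \<phi>] unfolding integral_lebesgue_on(1)[OF \<Omega>] by (simp add: mult_ac)
  qed
qed

lemma weakly_zero_imp_AE_zero:
  fixes H :: "real^'n::finite \<Rightarrow> real"
  assumes \<Omega>: "open \<Omega>" and H: "integrable (lebesgue_on \<Omega>) H"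
    and zero: "\<And>\<phi>. \<phi> \<in> test_functions \<Omega> \<Longrightarrow> (\<integral>x. \<phi> x * H x \<partial>lebesgue_on \<Omega>) = 0"
  shows "AE x in lebesgue_on \<Omega>. H x = 0"
proof -
  have main: "AE x in lebesgue. x \<in> \<Omega> \<longrightarrow> 0 \<le> \<sigma> * (indicator \<Omega> x * H x)" for \<sigma>
  proof (rule du_Bois_Reymond_nonneg[OF \<Omega>])
    show "integrable lebesgue (\<lambda>x. \<sigma> * (indicator \<Omega> x * H x))"
      using H by (simp add: integral_lebesgue_on(2)[OF \<Omega>])
    fix \<phi> assume \<phi>: "\<phi> \<in> test_functions \<Omega>"
    have "(\<integral>x. \<phi> x * (\<sigma> * (indicator \<Omega> x * H x)) \<partial>lebesgue) = \<sigma> * (\<integral>x. indicator \<Omega> x * (\<phi> x * H x) \<partial>lebesgue)"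
      by (subst integral_mult_right_zero[symmetric]) (simp add: mult_ac)
    also have "\<dots> = 0" using zero[OF \<phi>] by (simp add: integral_lebesgue_on(1)[OF \<Omega>])
    finally show "0 \<le> (\<integral>x. \<phi> x * (\<sigma> * (indicator \<Omega> x * H x)) \<partial>lebesgue)" by simp
  qed
  show ?thesis
    unfolding AE_lebesgue_on_iff[OF \<Omega>] using main[of 1] main[of "-1"] by eventually_elim auto
qed

lemma test_function_integrable_mult_on:
  assumes "\<phi> \<in> test_functions \<Omega>" "integrable (lebesgue_on \<Omega>) u"
  shows "integrable (lebesgue_on \<Omega>) (\<lambda>x. \<phi> x * u x)"
  using assms test_function_bounded[OF assms(1)] smooth_measurable(3)[OF test_function_smooth[OF assms(1)]]
  by (metis integrable_bounded_mult)

lemma integrable_imp_locally_integrable: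
  assumes "open \<Omega>" "integrable (lebesgue_on \<Omega>) u"
  shows "locally_integrable \<Omega> u"
  unfolding locally_integrable_def
proof (intro allI impI)
  fix K assume K: "compact K \<and> K \<subseteq> \<Omega>"
  then have Ks: "K \<in> sets lebesgue" by (simp add: compact_imp_closed)
  show "integrable (lebesgue_on K) u"
  proof -
    have "integrable lebesgue (\<lambda>x. indicator K x *\<^sub>R (indicator \<Omega> x * u x))"
      using assms(2) by (intro integrable_mult_indicator Ks) (simp add: integral_lebesgue_on(2)[OF assms(1)])
    also have "(\<lambda>x. indicator K x *\<^sub>R (indicator \<Omega> x * u x)) = (\<lambda>x. indicator K x *\<^sub>R u x)"
    proof
      show "indicator K x *\<^sub>R (indicator \<Omega> x * u x) = indicator K x *\<^sub>R u x" for x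
        using K by (cases "x \<in> K") auto
    qed
    finally show ?thesis using Ks by (subst integrable_restrict_space) auto
  qed
qed

section \<open>Isometric embeddings\<close>

lemma separable_top_of_set_iff:
  "separable_space (top_of_set A) \<longleftrightarrow> (\<exists>C. countable C \<and> C \<subseteq> A \<and> A \<subseteq> closure C)"
  for A :: "'a::topological_space set"
  unfolding separable_space_def closure_of_subtopology 
proof -
  have "A \<inter> closure (A \<inter> C) = A \<longleftrightarrow> A \<subseteq> closure C" if C: "C \<subseteq> A" for C
    using C by (simp add: Int_absorb1 inf.absorb_iff1[symmetric])
  then show "(\<exists>C. countable C \<and> C \<subseteq> topspace (top_of_set A) \<and> A \<inter> euclidean closure_of (A \<inter> C) = topspace (top_of_set A)) \<longleftrightarrow>
    (\<exists>C. countable C \<and> C \<subseteq> A \<and> A \<subseteq> closure C)"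
    by (auto simp del: inf.absorb_iff1)
qed

text \<open>
  Up to the embeddings, \<open>a\<close> and \<open>b\<close> induce the same open sets: every \<open>b -` U\<close> with \<open>U\<close> open has the form \<open>a -` W\<close>
  with \<open>W\<close> open, namely a union of balls around points of the image of \<open>a\<close>.
\<close>

lemma isometric_measurable_transfer:
  fixes a :: "'x::metric_space \<Rightarrow> 'v::metric_space" and b :: "'x \<Rightarrow> 'w::metric_space"
  assumes a: "isometric_embedding a" and b: "isometric_embedding b"
    and f: "a \<circ> f \<in> borel_measurable M"
  shows "b \<circ> f \<in> borel_measurable M"
proof (rule borel_measurableI)
  fix U :: "'w set" assume U: "open U"
  define W where "W = (\<Union>x\<in>b -` U. \<Union>r\<in>{r. ball (b x) r \<subseteq> U}. ball (a x) r)"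
  have "a y \<in> W \<longleftrightarrow> b y \<in> U" for y
  proof
    assume "b y \<in> U"
    then obtain r where r: "r > 0" "ball (b y) r \<subseteq> U" using U by (auto simp: open_contains_ball)
    then have "a y \<in> ball (a y) r" "b y \<in> U" by (auto simp: \<open>b y \<in> U\<close>)
    with r show "a y \<in> W" unfolding W_def by blast
  next
    assume "a y \<in> W"
    then obtain x r where "ball (b x) r \<subseteq> U" "a y \<in> ball (a x) r" unfolding W_def by blast
    moreover from this have "b y \<in> ball (b x) r"
      using a b by (simp add: isometric_embedding_def)
    ultimately show "b y \<in> U" by blast
  qed
  then have "(b \<circ> f) -` U \<inter> space M = (a \<circ> f) -` W \<inter> space M" by auto
  also have "\<dots> \<in> sets M" by (rule measurable_sets[OF f]) (auto simp: W_def intro!: borel_open open_UN)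
  finally show "(b \<circ> f) -` U \<inter> space M \<in> sets M" .
qed

lemma isometric_separable_transfer:
  fixes a :: "'x::metric_space \<Rightarrow> 'v::metric_space" and b :: "'x \<Rightarrow> 'w::metric_space"
  assumes a: "isometric_embedding a" and b: "isometric_embedding b"
    and sep: "separable_space (top_of_set (a ` A))"
  shows "separable_space (top_of_set (b ` A))"
proof -
  obtain C where C: "countable C" "C \<subseteq> a ` A" "a ` A \<subseteq> closure C"
    using sep by (auto simp: separable_top_of_set_iff)
  obtain E where E: "countable E" "E \<subseteq> A" "C = a ` E"
    using countable_subset_image[of C a A] C(1,2) by auto
  have "b y \<in> closure (b ` E)" if y: "y \<in> A" for y
    unfolding closure_approachable
  proof (intro allI impI)
    fix e :: real assume "e > 0"
    then obtain z where "z \<in> E" "dist (a z) (a y) < e"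
      using C(3) y unfolding E(3) by (auto simp: closure_approachable subset_iff)
    then show "\<exists>w\<in>b ` E. dist w (b y) < e"
      using a b by (auto simp: isometric_embedding_def)
  qed
  then show ?thesis
    unfolding separable_top_of_set_iff using E(1,2) by (intro exI[of _ "b ` E"]) auto
qed

text \<open>
  The norms of \<open>a y\<close> and \<open>b y\<close> both differ from the distance of \<open>y\<close> to a fixed base point, here
  \<open>undefined\<close>, by at most a constant, and constants are \<open>p\<close>-integrable on the bounded set \<open>\<Omega>\<close>.
\<close>

lemma isometric_Lp_vec_transfer:
  fixes a :: "'x::metric_space \<Rightarrow> 'v::banach" and b :: "'x \<Rightarrow> 'w::banach" and \<Omega> :: "(real^'n::finite) set"
  assumes \<Omega>: "open \<Omega>" "bounded \<Omega>" and p: "1 \<le> p"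
    and a: "isometric_embedding a" and b: "isometric_embedding b"
    and f: "a \<circ> f \<in> Lp_vec p \<Omega>"
  shows "b \<circ> f \<in> Lp_vec p \<Omega>"
proof -
  have m: "b \<circ> f \<in> borel_measurable (lebesgue_on \<Omega>)"
    using f by (intro isometric_measurable_transfer[OF a b]) (auto simp: Lp_vec_def)
  have "essentially_separably_valued \<Omega> (b \<circ> f)"
  proof -
    obtain N where N: "N \<in> null_sets lebesgue" "N \<subseteq> \<Omega>" "separable_space (top_of_set ((a \<circ> f) ` (\<Omega> - N)))"
      using f unfolding Lp_vec_def essentially_separably_valued_def by blast
    have "separable_space (top_of_set (b ` f ` (\<Omega> - N)))"
      using N(3) by (intro isometric_separable_transfer[OF a b]) (simp add: image_comp)
    then show ?thesis
      unfolding essentially_separably_valued_def using N(1,2) by (auto simp: image_comp)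
  qed
  moreover have "(\<lambda>x. norm ((b \<circ> f) x)) \<in> Lp p \<Omega>"
  proof (rule Lp_mono)
    let ?c = "norm (a undefined) + norm (b undefined)"
    show "(\<lambda>x. norm ((a \<circ> f) x) + ?c) \<in> Lp p \<Omega>"
      using f p by (intro Lp_add Lp_const \<Omega>) (auto simp: Lp_vec_def)
    show "(\<lambda>x. norm ((b \<circ> f) x)) \<in> borel_measurable (lebesgue_on \<Omega>)"
      by (rule measurable_compose[OF m]) (intro borel_measurable_continuous_onI continuous_intros)
    have "norm (b y) \<le> norm (a y) + ?c" for y
    proof -
      have "norm (b y) \<le> norm (b undefined) + dist (b y) (b undefined)"
        by (metis dist_norm norm_triangle_sub)
      also have "dist (b y) (b undefined) = dist (a y) (a undefined)"
        using a b by (simp add: isometric_embedding_def)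
      also have "\<dots> \<le> norm (a y) + norm (a undefined)"
        by (simp add: dist_norm norm_triangle_ineq4)
      finally show ?thesis by simp
    qed
    then show "AE x in lebesgue_on \<Omega>. \<bar>norm ((b \<circ> f) x)\<bar> \<le> \<bar>norm ((a \<circ> f) x) + ?c\<bar>"
      by (intro AE_I2) (auto intro: order_trans[OF _ abs_ge_self])
  qed (use p in auto)
  ultimately show ?thesis using m by (simp add: Lp_vec_def)
qed

section \<open>Norming functionals\<close>

text \<open>
  Sublinear functionals below the norm. For \<open>c > 0\<close> the inequality \<open>q (c *\<^sub>R x) \<le> c * q x\<close> is enough:
  applied to \<open>1 / c\<close> it gives the opposite one.
\<close>

definition sublinear :: "('v::real_normed_vector \<Rightarrow> real) \<Rightarrow> bool" where
  "sublinear q \<longleftrightarrow> (\<forall>x y. q (x + y) \<le> q x + q y) \<and> (\<forall>c>0. \<forall>x. q (c *\<^sub>R x) \<le> c * q x) \<and> (\<forall>x. q x \<le> norm x)"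

lemma sublinear_zero:
  assumes "sublinear q" shows "q 0 = 0"
proof -
  have "q (0 + 0) \<le> q 0 + q 0" "q 0 \<le> norm (0::'a)" using assms unfolding sublinear_def by blast+
  then show ?thesis by simp
qed

lemma sublinear_scale:
  assumes q: "sublinear q" and "c \<ge> 0"
  shows "q (c *\<^sub>R x) = c * q x"
proof (cases "c = 0")
  case True
  then show ?thesis by (simp add: sublinear_zero[OF q])
next
  case False
  then have c: "c > 0" using assms by simp
  have "q ((1/c) *\<^sub>R (c *\<^sub>R x)) \<le> (1/c) * q (c *\<^sub>R x)"
    using q c unfolding sublinear_def by (meson zero_less_divide_1_iff)
  then have "c * q x \<le> q (c *\<^sub>R x)" using c by (simp add: field_simps)
  moreover have "q (c *\<^sub>R x) \<le> c * q x" using q c unfolding sublinear_def by blast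
  ultimately show ?thesis by simp
qed

lemma sublinear_lower: "sublinear q \<Longrightarrow> - q (- x) \<le> q x"
proof -
  assume q: "sublinear q"
  have "q (x + - x) \<le> q x + q (- x)" using q unfolding sublinear_def by blast
  then show ?thesis using sublinear_zero[OF q] by simp
qed

lemma sublinear_norm: "sublinear (norm :: 'v::real_normed_vector \<Rightarrow> real)"
  by (auto simp: sublinear_def norm_triangle_ineq)

text \<open>
  The functional \<open>r x = inf {q (x + t *\<^sub>R a) - t * q a | t \<ge> 0}\<close> lies below \<open>q\<close>, and \<open>t = 1\<close> gives the
  bound at \<open>- a\<close>. A minimal \<open>q\<close> therefore satisfies \<open>q (- a) \<le> - q a\<close> for all \<open>a\<close>, that is, it is odd and
  hence linear.
\<close>

lemma sublinear_tilt:
  assumes q: "sublinear q"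
  obtains r where "sublinear r" "\<And>x. r x \<le> q x" "r (- a) \<le> - q a"
proof -
  have add: "q (x + y) \<le> q x + q y" for x y using q unfolding sublinear_def by blast
  define F where "F x t = q (x + t *\<^sub>R a) - t * q a" for x t
  define r where "r x = (INF t\<in>{0..}. F x t)" for x
  have low: "- q (- x) \<le> F x t" if "t \<ge> 0" for x t
    using add[of "x + t *\<^sub>R a" "- x"] sublinear_scale[OF q that, of a] by (simp add: F_def)
  have bdd: "bdd_below (F x ` {0..})" for x
    using low[where x=x] by (intro bdd_belowI[of _ "- q (- x)"]) auto
  have le: "r x \<le> F x t" if "t \<ge> 0" for x t
    unfolding r_def using that bdd by (intro cINF_lower) auto
  have ge: "c \<le> r x" if "\<And>t. t \<ge> 0 \<Longrightarrow> c \<le> F x t" for c x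
    unfolding r_def using that by (intro cINF_greatest) auto
  have r_q: "r x \<le> q x" for x using le[of 0 x] by (simp add: F_def)
  show ?thesis
  proof (rule that[of r])
    show "r x \<le> q x" for x by (rule r_q)
    show "r (- a) \<le> - q a" using le[of 1 "- a"] sublinear_zero[OF q] by (simp add: F_def)
    show "sublinear r"
      unfolding sublinear_def
    proof (intro conjI allI impI)
      fix x y
      have "r (x + y) - F y t \<le> F x s" if "s \<ge> 0" "t \<ge> 0" for s t
      proof -
        have "r (x + y) \<le> F (x + y) (s + t)" using that by (intro le) simp
        also have "\<dots> \<le> F x s + F y t"
          using add[of "x + s *\<^sub>R a" "y + t *\<^sub>R a"] by (simp add: F_def algebra_simps)
        finally show ?thesis by simp
      qed
      then have "r (x + y) - F y t \<le> r x" if "t \<ge> 0" for t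
        using that by (intro ge)
      then have "r (x + y) - r x \<le> F y t" if "t \<ge> 0" for t
        using that by (simp add: algebra_simps)
      then have "r (x + y) - r x \<le> r y" by (rule ge)
      then show "r (x + y) \<le> r x + r y" by simp
    next
      fix c :: real and x assume c: "c > 0"
      have "r (c *\<^sub>R x) / c \<le> F x t" if "t \<ge> 0" for t
      proof -
        have "r (c *\<^sub>R x) \<le> F (c *\<^sub>R x) (c * t)" using that c by (intro le) simp
        also have "\<dots> = c * F x t"
          using sublinear_scale[OF q, of c "x + t *\<^sub>R a"] c by (simp add: F_def algebra_simps)
        finally show ?thesis using c by (simp add: field_simps)
      qed
      then have "r (c *\<^sub>R x) / c \<le> r x" by (rule ge)
      then show "r (c *\<^sub>R x) \<le> c * r x" using c by (simp add: field_simps)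
    next
      fix x show "r x \<le> norm x" using r_q[of x] q unfolding sublinear_def by (meson order_trans)
    qed
  qed
qed

text \<open>
  Zorn's lemma: the pointwise infimum of a chain is finite, because every member is bounded below by
  minus the norm, and it is sublinear, because of two members of a chain one lies below the other.
\<close>

lemma minimal_sublinear:
  assumes p: "sublinear p"
  obtains q where "sublinear q" "\<And>x. q x \<le> p x"
    "\<And>r. sublinear r \<Longrightarrow> (\<And>x. r x \<le> q x) \<Longrightarrow> r = q"
proof -
  define A where "A = {q. sublinear q \<and> q \<le> p}"
  \<comment> \<open>The order is reversed, so that maximal elements are minimal functionals.\<close>
  define P :: "('a \<Rightarrow> real) \<Rightarrow> ('a \<Rightarrow> real) \<Rightarrow> bool" where "P q r \<longleftrightarrow> r \<le> q" for q r
  have po: "partial_order_on A (relation_of P A)"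
    by (rule partial_order_on_relation_ofI) (auto simp: P_def)
  have "\<exists>m\<in>A. \<forall>a\<in>A. P m a \<longrightarrow> a = m"
  proof (rule predicate_Zorn[OF po])
    fix C assume C: "C \<in> Chains (relation_of P A)"
    show "\<exists>u\<in>A. \<forall>a\<in>C. P a u"
    proof (cases "C = {}")
      case True
      then show ?thesis using p by (auto simp: A_def)
    next
      case False
      have sub: "sublinear q" "q \<le> p" if "q \<in> C" for q
        using C that by (auto simp: Chains_def relation_of_def A_def)
      have tot: "q \<le> r \<or> r \<le> q" if "q \<in> C" "r \<in> C" for q r
        using C that by (auto simp: Chains_def relation_of_def P_def)
      define u where "u x = (INF q\<in>C. q x)" for x
      have bdd: "bdd_below ((\<lambda>q. q x) ` C)" for x
      proof (rule bdd_belowI)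
        fix y assume "y \<in> (\<lambda>q. q x) ` C"
        then obtain q where q: "q \<in> C" "y = q x" by blast
        have "q (- x) \<le> norm (- x)" using sub(1)[OF q(1)] unfolding sublinear_def by blast
        then show "- norm x \<le> y" using sublinear_lower[OF sub(1)[OF q(1)], of x] q(2) by simp
      qed
      have le: "u x \<le> q x" if "q \<in> C" for q x
        unfolding u_def using that bdd by (intro cINF_lower) auto
      have ge: "c \<le> u x" if "\<And>q. q \<in> C \<Longrightarrow> c \<le> q x" for c x
        unfolding u_def using that False by (intro cINF_greatest) auto
      have "sublinear u"
        unfolding sublinear_def
      proof (intro conjI allI impI)
        fix x y
        have "u (x + y) - r y \<le> q x" if qr: "q \<in> C" "r \<in> C" for q r
        proof -
          obtain s where s: "s \<in> C" "s \<le> q" "s \<le> r" using tot[OF qr] qr by blast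
          have "u (x + y) \<le> s (x + y)" by (rule le[OF s(1)])
          also have "\<dots> \<le> s x + s y" using sub(1)[OF s(1)] unfolding sublinear_def by blast
          also have "\<dots> \<le> q x + r y" using s(2,3) by (intro add_mono) (auto simp: le_fun_def)
          finally show ?thesis by simp
        qed
        then have "u (x + y) - r y \<le> u x" if "r \<in> C" for r
          using that by (intro ge)
        then have "u (x + y) - u x \<le> r y" if "r \<in> C" for r
          using that by (simp add: algebra_simps)
        then have "u (x + y) - u x \<le> u y" by (rule ge)
        then show "u (x + y) \<le> u x + u y" by simp
      next
        fix c :: real and x assume c: "c > 0"
        have "u (c *\<^sub>R x) / c \<le> q x" if "q \<in> C" for q
          using le[OF that, of "c *\<^sub>R x"] sublinear_scale[OF sub(1)[OF that], of c x] c
          by (simp add: field_simps)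
        then have "u (c *\<^sub>R x) / c \<le> u x" by (rule ge)
        then show "u (c *\<^sub>R x) \<le> c * u x" using c by (simp add: field_simps)
      next
        fix x
        obtain q where q: "q \<in> C" using False by blast
        have "q x \<le> norm x" using sub(1)[OF q] unfolding sublinear_def by blast
        then show "u x \<le> norm x" using le[OF q, of x] by simp
      qed
      moreover have "u \<le> p"
        using le sub(2) False unfolding le_fun_def by (meson all_not_in_conv order_trans)
      moreover have "u \<le> q" if "q \<in> C" for q using le[OF that] by (simp add: le_fun_def)
      ultimately show ?thesis by (auto simp: A_def P_def)
    qed
  qed
  then obtain q where q: "q \<in> A" "\<And>r. r \<in> A \<Longrightarrow> r \<le> q \<Longrightarrow> r = q"
    by (auto simp: P_def)
  show ?thesis
  proof (rule that[of q])
    show "sublinear q" "\<And>x. q x \<le> p x" using q(1) by (auto simp: A_def le_fun_def)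
    show "r = q" if "sublinear r" "\<And>x. r x \<le> q x" for r
    proof (rule q(2))
      show le: "r \<le> q" using that(2) by (simp add: le_fun_def)
      show "r \<in> A" using le q(1) that(1) by (auto simp: A_def)
    qed
  qed
qed

text \<open>
  Tilting the norm at \<open>a\<close> gives a sublinear functional with value at most \<open>- norm a\<close> at \<open>- a\<close>. A minimal
  functional below it is linear, hence takes a value of at least \<open>norm a\<close> at \<open>a\<close>.
\<close>

lemma norming_functional:
  fixes a :: "'v::real_normed_vector"
  obtains f :: "'v \<Rightarrow>\<^sub>L real" where "norm f \<le> 1" "blinfun_apply f a = norm a"
proof -
  obtain p :: "'v \<Rightarrow> real" where p: "sublinear p" "p (- a) \<le> - norm a"
    using sublinear_tilt[OF sublinear_norm] by metis
  obtain q where q: "sublinear q" "\<And>x. q x \<le> p x"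
    "\<And>r. sublinear r \<Longrightarrow> (\<And>x. r x \<le> q x) \<Longrightarrow> r = q"
    using minimal_sublinear[OF p(1)] by blast
  have odd: "q (- x) = - q x" for x
  proof -
    obtain r where r: "sublinear r" "\<And>y. r y \<le> q y" "r (- x) \<le> - q x"
      using sublinear_tilt[OF q(1), of x] by metis
    have "q (- x) \<le> - q x" using q(3)[OF r(1,2)] r(3) by simp
    then show ?thesis using sublinear_lower[OF q(1), of x] by simp
  qed
  have add_le: "q (x + y) \<le> q x + q y" for x y using q(1) unfolding sublinear_def by blast
  have nle: "q x \<le> norm x" for x using q(1) unfolding sublinear_def by blast
  have add: "q (x + y) = q x + q y" for x y
    using add_le[of x y] add_le[of "- x" "- y"] odd[of "x + y"] by (simp add: odd)
  have scale: "q (c *\<^sub>R x) = c * q x" for c x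
  proof (cases "c \<ge> 0")
    case True
    then show ?thesis by (rule sublinear_scale[OF q(1)])
  next
    case False
    then have "q ((- c) *\<^sub>R x) = (- c) * q x" by (intro sublinear_scale[OF q(1)]) simp
    then show ?thesis using odd[of "c *\<^sub>R x"] by simp
  qed
  have abs_le: "\<bar>q x\<bar> \<le> norm x" for x
    using nle[of x] nle[of "- x"] odd[of x] by simp
  have bl: "bounded_linear q"
    by (rule bounded_linear_intro[where K = 1]) (auto simp: add scale abs_le)
  show ?thesis
  proof (rule that[of "Blinfun q"])
    show "norm (Blinfun q) \<le> 1"
      by (rule norm_blinfun_bound) (use abs_le bl in \<open>auto simp: bounded_linear_Blinfun_apply mult.commute\<close>)
    have "q a \<ge> norm a" using odd[of a] q(2)[of "- a"] p(2) by simp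
    then show "blinfun_apply (Blinfun q) a = norm a"
      using nle[of a] bl by (simp add: bounded_linear_Blinfun_apply)
  qed
qed

section \<open>Functions with values in the dual of a separable space\<close>

lemma norm_blinfun_le_dense:
  fixes F :: "'y::real_normed_vector \<Rightarrow>\<^sub>L real"
  assumes dense: "closure S = UNIV" and c: "0 \<le> c" and le: "\<And>v. v \<in> S \<Longrightarrow> \<bar>F v\<bar> \<le> norm v * c"
  shows "norm F \<le> c"
proof (rule norm_blinfun_bound[OF c])
  fix v
  have "closed {v. \<bar>F v\<bar> \<le> norm v * c}"
    by (intro closed_Collect_le continuous_intros)
  then have "closure S \<subseteq> {v. \<bar>F v\<bar> \<le> norm v * c}"
    using le by (intro closure_minimal) auto
  then have "v \<in> {v. \<bar>F v\<bar> \<le> norm v * c}" using dense by blast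
  then show "norm (F v) \<le> c * norm v" by (simp add: mult.commute)
qed

lemma blinfun_eq_dense:
  fixes F G :: "'y::real_normed_vector \<Rightarrow>\<^sub>L real"
  assumes "closure S = UNIV" "\<And>v. v \<in> S \<Longrightarrow> F v = G v"
  shows "F = G"
proof -
  have "norm (F - G) \<le> 0"
    by (rule norm_blinfun_le_dense[OF assms(1)]) (simp_all add: blinfun.diff_left assms(2))
  then show ?thesis by simp
qed

text \<open>
  On \<open>S\<close> the functional is Lipschitz, so it extends by limits of sequences in \<open>S\<close>. Approximating a real
  scalar by rationals and a vector by elements of \<open>S\<close> at the same time gives real homogeneity.
\<close>

lemma rational_subspace_functional_extension:
  fixes S :: "'y::real_normed_vector set" and L :: "'y \<Rightarrow> real"
  assumes dense: "closure S = UNIV"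
    and S_add: "\<And>u v. u \<in> S \<Longrightarrow> v \<in> S \<Longrightarrow> u + v \<in> S"
    and S_scale: "\<And>q v. q \<in> \<rat> \<Longrightarrow> v \<in> S \<Longrightarrow> q *\<^sub>R v \<in> S"
    and L_add: "\<And>u v. u \<in> S \<Longrightarrow> v \<in> S \<Longrightarrow> L (u + v) = L u + L v"
    and L_scale: "\<And>q v. q \<in> \<rat> \<Longrightarrow> v \<in> S \<Longrightarrow> L (q *\<^sub>R v) = q * L v"
    and bound: "\<And>v. v \<in> S \<Longrightarrow> \<bar>L v\<bar> \<le> norm v * C" and C: "0 \<le> C"
  shows "\<exists>F :: 'y \<Rightarrow>\<^sub>L real. norm F \<le> C \<and> (\<forall>v\<in>S. blinfun_apply F v = L v)"
proof -
  have lip: "\<bar>L u - L v\<bar> \<le> C * norm (u - v)" if uv: "u \<in> S" "v \<in> S" for u v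
  proof -
    have m: "(-1) *\<^sub>R v \<in> S" by (intro S_scale uv) simp
    have "L (u + (-1) *\<^sub>R v) = L u + (-1) * L v"
      using L_add[OF uv(1) m] L_scale[OF _ uv(2), of "-1"] by simp
    then have "L u - L v = L (u - v)" by simp
    moreover have "u - v \<in> S" using S_add[OF uv(1) m] by simp
    ultimately show ?thesis using bound[of "u - v"] by (simp add: mult.commute)
  qed
  have "\<exists>s. (\<forall>n::nat. s n \<in> S) \<and> s \<longlonglongrightarrow> v" for v
    using dense closure_sequential[of v S] by auto
  then obtain \<sigma> where \<sigma>: "\<And>v n. \<sigma> v n \<in> S" "\<And>v. \<sigma> v \<longlonglongrightarrow> v" by metis
  define F where "F v = lim (\<lambda>n. L (\<sigma> v n))" for v
  have "C-lipschitz_on S L"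
    by (rule lipschitz_onI) (use lip C in \<open>auto simp: dist_norm\<close>)
  then have uc: "uniformly_continuous_on S L" by (rule lipschitz_on_uniformly_continuous)
  have F\<sigma>: "(\<lambda>n. L (\<sigma> v n)) \<longlonglongrightarrow> F v" for v
  proof -
    have "Cauchy (\<lambda>n. L (\<sigma> v n))"
      by (rule uniformly_continuous_on_Cauchy[OF uc]) (auto intro: \<sigma> LIMSEQ_imp_Cauchy)
    then show ?thesis unfolding F_def by (simp add: Cauchy_convergent convergent_LIMSEQ_iff[symmetric])
  qed
  have key: "(\<lambda>n. L (s n)) \<longlonglongrightarrow> F v" if s: "\<And>n. s n \<in> S" "s \<longlonglongrightarrow> v" for s v
  proof -
    have "(\<lambda>n. L (s n) - L (\<sigma> v n)) \<longlonglongrightarrow> 0"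
    proof (rule Lim_null_comparison)
      show "\<forall>\<^sub>F n in sequentially. norm (L (s n) - L (\<sigma> v n)) \<le> C * norm (s n - \<sigma> v n)"
        using lip[OF s(1) \<sigma>(1)] by simp
      have "(\<lambda>n. C * norm (s n - \<sigma> v n)) \<longlonglongrightarrow> C * norm (v - v)"
        by (intro tendsto_intros s \<sigma>)
      then show "(\<lambda>n. C * norm (s n - \<sigma> v n)) \<longlonglongrightarrow> 0" by simp
    qed
    from tendsto_add[OF this F\<sigma>[of v]] show ?thesis by simp
  qed
  have FS: "F v = L v" if "v \<in> S" for v
    using key[of "\<lambda>n. v" v] that by (simp add: LIMSEQ_const_iff)
  have F_add: "F (u + v) = F u + F v" for u v
  proof (rule LIMSEQ_unique)
    show "(\<lambda>n. L (\<sigma> u n + \<sigma> v n)) \<longlonglongrightarrow> F (u + v)"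
      by (intro key S_add tendsto_intros \<sigma>)
    show "(\<lambda>n. L (\<sigma> u n + \<sigma> v n)) \<longlonglongrightarrow> F u + F v"
      using tendsto_add[OF F\<sigma> F\<sigma>] by (simp add: L_add \<sigma>)
  qed
  have F_scale: "F (c *\<^sub>R v) = c * F v" for c v
  proof -
    have "\<exists>q\<in>\<rat>. \<bar>q - c\<bar> < 1 / Suc n" for n
      using rational_approximation[of "1 / Suc n" c] by (metis divide_pos_pos of_nat_0_less_iff zero_less_Suc zero_less_one)
    then obtain q where q: "\<And>n. q n \<in> \<rat>" "\<And>n. \<bar>q n - c\<bar> < 1 / Suc n" by metis
    have qc: "q \<longlonglongrightarrow> c"
    proof (rule LIM_zero_cancel, rule Lim_null_comparison)
      show "\<forall>\<^sub>F n in sequentially. norm (q n - c) \<le> 1 / Suc n" using less_imp_le[OF q(2)] by (intro always_eventually) simp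
      show "(\<lambda>n. 1 / real (Suc n)) \<longlonglongrightarrow> 0" by (rule lim_const_over_n[THEN LIMSEQ_Suc])
    qed
    show ?thesis
    proof (rule LIMSEQ_unique)
      show "(\<lambda>n. L (q n *\<^sub>R \<sigma> v n)) \<longlonglongrightarrow> F (c *\<^sub>R v)"
        by (intro key S_scale tendsto_intros \<sigma> q qc)
      show "(\<lambda>n. L (q n *\<^sub>R \<sigma> v n)) \<longlonglongrightarrow> c * F v"
        using tendsto_mult[OF qc F\<sigma>] by (simp add: L_scale \<sigma> q)
    qed
  qed
  have F_bound: "\<bar>F v\<bar> \<le> norm v * C" for v
  proof (rule LIMSEQ_le)
    show "(\<lambda>n. \<bar>L (\<sigma> v n)\<bar>) \<longlonglongrightarrow> \<bar>F v\<bar>" by (intro tendsto_intros F\<sigma>)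
    show "(\<lambda>n. norm (\<sigma> v n) * C) \<longlonglongrightarrow> norm v * C" by (intro tendsto_intros \<sigma>)
  qed (use bound \<sigma> in auto)
  have bl: "bounded_linear F"
    by (rule bounded_linear_intro[where K = C]) (auto simp: F_add F_scale F_bound)
  show ?thesis
  proof (intro exI conjI ballI)
    show "norm (Blinfun F) \<le> C"
      by (rule norm_blinfun_bound[OF C]) (use F_bound in \<open>simp add: bounded_linear_Blinfun_apply[OF bl] mult.commute\<close>)
    show "blinfun_apply (Blinfun F) v = L v" if "v \<in> S" for v
      using FS[OF that] by (simp add: bounded_linear_Blinfun_apply[OF bl])
  qed
qed

text \<open>
  The rational linear combinations of a countable dense set, encoded as lists of pairs of a coefficient
  and a vector.
\<close>

lemma countable_dense_rational_subspace:
  assumes "separable_space (euclidean :: 'y::real_normed_vector topology)"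
  shows "\<exists>S :: 'y set. countable S \<and> closure S = UNIV \<and> (\<forall>u\<in>S. \<forall>v\<in>S. u + v \<in> S) \<and> (\<forall>q\<in>\<rat>. \<forall>v\<in>S. q *\<^sub>R v \<in> S)"
proof -
  obtain C :: "'y set" where C: "countable C" "closure C = UNIV"
    using assms by (auto simp: separable_space_def)
  define comb where "comb xs = sum_list (map (\<lambda>(q, d). q *\<^sub>R d) xs)" for xs :: "(real \<times> 'y) list"
  define S where "S = comb ` lists (\<rat> \<times> C)"
  have "countable S" unfolding S_def by (intro countable_image countable_lists countable_SIGMA countable_rat C)
  moreover have "closure S = UNIV"
  proof -
    have "C \<subseteq> S"
    proof
      fix d assume "d \<in> C"
      then have "[(1, d)] \<in> lists (\<rat> \<times> C)" by simp
      moreover have "d = comb [(1, d)]" by (simp add: comb_def)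
      ultimately show "d \<in> S" unfolding S_def by blast
    qed
    then show ?thesis using C(2) closure_mono by blast
  qed
  moreover have "u + v \<in> S" if "u \<in> S" "v \<in> S" for u v
  proof -
    obtain xs ys where "xs \<in> lists (\<rat> \<times> C)" "ys \<in> lists (\<rat> \<times> C)" "u = comb xs" "v = comb ys"
      using \<open>u \<in> S\<close> \<open>v \<in> S\<close> unfolding S_def by blast
    then show ?thesis unfolding S_def by (intro image_eqI[of _ _ "xs @ ys"]) (auto simp: comb_def)
  qed
  moreover have "q *\<^sub>R v \<in> S" if "q \<in> \<rat>" "v \<in> S" for q v
  proof -
    obtain xs where xs: "xs \<in> lists (\<rat> \<times> C)" "v = comb xs"
      using \<open>v \<in> S\<close> unfolding S_def by blast
    have "q *\<^sub>R comb ys = comb (map (\<lambda>(r, d). (q * r, d)) ys)" for ys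
      by (induction ys) (auto simp: comb_def scaleR_add_right)
    moreover have "map (\<lambda>(r, d). (q * r, d)) xs \<in> lists (\<rat> \<times> C)"
      using xs(1) \<open>q \<in> \<rat>\<close> by (auto simp: lists_eq_set)
    ultimately show ?thesis unfolding S_def xs(2) by blast
  qed
  ultimately show ?thesis by blast
qed

text \<open>
  The condition \<open>norm (F x) \<le> a\<close> is a countable intersection of conditions on evaluations at \<open>S\<close>.
\<close>

lemma weak_star_measurable_norm:
  fixes F :: "real^'n::finite \<Rightarrow> ('y::banach \<Rightarrow>\<^sub>L real)" and S :: "'y set"
  assumes S: "countable S" "closure S = UNIV" and F: "weak_star_measurable \<Omega> F"
  shows "(\<lambda>x. norm (F x)) \<in> borel_measurable (lebesgue_on \<Omega>)"
proof (rule borel_measurable_iff_le[THEN iffD2], intro allI)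
  fix a :: real
  let ?M = "lebesgue_on \<Omega>"
  have Sne: "S \<noteq> {}" using S(2) by auto
  show "{x \<in> space ?M. norm (F x) \<le> a} \<in> sets ?M"
  proof (cases "a \<ge> 0")
    case False
    then have "{x \<in> space ?M. norm (F x) \<le> a} = {}" using norm_ge_zero order_trans by blast
    then show ?thesis by (metis sets.empty_sets)
  next
    case True
    have iff: "norm (F x) \<le> a \<longleftrightarrow> (\<forall>v\<in>S. \<bar>F x v\<bar> \<le> norm v * a)" for x
    proof
      assume "norm (F x) \<le> a"
      then show "\<forall>v\<in>S. \<bar>F x v\<bar> \<le> norm v * a"
        using norm_blinfun[of "F x"] by (metis mult.commute mult_right_mono norm_ge_zero order_trans real_norm_def)
    qed (use norm_blinfun_le_dense[OF S(2) True] in blast)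
    have "{x \<in> space ?M. norm (F x) \<le> a} = (\<Inter>v\<in>S. {x \<in> space ?M. \<bar>F x v\<bar> \<le> norm v * a})"
      using Sne by (auto simp: iff)
    also have "\<dots> \<in> sets ?M"
    proof (rule sets.countable_INT'[OF S(1) Sne])
      have "{x \<in> space ?M. \<bar>F x v\<bar> \<le> norm v * a} \<in> sets ?M" for v
      proof -
        have [measurable]: "(\<lambda>x. F x v) \<in> borel_measurable ?M" using F by (simp add: weak_star_measurable_def)
        show ?thesis by measurable
      qed
      then show "(\<lambda>v. {x \<in> space ?M. \<bar>F x v\<bar> \<le> norm v * a}) ` S \<subseteq> sets ?M" by blast
    qed
    finally show ?thesis .
  qed
qed

lemma has_gelfand_integral_exists:
  fixes h :: "real^'n::finite \<Rightarrow> ('y::banach \<Rightarrow>\<^sub>L real)"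
  assumes h: "weak_star_measurable \<Omega> h" and b: "integrable (lebesgue_on \<Omega>) b"
    and le: "AE x in lebesgue_on \<Omega>. norm (h x) \<le> b x"
  shows "\<exists>T. has_gelfand_integral h T \<Omega>"
proof -
  let ?M = "lebesgue_on \<Omega>"
  define T where "T v = (\<integral>x. h x v \<partial>?M)" for v
  have le': "AE x in ?M. norm (h x v) \<le> b x * norm v" for v
    using le
  proof eventually_elim
    case (elim x)
    then show ?case using norm_blinfun[of "h x" v] by (meson mult_right_mono norm_ge_zero order_trans)
  qed
  have bv: "integrable ?M (\<lambda>x. b x * norm v)" for v using b by simp
  have int: "integrable ?M (\<lambda>x. h x v)" for v
  proof (rule Bochner_Integration.integrable_bound[OF bv])
    show "(\<lambda>x. h x v) \<in> borel_measurable ?M" using h by (simp add: weak_star_measurable_def)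
    show "AE x in ?M. norm (h x v) \<le> norm (b x * norm v)"
      using le'[of v] by eventually_elim simp
  qed
  have "bounded_linear T"
  proof (rule bounded_linear_intro)
    show "T (u + v) = T u + T v" for u v unfolding T_def by (simp add: blinfun.add_right int)
    show "T (c *\<^sub>R v) = c *\<^sub>R T v" for c v unfolding T_def by (simp add: blinfun.scaleR_right)
    show "norm (T v) \<le> norm v * (\<integral>x. b x \<partial>?M)" for v
    proof -
      have "norm (T v) \<le> (\<integral>x. norm (h x v) \<partial>?M)" unfolding T_def by (rule integral_norm_bound)
      also have "\<dots> \<le> (\<integral>x. b x * norm v \<partial>?M)"
        by (rule integral_mono_AE[OF integrable_norm[OF int] bv le'])
      finally show ?thesis by (simp add: mult.commute)
    qed
  qed
  then have "has_gelfand_integral h (Blinfun T) \<Omega>"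
    unfolding has_gelfand_integral_def using h int by (simp add: bounded_linear_Blinfun_apply T_def)
  then show ?thesis by blast
qed

text \<open>
  Countably many almost-everywhere statements hold simultaneously off a null set, where \<open>v \<mapsto> G v x\<close> is
  rationally linear and bounded on \<open>S\<close> and so extends to a functional. The values on the null set and
  outside \<open>\<Omega>\<close> are set to zero. Evaluations at general vectors are measurable as pointwise limits of
  evaluations at elements of \<open>S\<close>.
\<close>

lemma weak_star_function_from_dense_subspace:
  fixes G :: "'y::banach \<Rightarrow> real^'n::finite \<Rightarrow> real" and S :: "'y set"
  assumes S: "countable S" "closure S = UNIV" "\<And>u v. u \<in> S \<Longrightarrow> v \<in> S \<Longrightarrow> u + v \<in> S"
      "\<And>q v. q \<in> \<rat> \<Longrightarrow> v \<in> S \<Longrightarrow> q *\<^sub>R v \<in> S"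
    and meas: "\<And>v. v \<in> S \<Longrightarrow> G v \<in> borel_measurable (lebesgue_on \<Omega>)"
    and add: "\<And>u v. u \<in> S \<Longrightarrow> v \<in> S \<Longrightarrow> AE x in lebesgue_on \<Omega>. G (u + v) x = G u x + G v x"
    and scale: "\<And>q v. q \<in> \<rat> \<Longrightarrow> v \<in> S \<Longrightarrow> AE x in lebesgue_on \<Omega>. G (q *\<^sub>R v) x = q * G v x"
    and bound: "\<And>v. v \<in> S \<Longrightarrow> AE x in lebesgue_on \<Omega>. \<bar>G v x\<bar> \<le> norm v * g x"
    and g: "\<And>x. 0 \<le> g x"
  shows "\<exists>F. weak_star_measurable \<Omega> F \<and> (\<forall>x. norm (F x) \<le> g x) \<and>
    (\<forall>v\<in>S. AE x in lebesgue_on \<Omega>. blinfun_apply (F x) v = G v x)"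
proof -
  let ?M = "lebesgue_on \<Omega>"
  define good where "good x \<longleftrightarrow> (\<forall>u\<in>S. \<forall>v\<in>S. G (u + v) x = G u x + G v x) \<and>
    (\<forall>q\<in>\<rat>. \<forall>v\<in>S. G (q *\<^sub>R v) x = q * G v x) \<and> (\<forall>v\<in>S. \<bar>G v x\<bar> \<le> norm v * g x)" for x
  have "AE x in ?M. good x"
    unfolding good_def by (intro AE_conjI AE_ball_countable' add scale bound S(1) countable_rat)
  then obtain N where N: "{x \<in> space ?M. \<not> good x} \<subseteq> N" "emeasure ?M N = 0" "N \<in> sets ?M"
    by (rule AE_E)
  have "\<exists>F :: 'y \<Rightarrow>\<^sub>L real. norm F \<le> g x \<and> (x \<in> space ?M - N \<longrightarrow> (\<forall>v\<in>S. blinfun_apply F v = G v x)) \<and> (x \<notin> space ?M - N \<longrightarrow> F = 0)" for x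
  proof (cases "x \<in> space ?M - N")
    case True
    then have "good x" using N(1) by blast
    then have "\<exists>F :: 'y \<Rightarrow>\<^sub>L real. norm F \<le> g x \<and> (\<forall>v\<in>S. blinfun_apply F v = G v x)"
      unfolding good_def using g by (intro rational_subspace_functional_extension S) auto
    with True show ?thesis by blast
  next
    case False
    then show ?thesis using g by (intro exI[of _ 0]) auto
  qed
  then obtain F :: "real^'n \<Rightarrow> ('y \<Rightarrow>\<^sub>L real)" where F: "\<And>x. norm (F x) \<le> g x"
    "\<And>x v. x \<in> space ?M - N \<Longrightarrow> v \<in> S \<Longrightarrow> F x v = G v x" "\<And>x. x \<notin> space ?M - N \<Longrightarrow> F x = 0"
    by metis
  have mS: "(\<lambda>x. F x v) \<in> borel_measurable ?M" if v: "v \<in> S" for v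
  proof (rule measurable_cong[THEN iffD1])
    show "(\<lambda>x. if x \<in> N then 0 else G v x) \<in> borel_measurable ?M"
      using N(3) meas[OF v] by measurable
    show "(if x \<in> N then 0 else G v x) = F x v" if "x \<in> space ?M" for x
      using that F(2)[of x v] F(3)[of x] v by auto
  qed
  have "weak_star_measurable \<Omega> F"
    unfolding weak_star_measurable_def
  proof
    fix v
    obtain s where s: "\<And>n::nat. s n \<in> S" "s \<longlonglongrightarrow> v"
      using S(2) closure_sequential[of v S] by auto
    show "(\<lambda>x. F x v) \<in> borel_measurable ?M"
    proof (rule borel_measurable_LIMSEQ_real)
      show "(\<lambda>n. F x (s n)) \<longlonglongrightarrow> F x v" for x by (intro tendsto_intros s)
    qed (rule mS[OF s(1)])
  qed
  moreover have "AE x in ?M. F x v = G v x" if v: "v \<in> S" for v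
  proof -
    have "AE x in ?M. x \<notin> N" using N by (intro AE_not_in) (simp add: null_sets_def)
    moreover have "AE x in ?M. x \<in> space ?M" by (rule AE_space)
    ultimately show ?thesis by eventually_elim (use F(2) v in blast)
  qed
  ultimately show ?thesis using F(1) by blast
qed

section \<open>The metric description of both spaces\<close>

definition displacement_bound ::
    "(real^'n::finite) set \<Rightarrow> (real^'n \<Rightarrow> real) \<Rightarrow> (real^'n \<Rightarrow> 'x::metric_space) \<Rightarrow> bool" where
  "displacement_bound \<Omega> g f \<longleftrightarrow>
    (\<forall>j. \<forall>t>0. AE x in lebesgue. (\<forall>s\<in>{0..t}. x + s *\<^sub>R axis j 1 \<in> \<Omega>) \<longrightarrow>
      dist (f (x + t *\<^sub>R axis j 1)) (f x) \<le> segment_integral (axis j 1) t g x)"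

lemma displacement_bound_lipschitz:
  assumes f: "displacement_bound \<Omega> g f" and L: "0 \<le> L" "\<And>y z. dist (h y) (h z) \<le> L * dist y z"
  shows "displacement_bound \<Omega> (\<lambda>x. L * g x) (\<lambda>x. h (f x))"
  unfolding displacement_bound_def
proof (intro allI impI)
  fix j and t :: real assume "t > 0"
  then have "AE x in lebesgue. (\<forall>s\<in>{0..t}. x + s *\<^sub>R axis j 1 \<in> \<Omega>) \<longrightarrow>
      dist (f (x + t *\<^sub>R axis j 1)) (f x) \<le> segment_integral (axis j 1) t g x"
    using f by (simp add: displacement_bound_def)
  then show "AE x in lebesgue. (\<forall>s\<in>{0..t}. x + s *\<^sub>R axis j 1 \<in> \<Omega>) \<longrightarrow>
      dist (h (f (x + t *\<^sub>R axis j 1))) (h (f x)) \<le> segment_integral (axis j 1) t (\<lambda>x. L * g x) x"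
  proof eventually_elim
    case (elim x)
    then show ?case
      unfolding segment_integral_cmult using L by (meson mult_left_mono order_trans)
  qed
qed

lemma displacement_bound_isometric:
  assumes a: "isometric_embedding a" and b: "isometric_embedding b"
    and f: "displacement_bound \<Omega> g (a \<circ> f)"
  shows "displacement_bound \<Omega> g (b \<circ> f)"
  using f a b by (simp add: displacement_bound_def isometric_embedding_def)

text \<open>
  Composing with a Lipschitz function multiplies the bound on increments by its Lipschitz constant, so
  the scalar case provides the weak derivative.
\<close>

lemma displacement_bound_weak_derivative:
  fixes h :: "'v::real_normed_vector \<Rightarrow> real" and \<Omega> :: "(real^'n::finite) set"
  assumes \<Omega>: "open \<Omega>" and f: "displacement_bound \<Omega> g f" and g: "integrable lborel g" "\<And>x. 0 \<le> g x"
    and L: "0 \<le> L" "\<And>y z. dist (h y) (h z) \<le> L * dist y z"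
    and int: "integrable (lebesgue_on \<Omega>) (\<lambda>x. h (f x))"
  shows "\<exists>G. integrable (lebesgue_on \<Omega>) G \<and> (AE x in lebesgue_on \<Omega>. \<bar>G x\<bar> \<le> L * g x) \<and>
    (\<forall>\<phi>\<in>test_functions \<Omega>. (\<integral>x. partial j \<phi> x * h (f x) \<partial>lebesgue_on \<Omega>) = - (\<integral>x. \<phi> x * G x \<partial>lebesgue_on \<Omega>))"
proof (rule weak_derivative_of_segment_bound[OF \<Omega> int])
  show "AE x in lebesgue. (\<forall>s\<in>{0..t}. x + s *\<^sub>R axis j 1 \<in> \<Omega>) \<longrightarrow>
      \<bar>h (f (x + t *\<^sub>R axis j 1)) - h (f x)\<bar> \<le> segment_integral (axis j 1) t (\<lambda>x. L * g x) x" if t: "t > 0" for t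
    using displacement_bound_lipschitz[OF f L] t unfolding displacement_bound_def dist_real_def by blast
qed (use g L in auto)

lemma blinfun_lipschitz:
  fixes v' :: "'v::real_normed_vector \<Rightarrow>\<^sub>L real"
  shows "dist (v' y) (v' z) \<le> norm v' * dist y z"
  using norm_blinfun[of v' "y - z"] by (simp add: dist_norm blinfun.diff_right)

lemma Lp_vec_blinfun:
  fixes v' :: "'v::banach \<Rightarrow>\<^sub>L real" and \<Omega> :: "(real^'n::finite) set"
  assumes f: "f \<in> Lp_vec p \<Omega>" and p: "1 \<le> p"
  shows "(\<lambda>x. v' (f x)) \<in> Lp p \<Omega>"
proof (rule Lp_mono)
  show "(\<lambda>x. norm v' * norm (f x)) \<in> Lp p \<Omega>" using f by (intro Lp_cmult) (simp add: Lp_vec_def)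
  have "f \<in> borel_measurable (lebesgue_on \<Omega>)" using f by (simp add: Lp_vec_def)
  then show "(\<lambda>x. v' (f x)) \<in> borel_measurable (lebesgue_on \<Omega>)"
    by (rule measurable_compose) (intro borel_measurable_continuous_onI continuous_intros)
  show "AE x in lebesgue_on \<Omega>. \<bar>v' (f x)\<bar> \<le> \<bar>norm v' * norm (f x)\<bar>"
    using norm_blinfun[of v'] by (simp add: abs_mult)
qed (use p in auto)

text \<open>
  The Euclidean norm of the weak gradient is at most the sum of the moduli of its components, hence the
  factor \<open>CARD('n)\<close> in the bound.
\<close>

lemma R1p_of_displacement_bound:
  fixes f :: "real^'n::finite \<Rightarrow> 'v::banach"
  assumes \<Omega>: "open \<Omega>" "bounded \<Omega>" and p: "1 \<le> p" and f: "f \<in> Lp_vec p \<Omega>"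
    and g: "g \<in> Lp p \<Omega>" and g': "integrable lborel g'" "\<And>x. 0 \<le> g' x" "AE x in lebesgue_on \<Omega>. \<bar>g x\<bar> = g' x"
    and disp: "displacement_bound \<Omega> g' f"
  shows "f \<in> R1p p \<Omega>"
proof -
  have main: "\<exists>G. has_weak_gradient \<Omega> (\<lambda>x. v' (f x)) G \<and> (\<forall>j. (\<lambda>x. G x $ j) \<in> Lp p \<Omega>) \<and>
      (AE x in lebesgue_on \<Omega>. norm (G x) \<le> norm v' * (real CARD('n) * \<bar>g x\<bar>))" for v' :: "'v \<Rightarrow>\<^sub>L real"
  proof -
    have u: "integrable (lebesgue_on \<Omega>) (\<lambda>x. v' (f x))"
      by (rule Lp_integrable[OF \<Omega> Lp_vec_blinfun[OF f p] p])
    have "\<exists>G. \<forall>j. integrable (lebesgue_on \<Omega>) (G j) \<and> (AE x in lebesgue_on \<Omega>. \<bar>G j x\<bar> \<le> norm v' * g' x) \<and>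
      (\<forall>\<phi>\<in>test_functions \<Omega>. (\<integral>x. partial j \<phi> x * v' (f x) \<partial>lebesgue_on \<Omega>) = - (\<integral>x. \<phi> x * G j x \<partial>lebesgue_on \<Omega>))"
      by (rule choice)
         (intro allI displacement_bound_weak_derivative[OF \<Omega>(1) disp g'(1,2) norm_ge_zero blinfun_lipschitz u])
    then obtain G where G: "\<And>j. integrable (lebesgue_on \<Omega>) (G j)"
      "\<And>j. AE x in lebesgue_on \<Omega>. \<bar>G j x\<bar> \<le> norm v' * g' x"
      "\<And>j \<phi>. \<phi> \<in> test_functions \<Omega> \<Longrightarrow> (\<integral>x. partial j \<phi> x * v' (f x) \<partial>lebesgue_on \<Omega>) = - (\<integral>x. \<phi> x * G j x \<partial>lebesgue_on \<Omega>)"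
      by blast
    have Gg: "AE x in lebesgue_on \<Omega>. \<bar>G j x\<bar> \<le> norm v' * \<bar>g x\<bar>" for j
      using G(2)[of j] g'(3) by eventually_elim simp
    define H :: "real^'n \<Rightarrow> real^'n" where "H x = (\<chi> j. G j x)" for x
    have "has_weak_gradient \<Omega> (\<lambda>x. v' (f x)) H"
      unfolding has_weak_gradient_def using G(1,3) u
      by (simp add: H_def integrable_imp_locally_integrable[OF \<Omega>(1)])
    moreover have "(\<lambda>x. H x $ j) \<in> Lp p \<Omega>" for j
    proof (rule Lp_mono[OF Lp_cmult[OF g]])
      show "(\<lambda>x. H x $ j) \<in> borel_measurable (lebesgue_on \<Omega>)"
        using G(1)[of j] by (simp add: H_def)
      show "AE x in lebesgue_on \<Omega>. \<bar>H x $ j\<bar> \<le> \<bar>norm v' * g x\<bar>"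
        using Gg[of j] by eventually_elim (simp add: H_def abs_mult)
    qed (use p in simp)
    moreover have "AE x in lebesgue_on \<Omega>. norm (H x) \<le> norm v' * (real CARD('n) * \<bar>g x\<bar>)"
    proof -
      have "AE x in lebesgue_on \<Omega>. \<forall>j\<in>UNIV. \<bar>G j x\<bar> \<le> norm v' * \<bar>g x\<bar>"
        by (rule AE_ball_countable'[OF Gg]) simp
      then show ?thesis
      proof eventually_elim
        case (elim x)
        have "norm (H x) \<le> (\<Sum>j\<in>UNIV. \<bar>H x $ j\<bar>)" by (rule norm_le_l1_cart)
        also have "\<dots> \<le> (\<Sum>j\<in>(UNIV::'n set). norm v' * \<bar>g x\<bar>)"
          using elim by (intro sum_mono) (simp add: H_def)
        also have "\<dots> = norm v' * (real CARD('n) * \<bar>g x\<bar>)" by simp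
        finally show ?case .
      qed
    qed
    ultimately show ?thesis by blast
  qed
  show ?thesis
    unfolding R1p_def mem_Collect_eq
  proof (intro conjI allI bexI[of _ "\<lambda>x. real CARD('n) * \<bar>g x\<bar>"])
    show "(\<lambda>x. v' (f x)) \<in> W1p p \<Omega>" for v' :: "'v \<Rightarrow>\<^sub>L real"
      unfolding W1p_def using main[of v'] Lp_vec_blinfun[OF f p, of v'] by blast
    show "(\<lambda>x. real CARD('n) * \<bar>g x\<bar>) \<in> Lp p \<Omega>" by (intro Lp_cmult Lp_abs g)
    show "\<exists>G. has_weak_gradient \<Omega> (\<lambda>x. v' (f x)) G \<and>
      (AE x in lebesgue_on \<Omega>. norm (G x) \<le> norm v' * (real CARD('n) * \<bar>g x\<bar>))" for v' :: "'v \<Rightarrow>\<^sub>L real"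
      using main[of v'] by blast
  qed (rule f)
qed

lemma AE_lebesgue_translate:
  assumes "AE x in lebesgue. P x"
  shows "AE x in lebesgue. P (x + a)"
proof -
  have "AE x in distr lebesgue lebesgue ((+) a). P x" using assms by (simp only: lebesgue_distr_plus)
  then have "AE x in lebesgue. P (a + x)" by (rule AE_distrD[OF plus_measurable_lebesgue])
  then show ?thesis by (simp add: add.commute)
qed

text \<open>
  For points \<open>a\<close>, \<open>b\<close> of a countable dense subset of the essential range take a functional of norm at most
  \<open>1\<close> that norms \<open>a - b\<close>. If \<open>y\<close> is close to \<open>a\<close> and \<open>z\<close> to \<open>b\<close>, this functional nearly norms \<open>y - z\<close>, so
  the bounds on the increments of these countably many functionals bound the distance of \<open>y\<close> and \<open>z\<close>.
\<close>

lemma R1p_imp_displacement_bound: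
  fixes f :: "real^'n::finite \<Rightarrow> 'v::banach"
  assumes \<Omega>: "open \<Omega>" "bounded \<Omega>" and p: "1 \<le> p" and f: "f \<in> R1p p \<Omega>"
  obtains g g' where "g \<in> Lp p \<Omega>" "integrable lborel g'" "\<And>x. 0 \<le> g' x"
    "AE x in lebesgue_on \<Omega>. \<bar>g x\<bar> = g' x" "displacement_bound \<Omega> g' f"
proof -
  have fL: "f \<in> Lp_vec p \<Omega>" using f by (simp add: R1p_def)
  obtain g where g: "g \<in> Lp p \<Omega>" and grad: "\<And>v' :: 'v \<Rightarrow>\<^sub>L real. \<exists>G.
      has_weak_gradient \<Omega> (\<lambda>x. blinfun_apply v' (f x)) G \<and> (AE x in lebesgue_on \<Omega>. norm (G x) \<le> norm v' * g x)"
    using f unfolding R1p_def by blast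
  obtain g' where g': "integrable lborel g'" "\<And>x. 0 \<le> g' x" "AE x in lebesgue_on \<Omega>. \<bar>g x\<bar> = g' x"
    using Lp_borel_majorant[OF \<Omega> g p] by metis
  obtain N C where N: "N \<in> null_sets lebesgue" and C: "countable C" "f ` (\<Omega> - N) \<subseteq> closure C"
    using fL unfolding Lp_vec_def essentially_separably_valued_def separable_top_of_set_iff by blast
  have "\<exists>v' :: 'v \<Rightarrow>\<^sub>L real. norm v' \<le> 1 \<and> blinfun_apply v' (a - b) = norm (a - b)" for a b :: 'v
    using norming_functional[of "a - b"] by metis
  then obtain v where v: "\<And>a b. norm (v a b :: 'v \<Rightarrow>\<^sub>L real) \<le> 1" "\<And>a b. blinfun_apply (v a b) (a - b) = norm (a - b)"
    by metis
  have "displacement_bound \<Omega> g' f"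
    unfolding displacement_bound_def
  proof (intro allI impI)
    fix j :: 'n and t :: real assume t: "t > 0"
    let ?e = "axis j 1 :: real^'n"
    let ?I = "segment_integral ?e t g'"
    have one: "AE x in lebesgue. (\<forall>s\<in>{0..t}. x + s *\<^sub>R ?e \<in> \<Omega>) \<longrightarrow>
        \<bar>v a b (f (x + t *\<^sub>R ?e)) - v a b (f x)\<bar> \<le> ?I x" for a b
    proof -
      obtain G where G: "has_weak_gradient \<Omega> (\<lambda>x. v a b (f x)) G"
        "AE x in lebesgue_on \<Omega>. norm (G x) \<le> norm (v a b) * g x" using grad by blast
      have u: "integrable (lebesgue_on \<Omega>) (\<lambda>x. v a b (f x))"
        by (rule Lp_integrable[OF \<Omega> Lp_vec_blinfun[OF fL p] p])
      show ?thesis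
      proof (rule segment_bound_of_weak_derivative[OF \<Omega>(1) less_imp_le[OF t] u g'(1,2), where G = "\<lambda>x. G x $ j"])
        show "AE x in lebesgue_on \<Omega>. \<bar>G x $ j\<bar> \<le> g' x"
          using G(2) g'(3)
        proof eventually_elim
          case (elim x)
          have "\<bar>G x $ j\<bar> \<le> norm (G x)" by (rule component_le_norm_cart)
          also have "\<dots> \<le> norm (v a b) * \<bar>g x\<bar>"
            using elim(1) by (meson abs_ge_self mult_left_mono norm_ge_zero order_trans)
          also have "\<dots> \<le> 1 * \<bar>g x\<bar>" using v(1) by (intro mult_right_mono) auto
          finally show ?case using elim(2) by simp
        qed
        show "(\<integral>x. partial j \<phi> x * v a b (f x) \<partial>lebesgue_on \<Omega>) = - (\<integral>x. \<phi> x * G x $ j \<partial>lebesgue_on \<Omega>)"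
          if "\<phi> \<in> test_functions \<Omega>" for \<phi>
          using G(1) that by (simp add: has_weak_gradient_def)
      qed
    qed
    have all: "AE x in lebesgue. \<forall>a\<in>C. \<forall>b\<in>C. (\<forall>s\<in>{0..t}. x + s *\<^sub>R ?e \<in> \<Omega>) \<longrightarrow>
        \<bar>v a b (f (x + t *\<^sub>R ?e)) - v a b (f x)\<bar> \<le> ?I x"
      by (intro AE_ball_countable' one C(1))
    have N0: "AE x in lebesgue. x \<notin> N" using N by (rule AE_not_in)
    show "AE x in lebesgue. (\<forall>s\<in>{0..t}. x + s *\<^sub>R ?e \<in> \<Omega>) \<longrightarrow> dist (f (x + t *\<^sub>R ?e)) (f x) \<le> ?I x"
      using all N0 AE_lebesgue_translate[OF N0, of "t *\<^sub>R ?e"]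
    proof eventually_elim
      case (elim x)
      show ?case
      proof
        assume seg: "\<forall>s\<in>{0..t}. x + s *\<^sub>R ?e \<in> \<Omega>"
        define y where "y = f (x + t *\<^sub>R ?e)"
        define z where "z = f x"
        have "x \<in> \<Omega>" "x + t *\<^sub>R ?e \<in> \<Omega>" using seg t by (auto dest: bspec[of _ _ 0] bspec[of _ _ t])
        then have yz: "y \<in> closure C" "z \<in> closure C"
          using C(2) elim(2,3) by (auto simp: y_def z_def)
        show "dist (f (x + t *\<^sub>R ?e)) (f x) \<le> ?I x"
          unfolding y_def[symmetric] z_def[symmetric]
        proof (rule field_le_epsilon)
          fix \<epsilon> :: real assume \<epsilon>: "\<epsilon> > 0"
          obtain a where a: "a \<in> C" "dist a y < \<epsilon> / 4"
            using yz(1) \<epsilon> unfolding closure_approachable by (metis divide_pos_pos zero_less_numeral)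
          obtain b where b: "b \<in> C" "dist b z < \<epsilon> / 4"
            using yz(2) \<epsilon> unfolding closure_approachable by (metis divide_pos_pos zero_less_numeral)
          have le1: "\<bar>v a b w\<bar> \<le> norm w" for w
            using norm_blinfun[of "v a b" w] mult_right_mono[OF v(1)[of a b] norm_ge_zero[of w]] by simp
          have "norm (a - b) = v a b (a - y) + (v a b y - v a b z) + v a b (z - b)"
            unfolding v(2)[symmetric] by (simp add: blinfun.diff_right)
          also have "\<dots> \<le> norm (a - y) + ?I x + norm (z - b)"
            using le1[of "a - y"] le1[of "z - b"] elim(1) a(1) b(1) seg unfolding y_def z_def by fastforce
          finally have "dist a b \<le> ?I x + \<epsilon> / 2"
            using a(2) b(2) by (simp add: dist_norm norm_minus_commute)
          moreover have "dist y z \<le> dist a y + dist a b + dist b z"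
            using dist_triangle[of y z a] dist_triangle[of a z b] by (simp add: dist_commute)
          ultimately show "dist y z \<le> ?I x + \<epsilon>" using a(2) b(2) by linarith
        qed
      qed
    qed
  qed
  with g g' show ?thesis using that by blast
qed

lemma has_gelfand_integralD:
  assumes "has_gelfand_integral h T \<Omega>"
  shows "blinfun_apply T v = (\<integral>x. blinfun_apply (h x) v \<partial>lebesgue_on \<Omega>)"
  using assms by (simp add: has_gelfand_integral_def)

text \<open>
  The sum of the norms of the weak-star derivatives bounds the weak derivatives of \<open>\<langle>v, f\<rangle>\<close> up to the
  factor \<open>norm v\<close>, and a countable dense set of vectors \<open>v\<close> determines the norm of \<open>f (x + t e\<^sub>j) - f x\<close>.
\<close>

lemma W1p_star_imp_displacement_bound:
  fixes f :: "real^'n::finite \<Rightarrow> ('y::banach \<Rightarrow>\<^sub>L real)"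
  assumes \<Omega>: "open \<Omega>" "bounded \<Omega>" and p: "1 \<le> p"
    and sep: "separable_space (euclidean :: 'y topology)" and f: "f \<in> W1p_star p \<Omega>"
  obtains g g' where "g \<in> Lp p \<Omega>" "integrable lborel g'" "\<And>x. 0 \<le> g' x"
    "AE x in lebesgue_on \<Omega>. \<bar>g x\<bar> = g' x" "displacement_bound \<Omega> g' f"
proof -
  have fL: "f \<in> Lp_vec p \<Omega>" using f by (simp add: W1p_star_def)
  have "\<exists>f'. \<forall>j. f' j \<in> Lp_star p \<Omega> \<and> (\<forall>\<phi>\<in>test_functions \<Omega>. \<exists>S T.
      has_gelfand_integral (\<lambda>x. partial j \<phi> x *\<^sub>R f x) S \<Omega> \<and> has_gelfand_integral (\<lambda>x. \<phi> x *\<^sub>R f' j x) T \<Omega> \<and> S = - T)"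
    by (rule choice) (use f in \<open>simp add: W1p_star_def\<close>)
  then obtain f' where f': "\<And>j. f' j \<in> Lp_star p \<Omega>" and weak: "\<And>j \<phi>. \<phi> \<in> test_functions \<Omega> \<Longrightarrow> \<exists>S T.
      has_gelfand_integral (\<lambda>x. partial j \<phi> x *\<^sub>R f x) S \<Omega> \<and> has_gelfand_integral (\<lambda>x. \<phi> x *\<^sub>R f' j x) T \<Omega> \<and> S = - T"
    by blast
  define g where "g x = (\<Sum>j\<in>UNIV. norm (f' j x))" for x
  have g: "g \<in> Lp p \<Omega>"
    unfolding g_def using f' p by (intro Lp_sum) (auto simp: Lp_star_def)
  obtain g' where g': "integrable lborel g'" "\<And>x. 0 \<le> g' x" "AE x in lebesgue_on \<Omega>. \<bar>g x\<bar> = g' x"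
    using Lp_borel_majorant[OF \<Omega> g p] by metis
  obtain S :: "'y set" where S: "countable S" "closure S = UNIV"
    using sep by (auto simp: separable_space_def)
  have "displacement_bound \<Omega> g' f"
    unfolding displacement_bound_def
  proof (intro allI impI)
    fix j :: 'n and t :: real assume t: "t > 0"
    let ?e = "axis j 1 :: real^'n"
    let ?I = "segment_integral ?e t g'"
    have one: "AE x in lebesgue. (\<forall>s\<in>{0..t}. x + s *\<^sub>R ?e \<in> \<Omega>) \<longrightarrow>
        \<bar>f (x + t *\<^sub>R ?e) v - f x v\<bar> \<le> norm v * ?I x" for v
      unfolding segment_integral_cmult[symmetric]
    proof (rule segment_bound_of_weak_derivative[OF \<Omega>(1) less_imp_le[OF t], where G = "\<lambda>x. f' j x v"])
      have "(\<lambda>x. f x v) \<in> Lp p \<Omega>"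
      proof (rule Lp_mono)
        show "(\<lambda>x. norm v * norm (f x)) \<in> Lp p \<Omega>" using fL by (intro Lp_cmult) (simp add: Lp_vec_def)
        have "f \<in> borel_measurable (lebesgue_on \<Omega>)" using fL by (simp add: Lp_vec_def)
        then show "(\<lambda>x. f x v) \<in> borel_measurable (lebesgue_on \<Omega>)"
          by (rule measurable_compose) (intro borel_measurable_continuous_onI continuous_intros)
        show "AE x in lebesgue_on \<Omega>. \<bar>f x v\<bar> \<le> \<bar>norm v * norm (f x)\<bar>"
          using norm_blinfun[of "f _" v] by (simp add: abs_mult mult.commute)
      qed (use p in auto)
      then show "integrable (lebesgue_on \<Omega>) (\<lambda>x. f x v)" by (rule Lp_integrable[OF \<Omega> _ p])
      show "AE x in lebesgue_on \<Omega>. \<bar>f' j x v\<bar> \<le> norm v * g' x"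
        using g'(3)
      proof eventually_elim
        case (elim x)
        have "\<bar>f' j x v\<bar> \<le> norm (f' j x) * norm v" using norm_blinfun[of "f' j x" v] by simp
        also have "\<dots> \<le> g x * norm v"
          unfolding g_def by (intro mult_right_mono member_le_sum) auto
        also have "\<dots> \<le> norm v * g' x" using elim by (simp add: mult.commute mult_left_mono flip: elim)
        finally show ?case .
      qed
      show "(\<integral>x. partial j \<phi> x * f x v \<partial>lebesgue_on \<Omega>) = - (\<integral>x. \<phi> x * f' j x v \<partial>lebesgue_on \<Omega>)"
        if \<phi>: "\<phi> \<in> test_functions \<Omega>" for \<phi>
      proof -
        obtain A B where AB: "has_gelfand_integral (\<lambda>x. partial j \<phi> x *\<^sub>R f x) A \<Omega>"
          "has_gelfand_integral (\<lambda>x. \<phi> x *\<^sub>R f' j x) B \<Omega>" "A = - B"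
          using weak[OF \<phi>] by blast
        have "A v = - B v" using AB(3) by (simp add: blinfun.minus_left)
        then show ?thesis
          unfolding has_gelfand_integralD[OF AB(1)] has_gelfand_integralD[OF AB(2)]
          by (simp add: blinfun.scaleR_left)
      qed
    qed (use g' in auto)
    have "AE x in lebesgue. \<forall>v\<in>S. (\<forall>s\<in>{0..t}. x + s *\<^sub>R ?e \<in> \<Omega>) \<longrightarrow>
        \<bar>f (x + t *\<^sub>R ?e) v - f x v\<bar> \<le> norm v * ?I x"
      by (intro AE_ball_countable' one S(1))
    then show "AE x in lebesgue. (\<forall>s\<in>{0..t}. x + s *\<^sub>R ?e \<in> \<Omega>) \<longrightarrow> dist (f (x + t *\<^sub>R ?e)) (f x) \<le> ?I x"
    proof eventually_elim
      case (elim x)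
      show ?case
      proof
        assume seg: "\<forall>s\<in>{0..t}. x + s *\<^sub>R ?e \<in> \<Omega>"
        have "norm (f (x + t *\<^sub>R ?e) - f x) \<le> ?I x"
        proof (rule norm_blinfun_le_dense[OF S(2)])
          show "0 \<le> ?I x" by (rule segment_integral_nonneg[OF g'(2)])
          show "\<bar>blinfun_apply (f (x + t *\<^sub>R ?e) - f x) v\<bar> \<le> norm v * ?I x" if "v \<in> S" for v
            using elim seg that by (simp add: blinfun.diff_left)
        qed
        then show "dist (f (x + t *\<^sub>R ?e)) (f x) \<le> ?I x" by (simp add: dist_norm)
      qed
    qed
  qed
  with g g' show ?thesis using that by blast
qed

lemma weak_star_measurable_scaleR:
  assumes "weak_star_measurable \<Omega> h" "smooth \<phi>"
  shows "weak_star_measurable \<Omega> (\<lambda>x. \<phi> x *\<^sub>R h x)"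
  using assms smooth_measurable(3)[OF assms(2), of \<Omega>]
  by (auto simp: weak_star_measurable_def blinfun.scaleR_left intro!: borel_measurable_times)

lemma gelfand_integral_test_function_exists:
  fixes h :: "real^'n::finite \<Rightarrow> ('y::banach \<Rightarrow>\<^sub>L real)"
  assumes \<phi>: "\<phi> \<in> test_functions \<Omega>" and h: "weak_star_measurable \<Omega> h" and b: "integrable (lebesgue_on \<Omega>) b"
    and le: "AE x in lebesgue_on \<Omega>. norm (h x) \<le> b x"
  shows "\<exists>T. has_gelfand_integral (\<lambda>x. \<phi> x *\<^sub>R h x) T \<Omega>"
proof -
  obtain B where B: "B \<ge> 0" "\<And>x. \<bar>\<phi> x\<bar> \<le> B" using test_function_bounded[OF \<phi>] by metis
  show ?thesis
  proof (rule has_gelfand_integral_exists)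
    show "weak_star_measurable \<Omega> (\<lambda>x. \<phi> x *\<^sub>R h x)"
      by (rule weak_star_measurable_scaleR[OF h test_function_smooth[OF \<phi>]])
    show "integrable (lebesgue_on \<Omega>) (\<lambda>x. B * b x)" using b by simp
    show "AE x in lebesgue_on \<Omega>. norm (\<phi> x *\<^sub>R h x) \<le> B * b x"
      using le by eventually_elim (auto intro!: mult_mono B)
  qed
qed

text \<open>
  The weak derivatives of \<open>\<langle>v, f\<rangle>\<close> for \<open>v\<close> in a countable dense rational subspace are assembled into one
  function with values in the dual. The two Gelfand integrals agree up to sign on this subspace, and by
  density everywhere.
\<close>

lemma W1p_star_of_displacement_bound:
  fixes f :: "real^'n::finite \<Rightarrow> ('y::banach \<Rightarrow>\<^sub>L real)"
  assumes \<Omega>: "open \<Omega>" "bounded \<Omega>" and p: "1 \<le> p"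
    and sep: "separable_space (euclidean :: 'y topology)" and f: "f \<in> Lp_vec p \<Omega>"
    and g: "g \<in> Lp p \<Omega>" and g': "integrable lborel g'" "\<And>x. 0 \<le> g' x" "AE x in lebesgue_on \<Omega>. \<bar>g x\<bar> = g' x"
    and disp: "displacement_bound \<Omega> g' f"
  shows "f \<in> W1p_star p \<Omega>"
proof -
  let ?M = "lebesgue_on \<Omega>"
  obtain S :: "'y set" where S: "countable S" "closure S = UNIV"
    "\<And>u v. u \<in> S \<Longrightarrow> v \<in> S \<Longrightarrow> u + v \<in> S" "\<And>q v. q \<in> \<rat> \<Longrightarrow> v \<in> S \<Longrightarrow> q *\<^sub>R v \<in> S"
    using countable_dense_rational_subspace[OF sep] by metis
  have fm: "f \<in> borel_measurable ?M" using f by (simp add: Lp_vec_def)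
  have wm: "weak_star_measurable \<Omega> f"
    unfolding weak_star_measurable_def
    by (intro allI measurable_compose[OF fm] borel_measurable_continuous_onI continuous_intros)
  have nf: "integrable ?M (\<lambda>x. norm (f x))"
    using f by (intro Lp_integrable[OF \<Omega> _ p]) (simp add: Lp_vec_def)
  have u: "integrable ?M (\<lambda>x. f x v)" for v
  proof (rule Bochner_Integration.integrable_bound)
    show "integrable ?M (\<lambda>x. norm (f x) * norm v)" using nf by simp
    show "(\<lambda>x. f x v) \<in> borel_measurable ?M" using wm by (simp add: weak_star_measurable_def)
    show "AE x in ?M. norm (f x v) \<le> norm (norm (f x) * norm v)" using norm_blinfun[of "f _" v] by simp
  qed
  have lip: "dist (blinfun_apply y v) (blinfun_apply z v) \<le> norm v * dist y z" for y z :: "'y \<Rightarrow>\<^sub>L real" and v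
    using norm_blinfun[of "y - z" v] by (simp add: dist_norm blinfun.diff_left mult.commute)
  have gi: "integrable ?M (\<lambda>x. \<bar>g x\<bar>)" using Lp_integrable[OF \<Omega> g p] by simp
  have main: "\<exists>F. F \<in> Lp_star p \<Omega> \<and> (\<forall>\<phi>\<in>test_functions \<Omega>. \<exists>A B.
      has_gelfand_integral (\<lambda>x. partial j \<phi> x *\<^sub>R f x) A \<Omega> \<and> has_gelfand_integral (\<lambda>x. \<phi> x *\<^sub>R F x) B \<Omega> \<and> A = - B)" for j
  proof -
    have "\<exists>G. \<forall>v. integrable ?M (G v) \<and> (AE x in ?M. \<bar>G v x\<bar> \<le> norm v * g' x) \<and>
      (\<forall>\<phi>\<in>test_functions \<Omega>. (\<integral>x. partial j \<phi> x * f x v \<partial>?M) = - (\<integral>x. \<phi> x * G v x \<partial>?M))"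
      by (rule choice)
         (intro allI displacement_bound_weak_derivative[OF \<Omega>(1) disp g'(1,2) norm_ge_zero lip u])
    then obtain G where G: "\<And>v. integrable ?M (G v)"
      "\<And>v. AE x in ?M. \<bar>G v x\<bar> \<le> norm v * g' x"
      "\<And>v \<phi>. \<phi> \<in> test_functions \<Omega> \<Longrightarrow> (\<integral>x. partial j \<phi> x * f x v \<partial>?M) = - (\<integral>x. \<phi> x * G v x \<partial>?M)"
      by blast
    \<comment> \<open>Uniqueness of weak derivatives makes the chosen \<open>G\<close> linear in \<open>v\<close>, up to a null set that depends on
      the linear combination.\<close>
    have lin: "AE x in ?M. G (a *\<^sub>R v + b *\<^sub>R w) x = a * G v x + b * G w x" for a b v w
    proof -
      have "AE x in ?M. G (a *\<^sub>R v + b *\<^sub>R w) x - (a * G v x + b * G w x) = 0"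
      proof (rule weakly_zero_imp_AE_zero[OF \<Omega>(1)])
        show "integrable ?M (\<lambda>x. G (a *\<^sub>R v + b *\<^sub>R w) x - (a * G v x + b * G w x))" using G(1) by auto
        fix \<phi> assume \<phi>: "\<phi> \<in> test_functions \<Omega>"
        note i = test_function_integrable_mult_on[OF \<phi> G(1)] test_function_integrable_mult_on[OF test_function_partial[OF \<phi>] u]
        have "(\<integral>x. \<phi> x * (G (a *\<^sub>R v + b *\<^sub>R w) x - (a * G v x + b * G w x)) \<partial>?M) =
           (\<integral>x. \<phi> x * G (a *\<^sub>R v + b *\<^sub>R w) x - (a * (\<phi> x * G v x) + b * (\<phi> x * G w x)) \<partial>?M)"
          by (simp add: algebra_simps)
        also have "\<dots> = (\<integral>x. \<phi> x * G (a *\<^sub>R v + b *\<^sub>R w) x \<partial>?M) - (a * (\<integral>x. \<phi> x * G v x \<partial>?M) + b * (\<integral>x. \<phi> x * G w x \<partial>?M))"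
          using i(1) by simp
        also have "\<dots> = - (\<integral>x. partial j \<phi> x * f x (a *\<^sub>R v + b *\<^sub>R w) \<partial>?M) +
           (a * (\<integral>x. partial j \<phi> x * f x v \<partial>?M) + b * (\<integral>x. partial j \<phi> x * f x w \<partial>?M))"
          using G(3)[OF \<phi>] by simp
        also have "(\<integral>x. partial j \<phi> x * f x (a *\<^sub>R v + b *\<^sub>R w) \<partial>?M) =
           (\<integral>x. a * (partial j \<phi> x * f x v) + b * (partial j \<phi> x * f x w) \<partial>?M)"
          by (simp add: blinfun.add_right blinfun.scaleR_right algebra_simps)
        also have "\<dots> = a * (\<integral>x. partial j \<phi> x * f x v \<partial>?M) + b * (\<integral>x. partial j \<phi> x * f x w \<partial>?M)"
          using i(2) by simp
        finally show "(\<integral>x. \<phi> x * (G (a *\<^sub>R v + b *\<^sub>R w) x - (a * G v x + b * G w x)) \<partial>?M) = 0" by simp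
      qed
      then show ?thesis by eventually_elim simp
    qed
    have "\<exists>F. weak_star_measurable \<Omega> F \<and> (\<forall>x. norm (F x) \<le> g' x) \<and>
        (\<forall>v\<in>S. AE x in ?M. blinfun_apply (F x) v = G v x)"
    proof (rule weak_star_function_from_dense_subspace[OF S])
      show "G v \<in> borel_measurable ?M" for v using G(1) by auto
      show "AE x in ?M. G (v + w) x = G v x + G w x" for v w using lin[of 1 v 1 w] by simp
      show "AE x in ?M. G (q *\<^sub>R v) x = q * G v x" for q v using lin[of q v 0 v] by simp
    qed (use G(2) g'(2) in auto)
    then obtain F where F: "weak_star_measurable \<Omega> F" "\<And>x. norm (F x) \<le> g' x"
      "\<And>v. v \<in> S \<Longrightarrow> AE x in ?M. blinfun_apply (F x) v = G v x" by blast
    have Fg: "AE x in ?M. norm (F x) \<le> \<bar>g x\<bar>"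
      using g'(3) by eventually_elim (use F(2) in auto)
    have "F \<in> Lp_star p \<Omega>"
      unfolding Lp_star_def using F(1) Fg p
      by (auto intro!: Lp_mono[OF g] weak_star_measurable_norm[OF S(1,2)])
    moreover have "\<exists>A B. has_gelfand_integral (\<lambda>x. partial j \<phi> x *\<^sub>R f x) A \<Omega> \<and>
       has_gelfand_integral (\<lambda>x. \<phi> x *\<^sub>R F x) B \<Omega> \<and> A = - B" if \<phi>: "\<phi> \<in> test_functions \<Omega>" for \<phi>
    proof -
      obtain A where A: "has_gelfand_integral (\<lambda>x. partial j \<phi> x *\<^sub>R f x) A \<Omega>"
        using gelfand_integral_test_function_exists[OF test_function_partial[OF \<phi>] wm nf] by auto
      obtain B where B: "has_gelfand_integral (\<lambda>x. \<phi> x *\<^sub>R F x) B \<Omega>"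
        using gelfand_integral_test_function_exists[OF \<phi> F(1) gi Fg] by auto
      have "A = - B"
      proof (rule blinfun_eq_dense[OF S(2)])
        fix v assume v: "v \<in> S"
        have m: "(\<lambda>x. F x v) \<in> borel_measurable ?M" "G v \<in> borel_measurable ?M" "\<phi> \<in> borel_measurable ?M"
          using F(1) G(1) smooth_measurable(3)[OF test_function_smooth[OF \<phi>]] by (auto simp: weak_star_measurable_def)
        have "A v = (\<integral>x. partial j \<phi> x * f x v \<partial>?M)"
          unfolding has_gelfand_integralD[OF A] by (simp add: blinfun.scaleR_left)
        also have "\<dots> = - (\<integral>x. \<phi> x * G v x \<partial>?M)" by (rule G(3)[OF \<phi>])
        also have "(\<integral>x. \<phi> x * G v x \<partial>?M) = (\<integral>x. \<phi> x * F x v \<partial>?M)"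
        proof (rule integral_cong_AE)
          show "AE x in ?M. \<phi> x * G v x = \<phi> x * F x v" using F(3)[OF v] by eventually_elim simp
        qed (use m in auto)
        also have "\<dots> = B v" unfolding has_gelfand_integralD[OF B] by (simp add: blinfun.scaleR_left)
        finally show "A v = (- B) v" by (simp add: blinfun.minus_left)
      qed
      with A B show ?thesis by blast
    qed
    ultimately show ?thesis by blast
  qed
  then show ?thesis using f by (simp add: W1p_star_def)
qed

theorem theorem4p2:
  fixes \<Omega> :: "(real^'n::finite) set"
    and p :: real
    and \<iota>\<^sub>0 :: "'x::complete_space \<Rightarrow> 'v::banach"
    and \<iota> :: "'x \<Rightarrow> ('y::banach \<Rightarrow>\<^sub>L real)"
  assumes "open \<Omega>" and "connected \<Omega>" and "bounded \<Omega>"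
    and "1 \<le> p"
    and "separable_space (euclidean :: 'y topology)"
    and "isometric_embedding \<iota>\<^sub>0"
    and "isometric_embedding \<iota>"
  shows "R1p_metric \<iota>\<^sub>0 p \<Omega> = {f. \<iota> \<circ> f \<in> W1p_star p \<Omega>}"
proof -
  note \<Omega> = \<open>open \<Omega>\<close> \<open>bounded \<Omega>\<close>
  have "\<iota>\<^sub>0 \<circ> f \<in> R1p p \<Omega> \<longleftrightarrow> \<iota> \<circ> f \<in> W1p_star p \<Omega>" for f
  proof
    assume R: "\<iota>\<^sub>0 \<circ> f \<in> R1p p \<Omega>"
    then have L: "\<iota> \<circ> f \<in> Lp_vec p \<Omega>"
      by (intro isometric_Lp_vec_transfer[OF \<Omega> assms(4,6,7)]) (simp add: R1p_def)
    from R show "\<iota> \<circ> f \<in> W1p_star p \<Omega>"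
    proof (rule R1p_imp_displacement_bound[OF \<Omega> assms(4)])
      fix g g' assume "g \<in> Lp p \<Omega>" "integrable lborel g'" "\<And>x. 0 \<le> g' x"
        "AE x in lebesgue_on \<Omega>. \<bar>g x\<bar> = g' x" "displacement_bound \<Omega> g' (\<iota>\<^sub>0 \<circ> f)"
      then show ?thesis
        by (intro W1p_star_of_displacement_bound[OF \<Omega> assms(4,5) L])
           (auto intro: displacement_bound_isometric[OF assms(6,7)])
    qed
  next
    assume W: "\<iota> \<circ> f \<in> W1p_star p \<Omega>"
    then have L: "\<iota>\<^sub>0 \<circ> f \<in> Lp_vec p \<Omega>"
      by (intro isometric_Lp_vec_transfer[OF \<Omega> assms(4,7,6)]) (simp add: W1p_star_def)
    from W show "\<iota>\<^sub>0 \<circ> f \<in> R1p p \<Omega>"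
    proof (rule W1p_star_imp_displacement_bound[OF \<Omega> assms(4,5)])
      fix g g' assume "g \<in> Lp p \<Omega>" "integrable lborel g'" "\<And>x. 0 \<le> g' x"
        "AE x in lebesgue_on \<Omega>. \<bar>g x\<bar> = g' x" "displacement_bound \<Omega> g' (\<iota> \<circ> f)"
      then show ?thesis
        by (intro R1p_of_displacement_bound[OF \<Omega> assms(4) L])
           (auto intro: displacement_bound_isometric[OF assms(7,6)])
    qed
  qed
  then show ?thesis by (auto simp: R1p_metric_def)
qed

end
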